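(* Let $0<k<n$, let $\mu\subseteq\lambda$ be partitions fitting inside a $k\times(n-k)$-rectangle, and let $1\le a\le n-k$. Assume that all boxes in the $a$-th column from the right in $\lambda/\mu$ belong to the boundary ribbon $R(\lambda/\mu)$. Then the open subset $$U_a=\{V\in S^\circ_{\lambda/\mu}:\Delta_{I'(a,i)}(V)\ne0\text{ for }\overline\mu_a+1\le i\le\overline\lambda_a\}$$ coincides with the whole skew shaped positroid $S^\circ_{\lambda/\mu}$, and there is an isomorphism $$S^\circ_{\lambda/\mu}\simeq S^\circ_{\lambda^{a,R}/\mu^{a,R}}\times S^\circ_{\lambda^{a,L}/\mu^{a,L}}.$$
   Context: **Diagrams.** Partitions $\lambda=(\lambda_1\ge\dots\ge\lambda_k\ge0)$ with $\lambda_1\le n-k$ are drawn in the French convention (left and bottom justified) in the rectangle with $k$ rows (numbered from the bottom) and $n-k$ columns. $\lambda^t$ is the conjugate partition, and $\overline\lambda_a:=\lambda^t_{n-k+1-a}$ is the height of the $a$-th column from the right (similarly $\overline\mu_a$). $\square_{a,i}$ is the $i$-th box from the bottom in the $a$-th column from the right; $\square_{a,i}\in\lambda/\mu$ iff $\overline\mu_a<i\le\overline\lambda_a$. Let $b_i=n-k-\mu_i+i$ and $I_\mu=\{b_1<\dots<b_k\}$. Put $I'(a,i)=\{a_1,\dots,a_i,b_{i+1},\dots,b_k\}$ where $a_j=\min\{a+j-1,b_j\}$. The boundary ribbon $R(\lambda/\mu)$ is the set of boxes $\square_{a,i}\in\lambda/\mu$ such that the box immediately to the northeast, $\square_{a-1,i+1}$,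 is not in $\lambda$. **Cut diagrams.** $\lambda^{a,R}_i=\max(\lambda_i-(n-k-a+1),0)$ (the first $a-1$ columns of $\lambda$ from the right), a partition in a $k\times(a-1)$-rectangle; $\lambda^{a,L}_i=\min(\lambda_i,n-k-a+1)$ (columns $a,\dots,n-k$ from the right), a partition in a $k\times(n-k-a+1)$-rectangle; similarly for $\mu$. Thus $S^\circ_{\lambda^{a,R}/\mu^{a,R}}\subseteq\mathrm{Gr}(k,k+a-1)$ and $S^\circ_{\lambda^{a,L}/\mu^{a,L}}\subseteq\mathrm{Gr}(k,n-a+1)$ (for $a=1$ the former is the point $\mathrm{Gr}(k,k)$). **Skew shaped positroid.** $S^\circ_{\lambda/\mu}$ is the open Richardson variety $(\mathsf Bw_\mu\mathsf B/\mathsf B)\cap(\mathsf B_-w_\lambda\mathsf B/\mathsf B)$ in the flag variety $\mathrm{GL}(n)/\mathsf B$ ($\mathsf B,\mathsf B_-$ upper/lower triangular matrices), where $w_\lambda(i)=n-k-\lambda_i+i$ for $1\le i\le k$ and $w_\lambda(k+c)=c+\overline\lambda_c$ for $1\le c\le n-k$. It is identified (Knutson–Lam–Speyer) with, and regarded as, the open positroid variety $\Pi_f^\circ=\{V\in\mathrm{Gr}(k,n):f_V=f\}$, where $f:\mathbb Z\to\mathbb Z$ satisfies $f(i+n)=f(i)+n$, $f(c+\overline\mu_c)=c+\overline\lambda_c$ ($1\le c\le n-k$), $f(b_i)=n-k-\lambda_i+i+n$ ($1\le i\le k$). Here $V$ is represented by a rank $k$ matrix of size $k\times n$ with columns $v_1,\dots,v_n\in\mathbb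 C^k$ up to row operations, extended by $v_{i+n}=(-1)^{k-1}v_i$, and $f_V(i)=\min\{j\ge i:v_i\in\mathrm{span}(v_{i+1},\dots,v_j)\}$. $\Delta_I(V)$ is the maximal minor in columns $I$. *)

theory Defs
  imports
    "Jordan_Normal_Form.DL_Rank"
    "Jordan_Normal_Form.DL_Submatrix"
    "HOL-Library.Multiset"
    "HOL-Analysis.Abstract_Topology"
begin

section \<open>Embedded varieties over the complex numbers\<close>

text \<open>
  A quasi-projective variety is given by a set \<open>X\<close> of points and a function \<open>h\<close> assigning to
  each point a vector \<open>h p\<close> of homogeneous coordinates. Everything below only depends on the
  coordinate vectors up to nonzero scalars. Coordinates are indexed by a whole type; in the
  applications all but finitely many of them vanish identically.
\<close>

definition homogeneous_form :: "nat \<Rightarrow> (('i \<Rightarrow> complex) \<Rightarrow> complex) \<Rightarrow> bool" where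
  "homogeneous_form d F \<longleftrightarrow>
     (\<exists>S c. finite S \<and> (\<forall>m\<in>S. size m = d) \<and>
        F = (\<lambda>x. \<Sum>m\<in>S. c m * (\<Prod>i\<in>#m. x i)))"

definition zariski :: "('p \<Rightarrow> 'i \<Rightarrow> complex) \<Rightarrow> 'p set \<Rightarrow> 'p topology" where
  "zariski h X =
     topology_generated_by {{p\<in>X. F (h p) \<noteq> 0} | F. \<exists>d. homogeneous_form d F}"

definition regular_on ::
    "('p \<Rightarrow> 'i \<Rightarrow> complex) \<Rightarrow> 'p set \<Rightarrow> ('p \<Rightarrow> complex) \<Rightarrow> bool" where
  "regular_on h X f \<longleftrightarrow>
     (\<forall>p\<in>X. \<exists>W d P Q. openin (zariski h X) W \<and> p \<in> W \<and>
        homogeneous_form d P \<and> homogeneous_form d Q \<and>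
        (\<forall>q\<in>W. Q (h q) \<noteq> 0 \<and> f q = P (h q) / Q (h q)))"

definition variety_morphism ::
    "('p \<Rightarrow> 'i \<Rightarrow> complex) \<Rightarrow> 'p set \<Rightarrow> ('q \<Rightarrow> 'j \<Rightarrow> complex) \<Rightarrow> 'q set \<Rightarrow> ('p \<Rightarrow> 'q) \<Rightarrow> bool" where
  "variety_morphism h X h' Y \<phi> \<longleftrightarrow>
     continuous_map (zariski h X) (zariski h' Y) \<phi> \<and>
     (\<forall>W f. openin (zariski h' Y) W \<and> regular_on h' W f \<longrightarrow>
        regular_on h {p\<in>X. \<phi> p \<in> W} (f \<circ> \<phi>))"

definition variety_isomorphic ::
    "('p \<Rightarrow> 'i \<Rightarrow> complex) \<Rightarrow> 'p set \<Rightarrow> ('q \<Rightarrow> 'j \<Rightarrow> complex) \<Rightarrow> 'q set \<Rightarrow> bool" where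
  "variety_isomorphic h X h' Y \<longleftrightarrow>
     (\<exists>\<phi> \<psi>. variety_morphism h X h' Y \<phi> \<and> variety_morphism h' Y h X \<psi> \<and>
        (\<forall>p\<in>X. \<psi> (\<phi> p) = p) \<and> (\<forall>q\<in>Y. \<phi> (\<psi> q) = q))"

text \<open>
  The product variety structure on \<open>X \<times> Y\<close> is the one induced by the Segre embedding.
\<close>

definition segre ::
    "('p \<Rightarrow> 'i \<Rightarrow> complex) \<Rightarrow> ('q \<Rightarrow> 'j \<Rightarrow> complex) \<Rightarrow> 'p \<times> 'q \<Rightarrow> 'i \<times> 'j \<Rightarrow> complex" where
  "segre h h' = (\<lambda>(p, q) (i, j). h p i * h' q j)"

lemma topspace_zariski [simp]: "topspace (zariski h X) = X"
proof -
  have "homogeneous_form 0 (\<lambda>x. 1)"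
    unfolding homogeneous_form_def by (intro exI[of _ "{{#}}"] exI[of _ "\<lambda>_. 1"]) auto
  then have "X \<in> {{p\<in>X. F (h p) \<noteq> 0} | F. \<exists>d. homogeneous_form d F}"
    by (auto intro!: exI[of _ "\<lambda>x. 1"])
  then show ?thesis
    by (auto simp: zariski_def)
qed


section \<open>Grassmannians and open positroid varieties\<close>

text \<open>
  A point of $\mathrm{Gr}(k,n)$ is the row space of a \<open>k \<times> n\<close> matrix of rank \<open>k\<close>. The matrix
  entries are indexed from 0, whereas column labels are \<open>1, \<dots>, n\<close> as usual for positroids.
\<close>

definition represents :: "nat \<Rightarrow> nat \<Rightarrow> complex mat \<Rightarrow> complex vec set \<Rightarrow> bool" where
  "represents k n A V \<longleftrightarrow>
     A \<in> carrier_mat k n \<and> vec_space.rank k A = k \<and> V = vec_space.row_space n A"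

definition Gr :: "nat \<Rightarrow> nat \<Rightarrow> complex vec set set" where
  "Gr k n = {V. \<exists>A. represents k n A V}"

text \<open>
  An arbitrary choice of representing matrix. Another choice multiplies all maximal minors by
  a common nonzero scalar, and does not affect linear relations between the columns.
\<close>

definition rep :: "nat \<Rightarrow> nat \<Rightarrow> complex vec set \<Rightarrow> complex mat" where
  "rep k n V = (SOME A. represents k n A V)"

definition plucker :: "nat \<Rightarrow> nat \<Rightarrow> complex vec set \<Rightarrow> nat set \<Rightarrow> complex" where
  "plucker k n V I =
     (if I \<subseteq> {1..n} \<and> card I = k then det (submatrix (rep k n V) UNIV {j. Suc j \<in> I}) else 0)"

text \<open>The columns $v_i$ for all integers \<open>i\<close>, with $v_{i+n} = (-1)^{k-1} v_i$.\<close>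

definition ext_col :: "nat \<Rightarrow> nat \<Rightarrow> complex vec set \<Rightarrow> int \<Rightarrow> complex vec" where
  "ext_col k n V i =
     (((-1) ^ (k - 1)) powi ((i - 1) div int n)) \<cdot>\<^sub>v col (rep k n V) (nat ((i - 1) mod int n))"

definition affine_perm :: "nat \<Rightarrow> nat \<Rightarrow> complex vec set \<Rightarrow> int \<Rightarrow> int" where
  "affine_perm k n V i =
     (LEAST j. i \<le> j \<and>
        ext_col k n V i \<in>
          LinearCombinations.module.span class_ring (module_vec TYPE(complex) k)
            (ext_col k n V ` {i+1..j}))"

definition open_positroid :: "nat \<Rightarrow> nat \<Rightarrow> (int \<Rightarrow> int) \<Rightarrow> complex vec set set" where
  "open_positroid k n f = {V \<in> Gr k n. affine_perm k n V = f}"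


section \<open>Skew diagrams\<close>

text \<open>
  A partition with at most \<open>k\<close> parts is a function of which only the values at \<open>1, \<dots>, k\<close> matter.
\<close>

definition partition_in_box :: "nat \<Rightarrow> nat \<Rightarrow> (nat \<Rightarrow> nat) \<Rightarrow> bool" where
  "partition_in_box k m lam \<longleftrightarrow>
     (\<forall>i\<in>{1..k}. lam i \<le> m) \<and> (\<forall>i\<in>{1..k}. \<forall>j\<in>{1..k}. i \<le> j \<longrightarrow> lam j \<le> lam i)"

definition conj_part :: "nat \<Rightarrow> (nat \<Rightarrow> nat) \<Rightarrow> nat \<Rightarrow> nat" where
  "conj_part k lam c = card {i\<in>{1..k}. c \<le> lam i}"

definition col_height :: "nat \<Rightarrow> nat \<Rightarrow> (nat \<Rightarrow> nat) \<Rightarrow> nat \<Rightarrow> nat" where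
  "col_height k n lam a = conj_part k lam (n - k + 1 - a)"

text \<open>
  The pair \<open>(a, i)\<close> stands for the \<open>i\<close>-th box from the bottom in the \<open>a\<close>-th column from the right
  of the \<open>k \<times> (n - k)\<close> rectangle; its northeast neighbour is \<open>(a - 1, i + 1)\<close>.
\<close>

definition diagram :: "nat \<Rightarrow> nat \<Rightarrow> (nat \<Rightarrow> nat) \<Rightarrow> (nat \<times> nat) set" where
  "diagram k n lam = {(a, i). a \<in> {1..n - k} \<and> i \<in> {1..col_height k n lam a}}"

definition skew_diagram ::
    "nat \<Rightarrow> nat \<Rightarrow> (nat \<Rightarrow> nat) \<Rightarrow> (nat \<Rightarrow> nat) \<Rightarrow> (nat \<times> nat) set" where
  "skew_diagram k n lam mu = diagram k n lam - diagram k n mu"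

definition boundary_ribbon ::
    "nat \<Rightarrow> nat \<Rightarrow> (nat \<Rightarrow> nat) \<Rightarrow> (nat \<Rightarrow> nat) \<Rightarrow> (nat \<times> nat) set" where
  "boundary_ribbon k n lam mu =
     {(a, i) \<in> skew_diagram k n lam mu. (a - 1, i + 1) \<notin> diagram k n lam}"

definition b_index :: "nat \<Rightarrow> nat \<Rightarrow> (nat \<Rightarrow> nat) \<Rightarrow> nat \<Rightarrow> nat" where
  "b_index k n mu i = n - k - mu i + i"

definition I_prime :: "nat \<Rightarrow> nat \<Rightarrow> (nat \<Rightarrow> nat) \<Rightarrow> nat \<Rightarrow> nat \<Rightarrow> nat set" where
  "I_prime k n mu a i =
     (\<lambda>j. min (a + j - 1) (b_index k n mu j)) ` {1..i} \<union> b_index k n mu ` {i+1..k}"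

definition cut_right :: "nat \<Rightarrow> nat \<Rightarrow> nat \<Rightarrow> (nat \<Rightarrow> nat) \<Rightarrow> nat \<Rightarrow> nat" where
  "cut_right k n a lam i = lam i - (n - k - a + 1)"

definition cut_left :: "nat \<Rightarrow> nat \<Rightarrow> nat \<Rightarrow> (nat \<Rightarrow> nat) \<Rightarrow> nat \<Rightarrow> nat" where
  "cut_left k n a lam i = min (lam i) (n - k - a + 1)"


section \<open>Skew shaped positroids\<close>

definition is_skew_perm ::
    "nat \<Rightarrow> nat \<Rightarrow> (nat \<Rightarrow> nat) \<Rightarrow> (nat \<Rightarrow> nat) \<Rightarrow> (int \<Rightarrow> int) \<Rightarrow> bool" where
  "is_skew_perm k n lam mu f \<longleftrightarrow>
     (\<forall>i. f (i + int n) = f i + int n) \<and>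
     (\<forall>c\<in>{1..n - k}. f (int (c + col_height k n mu c)) = int (c + col_height k n lam c)) \<and>
     (\<forall>i\<in>{1..k}. f (int (b_index k n mu i)) = int (n - k - lam i + i + n))"

definition skew_perm ::
    "nat \<Rightarrow> nat \<Rightarrow> (nat \<Rightarrow> nat) \<Rightarrow> (nat \<Rightarrow> nat) \<Rightarrow> int \<Rightarrow> int" where
  "skew_perm k n lam mu = (THE f. is_skew_perm k n lam mu f)"

text \<open>
  The skew shaped positroid is taken as an open positroid variety in $\mathrm{Gr}(k,n)$, i.e. as
  the image of the open Richardson variety under its identification by Knutson, Lam and Speyer.
\<close>

definition skew_positroid ::
    "nat \<Rightarrow> nat \<Rightarrow> (nat \<Rightarrow> nat) \<Rightarrow> (nat \<Rightarrow> nat) \<Rightarrow> complex vec set set" where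
  "skew_positroid k n lam mu = open_positroid k n (skew_perm k n lam mu)"

definition U_set ::
    "nat \<Rightarrow> nat \<Rightarrow> (nat \<Rightarrow> nat) \<Rightarrow> (nat \<Rightarrow> nat) \<Rightarrow> nat \<Rightarrow> complex vec set set" where
  "U_set k n lam mu a =
     {V \<in> skew_positroid k n lam mu.
        \<forall>i\<in>{col_height k n mu a + 1..col_height k n lam a}. plucker k n V (I_prime k n mu a i) \<noteq> 0}"

text \<open>The conditions on \<open>skew_perm\<close> do determine a function.\<close>

lemma b_index_less:
  assumes "partition_in_box k (n - k) mu" "i \<in> {1..k}" "j \<in> {1..k}" "i < j"
  shows "b_index k n mu i < b_index k n mu j"
proof -
  have "mu j \<le> mu i" "mu i \<le> n - k"
    using assms unfolding partition_in_box_def by auto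
  then show ?thesis
    using assms(4) unfolding b_index_def by linarith
qed

lemma col_height_le: "col_height k n mu c \<le> k"
proof -
  have "card {i\<in>{1..k}. n - k + 1 - c \<le> mu i} \<le> card {1..k}"
    by (intro card_mono) auto
  then show ?thesis by (simp add: col_height_def conj_part_def)
qed

lemma col_height_mono: "c \<le> d \<Longrightarrow> col_height k n mu c \<le> col_height k n mu d"
  unfolding col_height_def conj_part_def by (intro card_mono) auto

lemma col_index_neq_b_index:
  assumes mu: "partition_in_box k (n - k) mu" and c: "c \<in> {1..n - k}" and i: "i \<in> {1..k}"
  shows "c + col_height k n mu c \<noteq> b_index k n mu i"
proof (cases "n - k + 1 - c \<le> mu i")
  case True
  have "{1..i} \<subseteq> {j\<in>{1..k}. n - k + 1 - c \<le> mu j}"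
  proof
    fix j assume "j \<in> {1..i}"
    then have "mu i \<le> mu j" "j \<in> {1..k}"
      using mu i unfolding partition_in_box_def by auto
    then show "j \<in> {j\<in>{1..k}. n - k + 1 - c \<le> mu j}"
      using True by auto
  qed
  then have "card {1..i} \<le> col_height k n mu c"
    unfolding col_height_def conj_part_def by (intro card_mono) auto
  then show ?thesis
    using True c unfolding b_index_def by auto
next
  case False
  have "{j\<in>{1..k}. n - k + 1 - c \<le> mu j} \<subseteq> {1..<i}"
  proof
    fix j assume j: "j \<in> {j\<in>{1..k}. n - k + 1 - c \<le> mu j}"
    have "j < i"
    proof (rule ccontr)
      assume "\<not> j < i"
      then have "mu j \<le> mu i"
        using mu i j unfolding partition_in_box_def by auto
      then show False using j False by auto
    qed
    then show "j \<in> {1..<i}" using j by auto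
  qed
  then have "col_height k n mu c \<le> card {1..<i}"
    unfolding col_height_def conj_part_def by (intro card_mono) auto
  then show ?thesis
    using False c i unfolding b_index_def by auto
qed

lemma ex1_skew_perm:
  assumes mu: "partition_in_box k (n - k) mu" and k: "0 < k" "k \<le> n"
  shows "\<exists>!f. is_skew_perm k n lam mu f"
proof -
  define p where "p = (\<lambda>c. c + col_height k n mu c)"
  define b where "b = b_index k n mu"
  have n: "0 < n" using k by auto
  have injp: "inj_on p {1..n - k}"
  proof (rule linorder_inj_onI')
    fix c d :: nat assume "c < d"
    then show "p c \<noteq> p d"
      using col_height_mono[of c d k n mu] unfolding p_def by auto
  qed
  have injb: "inj_on b {1..k}"
    by (rule linorder_inj_onI') (use b_index_less[OF mu] in \<open>fastforce simp: b_def\<close>)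
  have disj: "p ` {1..n - k} \<inter> b ` {1..k} = {}"
    using col_index_neq_b_index[OF mu] unfolding p_def b_def by blast
  have p_range: "p c \<in> {1..n}" if "c \<in> {1..n - k}" for c
    using that col_height_le[of k n mu c] k unfolding p_def by auto
  have b_range: "b i \<in> {1..n}" if "i \<in> {1..k}" for i
    using that k unfolding b_def b_index_def by auto
  have un: "p ` {1..n - k} \<union> b ` {1..k} = {1..n}"
  proof (rule card_subset_eq)
    show "card (p ` {1..n - k} \<union> b ` {1..k}) = card {1..n}"
      using disj injp injb k by (simp add: card_Un_disjoint card_image)
  qed (use p_range b_range in auto)

  define g where "g = (\<lambda>r. if r \<in> p ` {1..n - k}
    then let c = inv_into {1..n - k} p r in int (c + col_height k n lam c)
    else let i = inv_into {1..k} b r in int (n - k - lam i + i + n))"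
  define f where "f = (\<lambda>j::int. g (nat ((j - 1) mod int n + 1)) + int n * ((j - 1) div int n))"
  have fg: "f (int r) = g r" if r: "r \<in> {1..n}" for r
  proof -
    have "0 \<le> int r - 1" "int r - 1 < int n" using r by auto
    then show ?thesis unfolding f_def by simp
  qed
  have ex: "is_skew_perm k n lam mu f"
    unfolding is_skew_perm_def
  proof (intro conjI allI ballI)
    fix i
    have eq: "i + int n - 1 = (i - 1) + int n" by simp
    have dv: "((i - 1) + int n) div int n = (i - 1) div int n + 1"
      using n by (subst div_add_self2) auto
    have md: "((i - 1) + int n) mod int n = (i - 1) mod int n"
      by (rule mod_add_self2)
    show "f (i + int n) = f i + int n"
      unfolding f_def eq dv md by (simp add: distrib_left)
  next
    fix c assume c: "c \<in> {1..n - k}"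
    have "f (int (p c)) = g (p c)" using fg p_range c by blast
    also have "\<dots> = int (c + col_height k n lam c)"
      using c inv_into_f_f[OF injp c] unfolding g_def by (auto simp: Let_def)
    finally show "f (int (c + col_height k n mu c)) = int (c + col_height k n lam c)"
      by (simp add: p_def)
  next
    fix i assume i: "i \<in> {1..k}"
    have "b i \<notin> p ` {1..n - k}" using disj i by blast
    then have "g (b i) = int (n - k - lam i + i + n)"
      using inv_into_f_f[OF injb i] unfolding g_def by (simp add: Let_def)
    then show "f (int (b_index k n mu i)) = int (n - k - lam i + i + n)"
      using fg b_range i unfolding b_def by simp
  qed
  have shift: "h (i + int n * q) = h i + int n * q"
    if h: "is_skew_perm k n lam mu h" for h i q
  proof -
    have step: "h (j + int n) = h j + int n" for j
      using h unfolding is_skew_perm_def by blast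
    show ?thesis
    proof (induction q rule: int_induct[where k = 0])
      case (step1 q)
      then show ?case using step[of "i + int n * q"] by (simp add: algebra_simps)
    next
      case (step2 q)
      then show ?case using step[of "i + int n * (q - 1)"] by (simp add: algebra_simps)
    qed simp
  qed
  have agree: "h (int r) = f (int r)"
    if h: "is_skew_perm k n lam mu h" and r: "r \<in> {1..n}" for h r
  proof -
    from r un consider c where "c \<in> {1..n - k}" "r = p c" | i where "i \<in> {1..k}" "r = b i"
      by blast
    then show ?thesis
      using h ex by cases (simp_all only: is_skew_perm_def p_def b_def)
  qed
  have "h = f" if h: "is_skew_perm k n lam mu h" for h
  proof
    fix j :: int
    define r where "r = nat ((j - 1) mod int n + 1)"
    have ir: "int r = (j - 1) mod int n + 1" unfolding r_def using n by simp
    have "(j - 1) mod int n < int n" "0 \<le> (j - 1) mod int n" using n by auto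
    then have r: "r \<in> {1..n}" using ir by auto
    have j: "j = int r + int n * ((j - 1) div int n)"
      using ir mult_div_mod_eq[of "int n" "j - 1"] by linarith
    show "h j = f j"
      using agree[OF h r] shift[OF h, of "int r"] shift[OF ex, of "int r"] j by metis
  qed
  with ex show ?thesis by blast
qed

end

theory Submission
  imports Defs
begin

text \<open>
  A column \<open>v\<^sub>i\<close> lies in the span of columns \<open>v\<^sub>j\<close> with \<open>j \<in> J\<close> iff every
  vector of the row space \<open>V\<close> that vanishes on \<open>J\<close> vanishes at \<open>i\<close>. Thus membership in a
  positroid only concerns the matroid of \<open>V\<close>. Let \<open>m\<close> be the height of \<open>\<mu>\<close> in
  column \<open>a\<close> and \<open>P = a + m\<close>. The ribbon condition says that the columns of \<open>\<lambda>\<close> to the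
  right of \<open>a\<close> have height at most \<open>m + 1\<close>, so that the spans of \<open>v\<^sub>1, \<dots>, v\<^sub>P\<close> and of
  \<open>v\<^sub>P, \<dots>, v\<^sub>n\<close> meet only in the line of \<open>v\<^sub>P\<close>: the matroid is a parallel connection.
  The two factors are obtained by deleting columns, namely by keeping
  \<open>v\<^sub>1, \<dots>, v\<^sub>P\<^sub>-\<^sub>1\<close> and a basis of the span of \<open>v\<^sub>P, \<dots>, v\<^sub>n\<close> that contains \<open>v\<^sub>P\<close>
  (unless \<open>v\<^sub>P = 0\<close>), respectively \<open>v\<^sub>P, \<dots>, v\<^sub>n\<close> and a basis of a complement. The
  columns kept twice form a basis, so two points can be glued uniquely after normalising both on it.
\<close>

section \<open>Homogeneous forms and morphisms\<close>

text \<open>The obstacle is the row conditions: their cyclic intervals wrap around and involve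
  columns of both factors. For each row, the condition in one factor is equivalent to the original,
  while the other factor satisfies its own automatically. This comparison rests on three weak facts:
  the column relations hold, the columns \<open>b i\<close> are independent, and, if column
  \<open>a\<close> of the skew shape is nonempty, column \<open>P\<close> is outside the span of the
  \<open>b i\<close> with \<open>i > m + 1\<close>. They follow from the full conditions, but also
  from those of the factors, since the left one keeps \<open>P\<close> and every \<open>b i\<close>.
  One equivalence of dependence relations therefore serves both cutting and gluing. Coordinates
  depend on an arbitrary choice of representing matrix, so maps are described by forms up to a
  scalar that may vary with the point in any way. To stay polynomial, normalisation uses the
  adjugate instead of the inverse, and each half of a glued matrix is multiplied by the minor of the
  other half; its entries are then linear in the Segre coordinates.\<close>

lemma homogeneous_form_monom:
  assumes "size M = d"
  shows "homogeneous_form d (\<lambda>x. c * (\<Prod>i\<in>#M. x i))"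
  unfolding homogeneous_form_def
  using assms by (intro exI[of _ "{M}"] exI[of _ "\<lambda>_. c"]) auto

lemma homogeneous_form_coord: "homogeneous_form 1 (\<lambda>x. c * x i)"
  using homogeneous_form_monom[of "{#i#}" 1 c] by simp

lemma homogeneous_form_zero: "homogeneous_form d (\<lambda>x. 0)"
  unfolding homogeneous_form_def by (intro exI[of _ "{}"]) auto

lemma homogeneous_form_const: "homogeneous_form 0 (\<lambda>x. c)"
  using homogeneous_form_monom[of "{#}" 0 c] by simp

lemma homogeneous_form_add:
  assumes "homogeneous_form d F" "homogeneous_form d G"
  shows "homogeneous_form d (\<lambda>x. F x + G x)"
proof -
  obtain S c where S: "finite S" "\<forall>m\<in>S. size m = d" "F = (\<lambda>x. \<Sum>m\<in>S. c m * (\<Prod>i\<in>#m. x i))"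
    using assms(1) unfolding homogeneous_form_def by blast
  obtain T e where T: "finite T" "\<forall>m\<in>T. size m = d" "G = (\<lambda>x. \<Sum>m\<in>T. e m * (\<Prod>i\<in>#m. x i))"
    using assms(2) unfolding homogeneous_form_def by blast
  \<comment> \<open>The two sets of monomials may overlap; extension by zero lets both sums run over
    the union.\<close>
  define c' where "c' m = (if m \<in> S then c m else 0)" for m
  define e' where "e' m = (if m \<in> T then e m else 0)" for m
  have "(\<Sum>m\<in>S. c m * (\<Prod>i\<in>#m. x i)) = (\<Sum>m\<in>S \<union> T. c' m * (\<Prod>i\<in>#m. x i))" for x
    using S(1) T(1) by (intro sum.mono_neutral_cong_left) (auto simp: c'_def)
  moreover have "(\<Sum>m\<in>T. e m * (\<Prod>i\<in>#m. x i)) = (\<Sum>m\<in>S \<union> T. e' m * (\<Prod>i\<in>#m. x i))" for x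
    using S(1) T(1) by (intro sum.mono_neutral_cong_left) (auto simp: e'_def)
  ultimately have "(\<lambda>x. F x + G x) = (\<lambda>x. \<Sum>m\<in>S \<union> T. (c' m + e' m) * (\<Prod>i\<in>#m. x i))"
    unfolding S(3) T(3) by (simp add: distrib_right sum.distrib)
  then show ?thesis
    unfolding homogeneous_form_def using S T
    by (intro exI[of _ "S \<union> T"] exI[of _ "\<lambda>m. c' m + e' m"]) auto
qed

lemma homogeneous_form_sum:
  assumes "\<And>a. a \<in> A \<Longrightarrow> homogeneous_form d (F a)"
  shows "homogeneous_form d (\<lambda>x. \<Sum>a\<in>A. F a x)"
  using assms
proof (induction A rule: infinite_finite_induct)
  case (insert a A)
  then show ?case using homogeneous_form_add[of d "F a"] by simp
qed (simp_all add: homogeneous_form_zero)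

lemma homogeneous_form_mult:
  assumes "homogeneous_form d F" "homogeneous_form e G"
  shows "homogeneous_form (d + e) (\<lambda>x. F x * G x)"
proof -
  obtain S c where S: "finite S" "\<forall>m\<in>S. size m = d" "F = (\<lambda>x. \<Sum>m\<in>S. c m * (\<Prod>i\<in>#m. x i))"
    using assms(1) unfolding homogeneous_form_def by blast
  obtain T g where T: "finite T" "\<forall>m\<in>T. size m = e" "G = (\<lambda>x. \<Sum>m\<in>T. g m * (\<Prod>i\<in>#m. x i))"
    using assms(2) unfolding homogeneous_form_def by blast
  \<comment> \<open>Distinct pairs \<open>m\<close>, \<open>l\<close> can give the same product
    monomial, so the double sum is handled as a sum of forms and not as one set of
    monomials.\<close>
  have "(\<lambda>x. F x * G x) = (\<lambda>x. \<Sum>m\<in>S. \<Sum>l\<in>T. (c m * g l) * (\<Prod>i\<in>#m + l. x i))"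
    unfolding S(3) T(3) by (simp add: sum_product mult_ac)
  moreover have "homogeneous_form (d + e) \<dots>"
    using S(2) T(2) by (intro homogeneous_form_sum homogeneous_form_monom) auto
  ultimately show ?thesis by simp
qed

lemma homogeneous_form_scale:
  assumes "homogeneous_form d F"
  shows "homogeneous_form d (\<lambda>x. c * F x)"
  using homogeneous_form_mult[OF homogeneous_form_const assms] by simp

lemma homogeneous_form_prod:
  assumes "\<And>a. a \<in> A \<Longrightarrow> homogeneous_form d (F a)" "finite A"
  shows "homogeneous_form (card A * d) (\<lambda>x. \<Prod>a\<in>A. F a x)"
  using assms(2,1)
proof (induction A rule: finite_induct)
  case (insert a A)
  then have "homogeneous_form (d + card A * d) (\<lambda>x. F a x * (\<Prod>a\<in>A. F a x))"
    by (intro homogeneous_form_mult) auto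
  then show ?case using insert.hyps by simp
qed (simp add: homogeneous_form_const)

lemma homogeneous_form_compose:
  assumes "homogeneous_form e F" and G: "\<And>j. homogeneous_form d (G j)"
  shows "homogeneous_form (e * d) (\<lambda>x. F (\<lambda>j. G j x))"
proof -
  obtain S c where S: "finite S" "\<forall>m\<in>S. size m = e" "F = (\<lambda>x. \<Sum>m\<in>S. c m * (\<Prod>i\<in>#m. x i))"
    using assms(1) unfolding homogeneous_form_def by blast
  have "homogeneous_form (size m * d) (\<lambda>x. \<Prod>j\<in>#m. G j x)" for m
  proof (induction m)
    case (add j m)
    then show ?case using homogeneous_form_mult[OF G[of j]] by simp
  qed (simp add: homogeneous_form_const)
  then show ?thesis
    unfolding S(3) using S(2) by (intro homogeneous_form_sum homogeneous_form_scale) metis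
qed

text \<open>Each monomial picks up the factor \<open>s\<close> exactly \<open>d\<close> times. Hence
  vanishing of forms and quotients of forms of equal degree do not depend on a nonzero scale of the
  coordinate vector.\<close>

lemma homogeneous_form_scaled_arg:
  assumes "homogeneous_form d F"
  shows "F (\<lambda>i. s * x i) = s ^ d * F x"
proof -
  obtain S c where S: "finite S" "\<forall>m\<in>S. size m = d" "F = (\<lambda>x. \<Sum>m\<in>S. c m * (\<Prod>i\<in>#m. x i))"
    using assms unfolding homogeneous_form_def by blast
  have "(\<Prod>i\<in>#m. s * x i) = s ^ size m * (\<Prod>i\<in>#m. x i)" for m
    by (induction m) (auto simp: mult_ac)
  then show ?thesis
    unfolding S(3) sum_distrib_left using S(2) by (intro sum.cong) (auto simp: mult_ac)
qed

text \<open>In the Leibniz expansion every term is a signed product of \<open>n\<close> entries.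
  This serves for the Pluecker coordinates of a glued matrix.\<close>

lemma homogeneous_form_det:
  assumes "\<And>i j. i < n \<Longrightarrow> j < n \<Longrightarrow> homogeneous_form d (\<lambda>x. M x i j)"
  shows "homogeneous_form (n * d) (\<lambda>x. det (mat n n (\<lambda>(i, j). M x i j)))"
proof -
  have "det (mat n n (\<lambda>(i, j). M x i j)) =
      (\<Sum>p\<in>{p. p permutes {0..<n}}. signof p * (\<Prod>i = 0..<n. M x i (p i)))" for x
    by (subst det_def'[of _ n], simp, intro sum.cong refl arg_cong2[of _ _ _ _ "(*)"] prod.cong)
      (auto simp: permutes_in_image[of _ "{0..<n}"])
  moreover have "homogeneous_form (n * d)
      (\<lambda>x. \<Sum>p\<in>{p. p permutes {0..<n}}. signof p * (\<Prod>i = 0..<n. M x i (p i)))"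
  proof (intro homogeneous_form_sum homogeneous_form_scale)
    fix p assume "p \<in> {p. p permutes {0..<n}}"
    then show "homogeneous_form (n * d) (\<lambda>x. \<Prod>i = 0..<n. M x i (p i))"
      using homogeneous_form_prod[of "{0..<n}" d "\<lambda>i x. M x i (p i)"] assms
      by (auto simp: permutes_in_image[of _ "{0..<n}"])
  qed
  ultimately show ?thesis by simp
qed

text \<open>The scalar \<open>s\<close> may depend on \<open>p\<close> without any regularity: the
  preimage of a basic open set only depends on where \<open>F\<close> composed with \<open>G\<close>
  vanishes.\<close>

lemma continuous_map_homogeneous:
  assumes \<phi>: "\<phi> ` X \<subseteq> Y" and G: "\<And>j. homogeneous_form d (G j)"
    and eq: "\<And>p. p \<in> X \<Longrightarrow> \<exists>s. s \<noteq> 0 \<and> (\<forall>j. h' (\<phi> p) j = s * G j (h p))"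
  shows "continuous_map (zariski h X) (zariski h' Y) \<phi>"
  unfolding zariski_def[of h' Y]
proof (rule continuous_on_generated_topo)
  fix U assume "U \<in> {{p\<in>Y. F (h' p) \<noteq> 0} | F. \<exists>d. homogeneous_form d F}"
  then obtain F e where F: "homogeneous_form e F" "U = {p\<in>Y. F (h' p) \<noteq> 0}" by blast
  have "F (h' (\<phi> p)) \<noteq> 0 \<longleftrightarrow> F (\<lambda>j. G j (h p)) \<noteq> 0" if p: "p \<in> X" for p
  proof -
    obtain s where "s \<noteq> 0" "h' (\<phi> p) = (\<lambda>j. s * G j (h p))" using eq[OF p] by blast
    then show ?thesis using homogeneous_form_scaled_arg[OF F(1)] by simp
  qed
  then have "\<phi> -` U \<inter> topspace (zariski h X) = {p\<in>X. F (\<lambda>j. G j (h p)) \<noteq> 0}"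
    using \<phi> F(2) by auto
  then show "openin (zariski h X) (\<phi> -` U \<inter> topspace (zariski h X))"
    unfolding zariski_def using homogeneous_form_compose[OF F(1), of d G] G
    by (auto intro!: topology_generated_by_Basis)
next
  have "\<Union> {{p\<in>Y. F (h' p) \<noteq> 0} | F. \<exists>d. homogeneous_form d F} = topspace (zariski h' Y)"
    by (simp add: zariski_def)
  then show "\<phi> ` topspace (zariski h X) \<subseteq> \<Union> {{p\<in>Y. F (h' p) \<noteq> 0} | F. \<exists>d. homogeneous_form d F}"
    using \<phi> by simp
qed

text \<open>Regular functions pull back because numerator and denominator have equal degree, so that
  the powers of \<open>s\<close> cancel.\<close>

lemma variety_morphism_homogeneous:
  assumes \<phi>: "\<phi> ` X \<subseteq> Y" and G: "\<And>j. homogeneous_form d (G j)"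
    and eq: "\<And>p. p \<in> X \<Longrightarrow> \<exists>s. s \<noteq> 0 \<and> (\<forall>j. h' (\<phi> p) j = s * G j (h p))"
  shows "variety_morphism h X h' Y \<phi>"
  unfolding variety_morphism_def
proof (intro conjI allI impI)
  show "continuous_map (zariski h X) (zariski h' Y) \<phi>"
    by (rule continuous_map_homogeneous[where G = G and d = d]) (use \<phi> G eq in auto)
  fix W f assume W: "openin (zariski h' Y) W \<and> regular_on h' W f"
  define X' where "X' = {p \<in> X. \<phi> p \<in> W}"
  \<comment> \<open>The neighbourhoods that witness regularity are open in the topology generated on
    \<open>W\<close>, so continuity is needed for the map restricted to \<open>W\<close>.\<close>
  have cont: "continuous_map (zariski h X') (zariski h' W) \<phi>"
    by (rule continuous_map_homogeneous[where G = G and d = d]) (use eq G in \<open>auto simp: X'_def\<close>)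
  show "regular_on h {p \<in> X. \<phi> p \<in> W} (f \<circ> \<phi>)"
    unfolding regular_on_def X'_def[symmetric]
  proof
    fix p assume p: "p \<in> X'"
    then obtain Z e P Q where Z: "openin (zariski h' W) Z" "\<phi> p \<in> Z"
      and P: "homogeneous_form e P" and Q: "homogeneous_form e Q"
      and f: "\<forall>q\<in>Z. Q (h' q) \<noteq> 0 \<and> f q = P (h' q) / Q (h' q)"
      using W unfolding regular_on_def X'_def by blast
    define Z' where "Z' = {p \<in> X'. \<phi> p \<in> Z}"
    have Z': "openin (zariski h X') Z'"
      using openin_continuous_map_preimage[OF cont Z(1)] by (simp add: Z'_def)
    have "Q (\<lambda>j. G j (h q)) \<noteq> 0 \<and> (f \<circ> \<phi>) q = P (\<lambda>j. G j (h q)) / Q (\<lambda>j. G j (h q))"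
      if q: "q \<in> Z'" for q
    proof -
      obtain s where s: "s \<noteq> 0" "h' (\<phi> q) = (\<lambda>j. s * G j (h q))"
        using eq[of q] q by (auto simp: Z'_def X'_def)
      have "Q (h' (\<phi> q)) \<noteq> 0 \<and> f (\<phi> q) = P (h' (\<phi> q)) / Q (h' (\<phi> q))"
        using f q by (auto simp: Z'_def)
      then show ?thesis
        using s homogeneous_form_scaled_arg[OF P] homogeneous_form_scaled_arg[OF Q] by auto
    qed
    then show "\<exists>Z d P Q. openin (zariski h X') Z \<and> p \<in> Z \<and> homogeneous_form d P \<and>
        homogeneous_form d Q \<and> (\<forall>q\<in>Z. Q (h q) \<noteq> 0 \<and> (f \<circ> \<phi>) q = P (h q) / Q (h q))"
      using Z' Z(2) p homogeneous_form_compose[OF P, of d G] homogeneous_form_compose[OF Q, of d G] G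
      by (intro exI[of _ Z'] exI[of _ "e * d"] exI[of _ "\<lambda>x. P (\<lambda>j. G j x)"]
          exI[of _ "\<lambda>x. Q (\<lambda>j. G j x)"]) (auto simp: Z'_def)
  qed
qed

section \<open>Column relations in terms of the row space\<close>

abbreviation span_vec :: "nat \<Rightarrow> complex vec set \<Rightarrow> complex vec set" where
  "span_vec k \<equiv> LinearCombinations.module.span class_ring (module_vec TYPE(complex) k)"

lemma orthogonal_span:
  assumes S: "S \<subseteq> carrier_vec k" and y: "y \<in> carrier_vec k" "\<forall>s\<in>S. y \<bullet> s = 0"
    and w: "w \<in> span_vec k S"
  shows "y \<bullet> w = 0"
proof -
  interpret vec_space "TYPE(complex)" k .
  obtain a A where A: "finite A" "A \<subseteq> S" "w = lincomb a A"
    using w unfolding span_def by blast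
  have "y \<bullet> lincomb a A = 0"
    using A(1,2)
  proof (induction A rule: finite_induct)
    case (insert s A)
    then have s: "s \<in> carrier_vec k" "A \<subseteq> carrier_vec k" using S by auto
    then have "lincomb a (insert s A) = a s \<cdot>\<^sub>v s + lincomb a A"
      using insert by (intro lincomb_insert2) auto
    then show ?case
      using insert s y by (simp add: scalar_prod_add_distrib[of _ k])
  qed (use y in simp)
  then show ?thesis using A by simp
qed

lemma mem_span_if_orthogonal:
  assumes "finite S" "S \<subseteq> carrier_vec k" "w \<in> carrier_vec k"
    and "\<And>y. y \<in> carrier_vec k \<Longrightarrow> \<forall>s\<in>S. y \<bullet> s = 0 \<Longrightarrow> y \<bullet> w = 0"
  shows "w \<in> span_vec k S"
  using assms
proof (induction S arbitrary: w rule: finite_induct)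
  case empty
  interpret vec_space "TYPE(complex)" k .
  have "w = 0\<^sub>v k"
  proof (rule eq_vecI)
    fix i assume "i < dim_vec (0\<^sub>v k :: complex vec)"
    then show "w $ i = 0\<^sub>v k $ i"
      using empty(3)[of "unit_vec k i"] empty(2) by simp
  qed (use empty in simp)
  then show ?case by (simp add: span_empty)
next
  case (insert s S)
  interpret vec_space "TYPE(complex)" k .
  have s: "s \<in> carrier_vec k" and S: "S \<subseteq> carrier_vec k" using insert.prems by auto
  show ?case
  proof (cases "\<forall>y\<in>carrier_vec k. (\<forall>s\<in>S. y \<bullet> s = 0) \<longrightarrow> y \<bullet> s = 0")
    case True
    then have "w \<in> span S"
      using insert.prems by (intro insert.IH S) auto
    then show ?thesis using span_is_monotone[of S "insert s S"] by auto
  next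
    case False
    then obtain y0 where y0: "y0 \<in> carrier_vec k" "\<forall>s\<in>S. y0 \<bullet> s = 0" "y0 \<bullet> s \<noteq> 0" by blast
    define c where "c = (y0 \<bullet> w) / (y0 \<bullet> s)"
    have w: "w \<in> carrier_vec k" using insert.prems by auto
    have "w - c \<cdot>\<^sub>v s \<in> span S"
    proof (rule insert.IH[OF S])
      show "w - c \<cdot>\<^sub>v s \<in> carrier_vec k" using w s by simp
      fix y assume y: "y \<in> carrier_vec k" "\<forall>s\<in>S. y \<bullet> s = 0"
      \<comment> \<open>\<open>y\<close> is corrected by a multiple of \<open>y0\<close> so that it
        kills \<open>s\<close> as well; the hypothesis on \<open>w\<close> then applies to
        \<open>z\<close>.\<close>
      define z where "z = y - ((y \<bullet> s) / (y0 \<bullet> s)) \<cdot>\<^sub>v y0"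
      have z: "z \<in> carrier_vec k" using y y0 by (simp add: z_def)
      have zv: "z \<bullet> v = y \<bullet> v - (y \<bullet> s) / (y0 \<bullet> s) * (y0 \<bullet> v)" if "v \<in> carrier_vec k" for v
        using y y0 that by (simp add: z_def minus_scalar_prod_distrib[of _ k])
      have "z \<bullet> w = 0"
        using y y0 s S z by (intro insert.prems(3)) (auto simp: zv subset_iff)
      then show "y \<bullet> (w - c \<cdot>\<^sub>v s) = 0"
        using y0(3) zv[OF w] y(1) w s
        by (simp add: scalar_prod_minus_distrib[of _ k] c_def field_simps)
    qed
    then have "w - c \<cdot>\<^sub>v s \<in> span (insert s S)"
      using span_is_monotone[of S "insert s S"] by auto
    moreover have "c \<cdot>\<^sub>v s \<in> span (insert s S)"
      using insert.prems(1) by (intro smult_in_span span_mem) auto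
    ultimately have "(w - c \<cdot>\<^sub>v s) + c \<cdot>\<^sub>v s \<in> span (insert s S)"
      using insert.prems(1) by (intro span_add1) auto
    moreover have "(w - c \<cdot>\<^sub>v s) + c \<cdot>\<^sub>v s = w" using w s by auto
    ultimately show ?thesis by simp
  qed
qed

lemma mem_span_iff_orthogonal:
  assumes "finite S" "S \<subseteq> carrier_vec k" "w \<in> carrier_vec k"
  shows "w \<in> span_vec k S \<longleftrightarrow> (\<forall>y\<in>carrier_vec k. (\<forall>s\<in>S. y \<bullet> s = 0) \<longrightarrow> y \<bullet> w = 0)"
  using orthogonal_span[OF assms(2)] mem_span_if_orthogonal[OF assms] by blast

text \<open>Rank \<open>k\<close> says that the columns span, and by the double annihilator this
  fails only if a nonzero functional kills them all.\<close>

lemma rank_eq_iff_inj: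
  fixes A :: "complex mat"
  assumes A: "A \<in> carrier_mat k n"
  shows "vec_space.rank k A = k \<longleftrightarrow>
    (\<forall>y\<in>carrier_vec k. (\<forall>j<n. y \<bullet> col A j = 0) \<longrightarrow> y = 0\<^sub>v k)"
proof -
  interpret vec_space "TYPE(complex)" k .
  have cols: "set (cols A) = col A ` {..<n}" using A by (auto simp: cols_def)
  have C: "set (cols A) \<subseteq> carrier_vec k" using A cols_dim by blast
  have "rank A = k \<longleftrightarrow> span (set (cols A)) = carrier_vec k"
  proof
    assume "span (set (cols A)) = carrier_vec k"
    then have "span_vs (set (cols A)) = V" by (simp add: module_vec_def)
    then show "rank A = k" unfolding rank_def using dim_is_n by simp
  next
    assume r: "rank A = k"
    \<comment> \<open>A maximal independent set of columns has \<open>k\<close> elements, the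
      dimension of the ambient space, so it is a basis.\<close>
    obtain U where U: "finite U" "maximal U (\<lambda>T. T \<subseteq> set (cols A) \<and> lin_indpt T)"
      using maximal_exists_superset[of "set (cols A)" "\<lambda>T. T \<subseteq> set (cols A) \<and> lin_indpt T" "{}"]
      by (auto simp: lin_dep_def)
    then have U': "U \<subseteq> set (cols A)" "lin_indpt U" by (auto simp: maximal_def)
    have "card U = dim" using rank_card_indpt[OF A U(2)] r dim_is_n by simp
    then have "basis U"
      using U U' C by (intro dim_li_is_basis) auto
    then have "span U = carrier_vec k" by (simp add: basis_def)
    then show "span (set (cols A)) = carrier_vec k"
      using span_is_monotone[OF U'(1)] span_closed[OF C] by auto
  qed
  also have "\<dots> \<longleftrightarrow> (\<forall>y\<in>carrier_vec k. (\<forall>j<n. y \<bullet> col A j = 0) \<longrightarrow> y = 0\<^sub>v k)"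
  proof
    assume sp: "span (set (cols A)) = carrier_vec k"
    show "\<forall>y\<in>carrier_vec k. (\<forall>j<n. y \<bullet> col A j = 0) \<longrightarrow> y = 0\<^sub>v k"
    proof (intro ballI impI eq_vecI)
      fix y :: "complex vec" and i
      assume y: "y \<in> carrier_vec k" "\<forall>j<n. y \<bullet> col A j = 0" "i < dim_vec (0\<^sub>v k :: complex vec)"
      then have "y \<bullet> unit_vec k i = 0"
        using sp cols by (intro orthogonal_span[OF C]) auto
      then show "y $ i = 0\<^sub>v k $ i" using y by simp
    qed auto
  next
    assume r: "\<forall>y\<in>carrier_vec k. (\<forall>j<n. y \<bullet> col A j = 0) \<longrightarrow> y = 0\<^sub>v k"
    have "w \<in> span (set (cols A))" if w: "w \<in> carrier_vec k" for w
      using r w cols by (intro mem_span_if_orthogonal C) auto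
    then show "span (set (cols A)) = carrier_vec k"
      using span_closed[OF C] by auto
  qed
  finally show ?thesis .
qed

text \<open>A vector \<open>y\<close> of row coefficients acts as a functional on the columns, and
  its values are the entries of a vector of the row space. This is how relations between columns
  become statements about \<open>V\<close>.\<close>

lemma row_space_image:
  fixes A :: "complex mat"
  assumes A: "A \<in> carrier_mat k n"
  shows "vec_space.row_space n A = (\<lambda>y. vec n (\<lambda>j. y \<bullet> col A j)) ` carrier_vec k"
proof -
  interpret vec_space "TYPE(complex)" n .
  have *: "A\<^sup>T *\<^sub>v y = vec n (\<lambda>j. y \<bullet> col A j)" if "y \<in> carrier_vec k" for y
    using A that by (intro eq_vecI) (auto intro!: comm_scalar_prod[of _ k])
  show ?thesis
    unfolding row_space_eq[OF A] using A by (auto simp: * image_iff)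
qed

lemma represents_iff:
  "represents k n A V \<longleftrightarrow> A \<in> carrier_mat k n \<and>
    (\<forall>y\<in>carrier_vec k. (\<forall>j<n. y \<bullet> col A j = 0) \<longrightarrow> y = 0\<^sub>v k) \<and>
    V = (\<lambda>y. vec n (\<lambda>j. y \<bullet> col A j)) ` carrier_vec k"
  unfolding represents_def using rank_eq_iff_inj row_space_image by blast

lemma represents_rep: "V \<in> Gr k n \<Longrightarrow> represents k n (rep k n V) V"
  unfolding Gr_def rep_def by (auto intro: someI)

text \<open>The rows of \<open>B\<close> lie in \<open>V\<close>, so they are combinations of the
  rows of \<open>A\<close>; a singular \<open>G\<close> would yield a nonzero functional killing
  every column of \<open>B\<close>.\<close>

lemma represents_unique:
  assumes A: "represents k n A V" and B: "represents k n B V"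
  shows "\<exists>G\<in>carrier_mat k k. det G \<noteq> 0 \<and> B = G * A"
proof -
  have Ac: "A \<in> carrier_mat k n" and Bc: "B \<in> carrier_mat k n"
    using A B by (auto simp: represents_iff)
  have "\<exists>y\<in>carrier_vec k. \<forall>j<n. B $$ (i, j) = y \<bullet> col A j" if i: "i < k" for i
  proof -
    have "vec n (\<lambda>j. unit_vec k i \<bullet> col B j) \<in> V"
      using B by (auto simp: represents_iff)
    then obtain y where y: "y \<in> carrier_vec k"
      "vec n (\<lambda>j. unit_vec k i \<bullet> col B j) = vec n (\<lambda>j. y \<bullet> col A j)"
      using A by (auto simp: represents_iff)
    have "B $$ (i, j) = y \<bullet> col A j" if j: "j < n" for j
    proof -
      have "unit_vec k i \<bullet> col B j = y \<bullet> col A j"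
        using arg_cong[OF y(2), of "\<lambda>v. v $ j"] j by simp
      then show ?thesis using i j Bc by simp
    qed
    then show ?thesis using y by blast
  qed
  then obtain Y where Y: "\<And>i. i < k \<Longrightarrow> Y i \<in> carrier_vec k"
    "\<And>i j. i < k \<Longrightarrow> j < n \<Longrightarrow> B $$ (i, j) = Y i \<bullet> col A j" by metis
  define G where "G = mat_of_rows k (map Y [0..<k])"
  have G: "G \<in> carrier_mat k k" by (auto simp: G_def)
  have rowG: "row G i = Y i" if "i < k" for i
    using that Y by (simp add: G_def)
  have BG: "B = G * A"
    using Ac Bc G by (intro eq_matI) (auto simp: Y rowG)
  have "det G\<^sup>T \<noteq> 0"
  proof
    assume "det G\<^sup>T = 0"
    then obtain v where v: "v \<in> carrier_vec k" "v \<noteq> 0\<^sub>v k" "G\<^sup>T *\<^sub>v v = 0\<^sub>v k"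
      using det_0_iff_vec_prod_zero[of "G\<^sup>T" k] G by auto
    have "v \<bullet> col B j = 0" if j: "j < n" for j
    proof -
      have a: "col A j \<in> carrier_vec k" using Ac j by auto
      have "v \<bullet> col B j = v \<bullet> (G *\<^sub>v col A j)"
        by (simp only: BG col_mult2[OF G Ac j])
      also have "\<dots> = (G\<^sup>T *\<^sub>v v) \<bullet> col A j"
        using G a v(1) by (simp add: transpose_vec_mult_scalar[of _ k k] )
      finally show ?thesis using v a by simp
    qed
    then show False using B v by (auto simp: represents_iff)
  qed
  then show ?thesis using G BG det_transpose[OF G] by auto
qed

text \<open>Column labels start at 1 throughout, whereas vectors and matrices are indexed from 0.\<close>

definition dep :: "complex vec set \<Rightarrow> nat set \<Rightarrow> nat \<Rightarrow> bool" where
  "dep V J e \<longleftrightarrow> (\<forall>x\<in>V. (\<forall>j\<in>J. x $ (j - 1) = 0) \<longrightarrow> x $ (e - 1) = 0)"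

text \<open>Columns are taken in the order of \<open>t\<close>, with repetitions allowed; this suits
  the replacement of a single column in Cramer's rule.\<close>

definition tuple_minor :: "nat \<Rightarrow> complex mat \<Rightarrow> (nat \<Rightarrow> nat) \<Rightarrow> complex" where
  "tuple_minor k A t = det (mat k k (\<lambda>(i, j). A $$ (i, t j - 1)))"

text \<open>The increasing enumeration of \<open>I\<close>, which is the column order of
  \<open>submatrix\<close>; the outer \<open>Suc\<close> undoes the shift between labels and
  indices.\<close>

definition enum_set :: "nat set \<Rightarrow> nat \<Rightarrow> nat" where
  "enum_set I j = Suc (pick {j. Suc j \<in> I} j)"

text \<open>For a row space \<open>V\<close> this is the row space of the matrix with columns
  \<open>\<xi> 1, ..., \<xi> n\<close>, expressed without choosing a matrix. Deletion and
  relabelling of columns have this form.\<close>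

definition pull :: "nat \<Rightarrow> (nat \<Rightarrow> nat) \<Rightarrow> complex vec set \<Rightarrow> complex vec set" where
  "pull n \<xi> V = (\<lambda>x. vec n (\<lambda>j. x $ (\<xi> (Suc j) - 1))) ` V"

lemma ball_atLeast1AtMost: "(\<forall>e\<in>{1..n}. P (e - 1)) \<longleftrightarrow> (\<forall>j<n. P j)" for n :: nat
proof
  assume *: "\<forall>e\<in>{1..n}. P (e - 1)"
  show "\<forall>j<n. P j"
  proof (intro allI impI)
    fix j assume "j < n"
    then show "P j" using *[rule_format, of "Suc j"] by simp
  qed
qed auto

lemma Suc_image_vimage: "I \<subseteq> {1..n} \<Longrightarrow> Suc ` {j. j < n \<and> Suc j \<in> I} = I"
proof (intro equalityI subsetI)
  fix i assume "I \<subseteq> {1..n}" "i \<in> I"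
  then show "i \<in> Suc ` {j. j < n \<and> Suc j \<in> I}" by (cases i) auto
qed auto

lemma enum_set_bij:
  assumes I: "I \<subseteq> {1..n}" "card I = k"
  shows "bij_betw (enum_set I) {..<k} I"
proof -
  define J where "J = {j. Suc j \<in> I}"
  have "J = {j. j < n \<and> Suc j \<in> I}" using I(1) by (auto simp: J_def)
  then have SJ: "Suc ` J = I" using Suc_image_vimage[OF I(1)] by simp
  have finJ: "finite J" by (rule finite_imageD[of Suc]) (use SJ finite_subset[OF I(1)] in auto)
  have cJ: "card J = k" using card_image[of Suc J] SJ I(2) by simp
  have lt: "pick J i < pick J j" if "i < j" "j < k" for i j
    using that cJ by (intro pick_mono) auto
  have inj: "inj_on (pick J) {..<k}"
    by (rule linorder_inj_onI') (metis lt lessThan_iff less_irrefl)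
  have "pick J ` {..<k} \<subseteq> J"
    using pick_in_set[of _ J] cJ by auto
  then have "pick J ` {..<k} = J"
    using finJ cJ inj by (intro card_subset_eq) (auto simp: card_image)
  then have "bij_betw (pick J) {..<k} J" using inj by (simp add: bij_betw_def)
  moreover have "bij_betw Suc J I" using SJ by (simp add: bij_betw_def)
  ultimately have "bij_betw (Suc \<circ> pick J) {..<k} I" by (rule bij_betw_trans)
  then show ?thesis by (simp add: enum_set_def[abs_def] J_def comp_def)
qed

lemma plucker_tuple_minor:
  assumes V: "V \<in> Gr k n" and I: "I \<subseteq> {1..n}" "card I = k"
  shows "plucker k n V I = tuple_minor k (rep k n V) (enum_set I)"
proof -
  have A: "rep k n V \<in> carrier_mat k n" using represents_rep[OF V] by (simp add: represents_iff)
  have "card {j. j < n \<and> Suc j \<in> I} = k"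
    using card_image[of Suc "{j. j < n \<and> Suc j \<in> I}"] I(2) Suc_image_vimage[OF I(1)] by simp
  then have "submatrix (rep k n V) UNIV {j. Suc j \<in> I} =
      mat k k (\<lambda>(i, j). rep k n V $$ (i, enum_set I j - 1))"
    using A by (auto simp: submatrix_def enum_set_def pick_UNIV)
  then show ?thesis using I by (simp add: plucker_def tuple_minor_def)
qed

lemma tuple_minor_mult:
  assumes G: "G \<in> carrier_mat k k" and A: "A \<in> carrier_mat k n"
    and t: "\<And>j. j < k \<Longrightarrow> t j \<in> {1..n}"
  shows "tuple_minor k (G * A) t = det G * tuple_minor k A t"
proof -
  define M where "M = mat k k (\<lambda>(i, j). A $$ (i, t j - 1))"
  have M: "M \<in> carrier_mat k k" by (simp add: M_def)
  have tl: "t j - 1 < n" if "j < k" for j using t[OF that] by auto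
  have "mat k k (\<lambda>(i, j). (G * A) $$ (i, t j - 1)) = G * M"
  proof (rule eq_matI)
    fix i j assume ij: "i < dim_row (G * M)" "j < dim_col (G * M)"
    then have "i < k" "j < k" using G M by auto
    moreover from this have "col M j = col A (t j - 1)"
      using A tl by (auto simp: M_def)
    ultimately show "mat k k (\<lambda>(i, j). (G * A) $$ (i, t j - 1)) $$ (i, j) = (G * M) $$ (i, j)"
      using G A M tl by auto
  qed (use G M in auto)
  then show ?thesis using det_mult[OF G M] by (simp add: tuple_minor_def M_def)
qed

lemma dep_iff:
  assumes A: "represents k n A V" and J: "J \<subseteq> {1..n}" and e: "e \<in> {1..n}"
  shows "dep V J e \<longleftrightarrow>
    (\<forall>y\<in>carrier_vec k. (\<forall>j\<in>J. y \<bullet> col A (j - 1) = 0) \<longrightarrow> y \<bullet> col A (e - 1) = 0)"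
proof -
  have V: "V = (\<lambda>y. vec n (\<lambda>j. y \<bullet> col A j)) ` carrier_vec k"
    using A by (simp add: represents_iff)
  have *: "vec n (\<lambda>j. y \<bullet> col A j) $ (j - 1) = y \<bullet> col A (j - 1)" if "j \<in> {1..n}" for y j
    using that by auto
  have "(\<forall>j\<in>J. vec n (\<lambda>j. y \<bullet> col A j) $ (j - 1) = 0) \<longleftrightarrow> (\<forall>j\<in>J. y \<bullet> col A (j - 1) = 0)" for y
    by (intro ball_cong refl arg_cong[of _ _ "\<lambda>z. z = 0"] *) (use J in auto)
  then show ?thesis unfolding dep_def V ball_simps *[OF e] by simp
qed

text \<open>The minor vanishes iff some nonzero functional kills the selected columns. A functional
  killing all columns is zero, so nonvanishing means that killing the selected columns forces
  killing all of them.\<close>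

lemma tuple_minor_nonzero_iff:
  assumes A: "represents k n A V" and t: "\<And>j. j < k \<Longrightarrow> t j \<in> {1..n}"
  shows "tuple_minor k A t \<noteq> 0 \<longleftrightarrow> (\<forall>e\<in>{1..n}. dep V (t ` {..<k}) e)"
proof -
  define M where "M = mat k k (\<lambda>(i, j). A $$ (i, t j - 1))"
  have M: "M \<in> carrier_mat k k" by (simp add: M_def)
  have Ac: "A \<in> carrier_mat k n" using A by (simp add: represents_iff)
  have tl: "t j - 1 < n" if "j < k" for j using t[OF that] by auto
  have colM: "col M j = col A (t j - 1)" if "j < k" for j
    using Ac tl that by (auto simp: M_def)
  have MT: "(M\<^sup>T *\<^sub>v y = 0\<^sub>v k) \<longleftrightarrow> (\<forall>j<k. y \<bullet> col A (t j - 1) = 0)"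
    if y: "y \<in> carrier_vec k" for y
  proof -
    have "(M\<^sup>T *\<^sub>v y) $ j = y \<bullet> col A (t j - 1)" if "j < k" for j
      using that M y Ac tl[OF that] comm_scalar_prod[of y k "col A (t j - 1)"] by (simp add: colM)
    moreover have "(M\<^sup>T *\<^sub>v y = 0\<^sub>v k) \<longleftrightarrow> (\<forall>j<k. (M\<^sup>T *\<^sub>v y) $ j = 0)"
    proof (intro iffI allI impI)
      fix j assume "M\<^sup>T *\<^sub>v y = 0\<^sub>v k" "j < k"
      then show "(M\<^sup>T *\<^sub>v y) $ j = 0" by (simp only: index_zero_vec)
    next
      assume "\<forall>j<k. (M\<^sup>T *\<^sub>v y) $ j = 0"
      then show "M\<^sup>T *\<^sub>v y = 0\<^sub>v k"
        by (intro eq_vecI) (use M in \<open>auto simp del: index_mult_mat_vec\<close>)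
    qed
    ultimately show ?thesis by simp
  qed
  have "tuple_minor k A t \<noteq> 0 \<longleftrightarrow> det M\<^sup>T \<noteq> 0"
    using det_transpose[OF M] by (simp add: tuple_minor_def M_def)
  also have "\<dots> \<longleftrightarrow> (\<forall>y\<in>carrier_vec k. (\<forall>j<k. y \<bullet> col A (t j - 1) = 0) \<longrightarrow> y = 0\<^sub>v k)"
  proof -
    have "det M\<^sup>T = 0 \<longleftrightarrow> (\<exists>y. y \<in> carrier_vec k \<and> y \<noteq> 0\<^sub>v k \<and> M\<^sup>T *\<^sub>v y = 0\<^sub>v k)"
      by (rule det_0_iff_vec_prod_zero) (use M in simp)
    then show ?thesis using MT by blast
  qed
  also have "\<dots> \<longleftrightarrow> (\<forall>y\<in>carrier_vec k. (\<forall>j<k. y \<bullet> col A (t j - 1) = 0) \<longrightarrow>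
      (\<forall>j<n. y \<bullet> col A j = 0))"
  proof -
    have "y = 0\<^sub>v k \<longleftrightarrow> (\<forall>j<n. y \<bullet> col A j = 0)" if y: "y \<in> carrier_vec k" for y
    proof
      assume "y = 0\<^sub>v k"
      then show "\<forall>j<n. y \<bullet> col A j = 0" using Ac by simp
    qed (use A y in \<open>simp add: represents_iff\<close>)
    then show ?thesis by (intro ball_cong refl) simp
  qed
  also have "\<dots> \<longleftrightarrow> (\<forall>e\<in>{1..n}. dep V (t ` {..<k}) e)"
  proof -
    have sub: "t ` {..<k} \<subseteq> {1..n}" using t by auto
    have 1: "(\<forall>j<k. y \<bullet> col A (t j - 1) = 0) \<longleftrightarrow> (\<forall>j\<in>t ` {..<k}. y \<bullet> col A (j - 1) = 0)" for y
      by auto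
    have 2: "(\<forall>j<n. y \<bullet> col A j = 0) \<longleftrightarrow> (\<forall>e\<in>{1..n}. y \<bullet> col A (e - 1) = 0)" for y
      by (rule ball_atLeast1AtMost[symmetric])
    have 3: "(\<forall>e\<in>{1..n}. dep V (t ` {..<k}) e) \<longleftrightarrow>
        (\<forall>e\<in>{1..n}. \<forall>y\<in>carrier_vec k. (\<forall>j\<in>t ` {..<k}. y \<bullet> col A (j - 1) = 0) \<longrightarrow> y \<bullet> col A (e - 1) = 0)"
      by (intro ball_cong refl dep_iff[OF A sub])
    show ?thesis unfolding 1 2 3 by blast
  qed
  finally show ?thesis .
qed

lemma plucker_nonzero_iff:
  assumes V: "V \<in> Gr k n" and I: "I \<subseteq> {1..n}" "card I = k"
  shows "plucker k n V I \<noteq> 0 \<longleftrightarrow> (\<forall>e\<in>{1..n}. dep V I e)"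
proof -
  have b: "bij_betw (enum_set I) {..<k} I" by (rule enum_set_bij[OF I])
  then have "enum_set I ` {..<k} = I" by (simp add: bij_betw_def)
  moreover have "enum_set I j \<in> {1..n}" if "j < k" for j
    using bij_betwE[OF b] that I(1) by blast
  ultimately show ?thesis
    using plucker_tuple_minor[OF assms] tuple_minor_nonzero_iff[OF represents_rep[OF V], of "enum_set I"]
    by simp
qed

lemma plucker_representation:
  assumes A: "represents k n A V"
  shows "\<exists>s. s \<noteq> 0 \<and> (\<forall>I. I \<subseteq> {1..n} \<and> card I = k \<longrightarrow> plucker k n V I = s * tuple_minor k A (enum_set I))"
proof -
  have V: "V \<in> Gr k n" using A by (auto simp: Gr_def)
  obtain G where G: "G \<in> carrier_mat k k" "det G \<noteq> 0" "rep k n V = G * A"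
    using represents_unique[OF A represents_rep[OF V]] by blast
  have "plucker k n V I = det G * tuple_minor k A (enum_set I)" if I: "I \<subseteq> {1..n}" "card I = k" for I
  proof -
    have "enum_set I j \<in> {1..n}" if "j < k" for j
      using bij_betwE[OF enum_set_bij[OF I]] that I(1) by blast
    moreover have "A \<in> carrier_mat k n" using A by (simp add: represents_iff)
    ultimately show ?thesis
      using plucker_tuple_minor[OF V I] tuple_minor_mult[OF G(1), of A n "enum_set I"]
      by (simp add: G(3))
  qed
  then show ?thesis using G(2) by blast
qed

text \<open>Sorting the columns costs a sign, and a repeated column gives zero. The point is that
  \<open>\<epsilon>\<close> does not depend on \<open>V\<close>: such a minor is a linear form in
  the Pluecker coordinates.\<close>

lemma tuple_minor_plucker:
  assumes t: "\<And>j. j < k \<Longrightarrow> t j \<in> {1..n}"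
  shows "\<exists>\<epsilon>. \<forall>V\<in>Gr k n. tuple_minor k (rep k n V) t = \<epsilon> * plucker k n V (t ` {..<k})"
proof (cases "inj_on t {..<k}")
  case False
  then obtain i j where ij: "i < k" "j < k" "i \<noteq> j" "t i = t j" by (auto simp: inj_on_def)
  have "tuple_minor k A t = 0" for A
    unfolding tuple_minor_def
    by (rule det_identical_cols[of _ k i j]) (use ij in \<open>auto intro!: eq_vecI\<close>)
  then show ?thesis by (intro exI[of _ 0]) simp
next
  case True
  define I where "I = t ` {..<k}"
  have I: "I \<subseteq> {1..n}" "card I = k" using True t by (auto simp: I_def card_image)
  define g where "g = inv_into {..<k} (enum_set I)"
  have bt: "bij_betw t {..<k} I" using True by (simp add: bij_betw_def I_def)
  have be: "bij_betw (enum_set I) {..<k} I" by (rule enum_set_bij[OF I])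
  have "bij_betw (g \<circ> t) {..<k} {..<k}"
    using bij_betw_trans[OF bt bij_betw_inv_into[OF be]] by (simp add: g_def)
  define \<pi> where "\<pi> j = (if j < k then g (t j) else j)" for j
  have "bij_betw \<pi> {0..<k} {0..<k}"
    using \<open>bij_betw (g \<circ> t) _ _\<close> bij_betw_cong[of "{..<k}" \<pi> "g \<circ> t" "{..<k}"]
    by (simp add: \<pi>_def lessThan_atLeast0)
  then have \<pi>: "\<pi> permutes {0..<k}" by (rule bij_imp_permutes) (simp add: \<pi>_def)
  have t\<pi>: "t j = enum_set I (\<pi> j)" if "j < k" for j
    using that be bt by (auto simp: \<pi>_def g_def bij_betw_def f_inv_into_f)
  have \<pi>k: "\<pi> j < k" if "j < k" for j using permutes_in_image[OF \<pi>, of j] that by simp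
  have "tuple_minor k A t = signof \<pi> * tuple_minor k A (enum_set I)" for A
  proof -
    define M where "M = mat k k (\<lambda>(i, j). A $$ (i, enum_set I j - 1))"
    have M: "M \<in> carrier_mat k k" by (simp add: M_def)
    have "mat k k (\<lambda>(i, j). A $$ (i, t j - 1)) = (mat k k (\<lambda>(i, j). M\<^sup>T $$ (\<pi> i, j)))\<^sup>T"
      by (intro eq_matI) (auto simp: M_def t\<pi> \<pi>k)
    then have "tuple_minor k A t = det (mat k k (\<lambda>(i, j). M\<^sup>T $$ (\<pi> i, j)))"
      unfolding tuple_minor_def by (simp add: det_transpose[of _ k])
    also have "\<dots> = signof \<pi> * det M\<^sup>T" using M \<pi> by (intro det_permute_rows) auto
    finally show ?thesis using det_transpose[OF M] by (simp add: tuple_minor_def M_def)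
  qed
  then show ?thesis
    using plucker_tuple_minor[OF _ I] unfolding I_def by (intro exI[of _ "signof \<pi>"]) simp
qed

lemma tuple_minor_linear_form:
  assumes "\<And>j. j < k \<Longrightarrow> t j \<in> {1..n}"
  shows "\<exists>\<epsilon> I. \<forall>V\<in>Gr k n. tuple_minor k (rep k n V) t = \<epsilon> * plucker k n V I"
  using tuple_minor_plucker[where t = t, OF assms] by blast

text \<open>Full rank survives the selection because the hypothesis \<open>dep\<close> makes the
  selected columns span.\<close>

lemma represents_pull:
  assumes A: "represents k n A V" and \<xi>: "\<And>j. j \<in> {1..n'} \<Longrightarrow> \<xi> j \<in> {1..n}"
    and dep: "\<And>e. e \<in> {1..n} \<Longrightarrow> dep V (\<xi> ` {1..n'}) e"
  shows "represents k n' (mat k n' (\<lambda>(i, j). A $$ (i, \<xi> (Suc j) - 1))) (pull n' \<xi> V)"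
proof -
  define B where "B = mat k n' (\<lambda>(i, j). A $$ (i, \<xi> (Suc j) - 1))"
  have Ac: "A \<in> carrier_mat k n" using A by (simp add: represents_iff)
  have \<xi>l: "\<xi> (Suc j) - 1 < n" if "j < n'" for j using \<xi>[of "Suc j"] that by auto
  have colB: "col B j = col A (\<xi> (Suc j) - 1)" if "j < n'" for j
    using Ac \<xi>l[OF that] that by (intro eq_vecI) (auto simp: B_def)
  have V: "V = (\<lambda>y. vec n (\<lambda>j. y \<bullet> col A j)) ` carrier_vec k"
    using A by (simp add: represents_iff)
  have "pull n' \<xi> V = (\<lambda>y. vec n' (\<lambda>j. y \<bullet> col B j)) ` carrier_vec k"
    unfolding V pull_def image_image using \<xi>l by (intro image_cong refl eq_vecI) (auto simp: colB)
  moreover have "y = 0\<^sub>v k" if y: "y \<in> carrier_vec k" and 0: "\<forall>j<n'. y \<bullet> col B j = 0" for y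
  proof -
    have *: "(vec n (\<lambda>j. y \<bullet> col A j)) $ (i - 1) = 0" if "i \<in> \<xi> ` {1..n'}" for i
    proof -
      obtain j where j: "j \<in> {1..n'}" "i = \<xi> j" using \<open>i \<in> \<xi> ` {1..n'}\<close> by blast
      then obtain j' where "j = Suc j'" "j' < n'" by (cases j) auto
      then show ?thesis using 0 \<open>i = \<xi> j\<close> \<xi>l[of j'] by (simp add: colB)
    qed
    have "y \<bullet> col A j = 0" if j: "j < n" for j
    proof -
      have "vec n (\<lambda>j. y \<bullet> col A j) $ (Suc j - 1) = 0"
        using dep[of "Suc j"] j * y unfolding dep_def V by auto
      then show ?thesis using j by simp
    qed
    then show ?thesis using A y by (auto simp: represents_iff)
  qed
  ultimately show ?thesis unfolding represents_iff B_def[symmetric] by (auto simp: B_def)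
qed

lemma dep_pull:
  assumes J: "J \<subseteq> {1..n'}" and e: "e \<in> {1..n'}"
  shows "dep (pull n' \<xi> V) J e \<longleftrightarrow> dep V (\<xi> ` J) (\<xi> e)"
proof -
  have *: "(vec n' (\<lambda>j. x $ (\<xi> (Suc j) - 1))) $ (j - 1) = x $ (\<xi> j - 1)"
    if "j \<in> {1..n'}" for j and x :: "complex vec"
    using that by (cases j) auto
  have "(\<forall>j\<in>J. (vec n' (\<lambda>j. x $ (\<xi> (Suc j) - 1))) $ (j - 1) = 0) \<longleftrightarrow> (\<forall>j\<in>J. x $ (\<xi> j - 1) = 0)"
    for x :: "complex vec"
    using J by (intro ball_cong refl) (subst *, auto)
  then show ?thesis unfolding dep_def pull_def ball_simps *[OF e] by simp
qed

section \<open>Affine permutations and skew shaped positroids\<close>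

definition cyc :: "nat \<Rightarrow> int \<Rightarrow> nat" where
  "cyc n i = nat ((i - 1) mod int n) + 1"

lemma cyc_range: "0 < n \<Longrightarrow> cyc n i \<in> {1..n}"
  using pos_mod_bound[of "int n" "i - 1"] pos_mod_sign[of "int n" "i - 1"] by (simp add: cyc_def Suc_le_eq nat_less_iff)

lemma cyc_add: "cyc n (i + int n) = cyc n i"
proof -
  have "i + int n - 1 = (i - 1) + int n" by simp
  then show ?thesis by (simp only: cyc_def mod_add_self2)
qed

lemma cyc_nat: "i \<in> {1..n} \<Longrightarrow> cyc n (int i) = i"
  by (cases i) (auto simp: cyc_def zmod_int[symmetric])

text \<open>The signs in \<open>ext_col\<close> are nonzero scalars and do not affect which
  functionals kill a column.\<close>

lemma ext_col_mem_span_iff: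
  assumes V: "V \<in> Gr k n" and n: "0 < n"
  shows "ext_col k n V i \<in> span_vec k (ext_col k n V ` {i+1..j}) \<longleftrightarrow> dep V (cyc n ` {i+1..j}) (cyc n i)"
proof -
  define A where "A = rep k n V"
  have A: "represents k n A V" using represents_rep[OF V] by (simp add: A_def)
  then have Ac: "A \<in> carrier_mat k n" by (simp add: represents_iff)
  have colc: "col A (cyc n i - 1) \<in> carrier_vec k" for i
    using Ac by (metis col_dim carrier_matD(1))
  obtain s :: "int \<Rightarrow> complex" where s: "\<And>i. s i \<noteq> 0"
    "\<And>i. ext_col k n V i = s i \<cdot>\<^sub>v col A (cyc n i - 1)"
    by (rule that[of "\<lambda>i. ((-1) ^ (k - 1)) powi ((i - 1) div int n)"])
      (simp_all add: ext_col_def A_def cyc_def)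
  have y: "y \<bullet> ext_col k n V i = 0 \<longleftrightarrow> y \<bullet> col A (cyc n i - 1) = 0" if "y \<in> carrier_vec k" for y i
    using s colc that by simp
  have c: "ext_col k n V i \<in> carrier_vec k" for i using s(2) colc by simp
  have "cyc n ` {i+1..j} \<subseteq> {1..n}" using cyc_range[OF n] by blast
  then show ?thesis
    using dep_iff[OF A _ cyc_range[OF n], of "cyc n ` {i+1..j}" i]
      mem_span_iff_orthogonal[of "ext_col k n V ` {i+1..j}" k "ext_col k n V i"] c y
    by (simp add: image_subset_iff)
qed

lemma dep_mono: "dep V J e \<Longrightarrow> J \<subseteq> K \<Longrightarrow> dep V K e"
  unfolding dep_def by blast

text \<open>Over the integers a least element needs a nonempty set bounded below, which
  \<open>e\<close> and \<open>i\<close> provide. Monotonicity reduces minimality to the single value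
  \<open>j - 1\<close>.\<close>

lemma Least_int_eq_iff:
  fixes i j :: int
  assumes mono: "\<And>j. i \<le> j \<Longrightarrow> P j \<Longrightarrow> P (j + 1)" and ex: "i \<le> e" "P e"
  shows "(LEAST j. i \<le> j \<and> P j) = j \<longleftrightarrow> i \<le> j \<and> P j \<and> (i < j \<longrightarrow> \<not> P (j - 1))"
proof -
  have up: "P j'" if "i \<le> j" "P j" "j \<le> j'" for j j'
    using that(3) by (induction rule: int_ge_induct) (use that mono in auto)
  have *: "(LEAST j. i \<le> j \<and> P j) = j" if j: "i \<le> j" "P j" "i < j \<longrightarrow> \<not> P (j - 1)" for j
  proof (rule Least_equality)
    fix y assume y: "i \<le> y \<and> P y"
    show "j \<le> y"
    proof (rule ccontr)
      assume "\<not> j \<le> y"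
      then show False using up[of y "j - 1"] y j by auto
    qed
  qed (use j in simp)
  have "\<exists>m. P (i + int m)" using ex by (intro exI[of _ "nat (e - i)"]) simp
  define m where "m = (LEAST m. P (i + int m))"
  have m: "P (i + int m)" "\<And>m'. m' < m \<Longrightarrow> \<not> P (i + int m')"
    using LeastI_ex[OF \<open>\<exists>m. P (i + int m)\<close>] not_less_Least[of _ "\<lambda>m. P (i + int m)"]
    by (auto simp: m_def)
  have "i < i + int m \<longrightarrow> \<not> P (i + int m - 1)"
  proof
    assume "i < i + int m"
    then have "m - 1 < m" "i + int (m - 1) = i + int m - 1" by auto
    then show "\<not> P (i + int m - 1)" using m(2)[of "m - 1"] by (metis)
  qed
  then show ?thesis using * m(1) *[of "i + int m"] by auto
qed

lemma affine_perm_eq_iff: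
  assumes V: "V \<in> Gr k n" and n: "0 < n"
  shows "affine_perm k n V i = j \<longleftrightarrow> i \<le> j \<and> dep V (cyc n ` {i+1..j}) (cyc n i) \<and>
    (i < j \<longrightarrow> \<not> dep V (cyc n ` {i+1..j-1}) (cyc n i))"
  unfolding affine_perm_def ext_col_mem_span_iff[OF assms]
proof (rule Least_int_eq_iff)
  show "i \<le> i + int n" by simp
  \<comment> \<open>The search ends at \<open>i + n\<close> at the latest, where the column is the
    \<open>i\<close>-th one up to sign.\<close>
  have "cyc n i \<in> cyc n ` {i+1..i+int n}" using n by (intro image_eqI[of _ _ "i + int n"]) (auto simp: cyc_add)
  then show "dep V (cyc n ` {i+1..i+int n}) (cyc n i)" unfolding dep_def by blast
qed (auto elim!: dep_mono)

lemma affine_perm_periodic: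
  assumes V: "V \<in> Gr k n" and n: "0 < n"
  shows "affine_perm k n V (i + int n) = affine_perm k n V i + int n"
proof -
  have *: "cyc n ` {i + int n + 1..j + int n} = cyc n ` {i+1..j}" for j
  proof -
    have "{i + int n + 1..j + int n} = (\<lambda>x. x + int n) ` {i+1..j}"
      by (simp add: add.commute add.left_commute)
    then show ?thesis by (simp only: image_image cyc_add)
  qed
  have "affine_perm k n V i = affine_perm k n V i" ..
  then have "i \<le> affine_perm k n V i \<and> dep V (cyc n ` {i+1..affine_perm k n V i}) (cyc n i) \<and>
    (i < affine_perm k n V i \<longrightarrow> \<not> dep V (cyc n ` {i+1..affine_perm k n V i - 1}) (cyc n i))"
    unfolding affine_perm_eq_iff[OF assms] .
  then show ?thesis
    unfolding affine_perm_eq_iff[OF assms, of "i + int n"] cyc_add *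
    using *[of "affine_perm k n V i - 1"] by (simp add: algebra_simps)
qed

lemma cyc_image_nat: "q \<le> n \<Longrightarrow> cyc n ` {int p + 1..int q} = {p<..q}"
proof -
  assume q: "q \<le> n"
  have "{int p + 1..int q} = int ` {p<..q}"
  proof (intro equalityI subsetI)
    fix x assume "x \<in> {int p + 1..int q}"
    then have "x = int (nat x)" "nat x \<in> {p<..q}" by auto
    then show "x \<in> int ` {p<..q}" by blast
  qed auto
  moreover have "cyc n (int x) = x" if "x \<in> {p<..q}" for x
    using that q by (intro cyc_nat) auto
  ultimately show ?thesis by (simp add: image_image)
qed

lemma cyc_image_wrap:
  assumes "b \<le> n" "l \<le> n"
  shows "cyc n ` {int b + 1..int l + int n} = {b<..n} \<union> {1..l}"
proof -
  have "{int b + 1..int l + int n} = {int b + 1..int n} \<union> {int n + 1..int l + int n}"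
    using assms by auto
  moreover have "{int n + 1..int l + int n} = (\<lambda>x. x + int n) ` {int 0 + 1..int l}" by simp
  ultimately have "cyc n ` {int b + 1..int l + int n} = cyc n ` {int b + 1..int n} \<union> cyc n ` {int 0 + 1..int l}"
    by (simp only: image_Un image_image cyc_add)
  also have "\<dots> = {b<..n} \<union> {0<..l}"
    using cyc_image_nat[of n n b] cyc_image_nat[of l n 0] assms by simp
  finally show ?thesis by auto
qed

text \<open>The values of the affine permutation read as dependences, with \<open>D\<close> abstract
  so that relations pulled back to the factors can be inserted. If the two heights agree, the label
  is a fixed point and the first clause says that it is a loop. A row label is sent beyond
  \<open>n\<close>, so its interval wraps around.\<close>

definition skew_dep :: "nat \<Rightarrow> nat \<Rightarrow> (nat \<Rightarrow> nat) \<Rightarrow> (nat \<Rightarrow> nat) \<Rightarrow> (nat set \<Rightarrow> nat \<Rightarrow> bool) \<Rightarrow> bool" where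
  "skew_dep k n lam mu D \<longleftrightarrow>
     (\<forall>c\<in>{1..n - k}. D {c + col_height k n mu c<..c + col_height k n lam c} (c + col_height k n mu c) \<and>
        (col_height k n mu c < col_height k n lam c \<longrightarrow>
          \<not> D {c + col_height k n mu c<..<c + col_height k n lam c} (c + col_height k n mu c))) \<and>
     (\<forall>i\<in>{1..k}. D ({b_index k n mu i<..n} \<union> {1..b_index k n lam i}) (b_index k n mu i) \<and>
        \<not> D ({b_index k n mu i<..n} \<union> {1..<b_index k n lam i}) (b_index k n mu i))"

lemma col_height_mono_partition:
  assumes "\<forall>i\<in>{1..k}. mu i \<le> lam i"
  shows "col_height k n mu c \<le> col_height k n lam c"
  unfolding col_height_def conj_part_def
proof (rule card_mono)
  show "{i \<in> {1..k}. n - k + 1 - c \<le> mu i} \<subseteq> {i \<in> {1..k}. n - k + 1 - c \<le> lam i}"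
    using assms le_trans by blast
qed simp

text \<open>\<open>affine_perm\<close> is always periodic, so comparing it with
  \<open>skew_perm\<close> amounts to comparing values on one period, which consists of the column
  labels and the row labels.\<close>

lemma skew_positroid_iff:
  assumes k: "0 < k" "k \<le> n" and lam: "partition_in_box k (n - k) lam" and mu: "partition_in_box k (n - k) mu"
    and le: "\<forall>i\<in>{1..k}. mu i \<le> lam i"
  shows "V \<in> skew_positroid k n lam mu \<longleftrightarrow> V \<in> Gr k n \<and> skew_dep k n lam mu (dep V)"
proof (cases "V \<in> Gr k n")
  case V: True
  have n: "0 < n" using k by simp
  have ex1: "\<exists>!f. is_skew_perm k n lam mu f" by (rule ex1_skew_perm[OF mu k])
  have "is_skew_perm k n lam mu (skew_perm k n lam mu)"
    unfolding skew_perm_def by (rule theI'[OF ex1])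
  then have "affine_perm k n V = skew_perm k n lam mu \<longleftrightarrow> is_skew_perm k n lam mu (affine_perm k n V)"
    using ex1 by auto
  also have "\<dots> \<longleftrightarrow> skew_dep k n lam mu (dep V)"
  proof -
    have col: "affine_perm k n V (int (c + col_height k n mu c)) = int (c + col_height k n lam c) \<longleftrightarrow>
        D {c + col_height k n mu c<..c + col_height k n lam c} (c + col_height k n mu c) \<and>
        (col_height k n mu c < col_height k n lam c \<longrightarrow>
          \<not> D {c + col_height k n mu c<..<c + col_height k n lam c} (c + col_height k n mu c))"
      if c: "c \<in> {1..n - k}" and D: "D = dep V" for c D
    proof -
      define p q where "p = c + col_height k n mu c" and "q = c + col_height k n lam c"
      have "col_height k n mu c \<le> col_height k n lam c"
        using le by (rule col_height_mono_partition)
      then have pq: "p \<in> {1..n}" "p \<le> q" "q \<le> n"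
        using c col_height_le[of k n lam c] by (auto simp: p_def q_def)
      have 1: "cyc n ` {int p + 1..int q - 1} = {p<..<q}" if "p < q"
      proof -
        have "int q - 1 = int (q - 1)" "{p<..q - 1} = {p<..<q}" using that by auto
        moreover have "cyc n ` {int p + 1..int (q - 1)} = {p<..q - 1}"
          by (rule cyc_image_nat) (use pq in simp)
        ultimately show ?thesis by (simp only:)
      qed
      have 2: "int p \<le> int q" "int p < int q \<longleftrightarrow> p < q" using pq by auto
      have "affine_perm k n V (int p) = int q \<longleftrightarrow> D {p<..q} p \<and> (p < q \<longrightarrow> \<not> D {p<..<q} p)"
        by (simp only: affine_perm_eq_iff[OF V n] D 2 cyc_image_nat[OF pq(3)] cyc_nat[OF pq(1)] 1
            simp_thms cong: imp_cong)
      then show ?thesis by (simp only: p_def q_def add_less_cancel_left)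
    qed
    have row: "affine_perm k n V (int (b_index k n mu i)) = int (n - k - lam i + i + n) \<longleftrightarrow>
        D ({b_index k n mu i<..n} \<union> {1..b_index k n lam i}) (b_index k n mu i) \<and>
        \<not> D ({b_index k n mu i<..n} \<union> {1..<b_index k n lam i}) (b_index k n mu i)"
      if i: "i \<in> {1..k}" and D: "D = dep V" for i D
    proof -
      define b l where "b = b_index k n mu i" and "l = b_index k n lam i"
      have bl: "b \<in> {1..n}" "1 \<le> l" "l \<le> n"
        using i k by (auto simp: b_def l_def b_index_def)
      have 1: "cyc n ` {int b + 1..int l + int n - 1} = {b<..n} \<union> {1..<l}"
      proof -
        have "int l + int n - 1 = int (l - 1) + int n" "{1..l - 1} = {1..<l}" using bl by auto
        moreover have "cyc n ` {int b + 1..int (l - 1) + int n} = {b<..n} \<union> {1..l - 1}"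
          by (rule cyc_image_wrap) (use bl in auto)
        ultimately show ?thesis by (simp only:)
      qed
      have 2: "cyc n ` {int b + 1..int l + int n} = {b<..n} \<union> {1..l}" "cyc n (int b) = b"
        by (rule cyc_image_wrap; use bl in simp) (rule cyc_nat; use bl in simp)
      have 3: "int b < int l + int n" "int b \<le> int l + int n" using bl by auto
      have "int (n - k - lam i + i + n) = int l + int n" by (simp add: l_def b_index_def)
      then have "affine_perm k n V (int b) = int (n - k - lam i + i + n) \<longleftrightarrow>
          D ({b<..n} \<union> {1..l}) b \<and> \<not> D ({b<..n} \<union> {1..<l}) b"
        by (simp only: affine_perm_eq_iff[OF V n] D 1 2 3 simp_thms)
      then show ?thesis by (simp only: b_def l_def)
    qed
    have "(\<forall>i. affine_perm k n V (i + int n) = affine_perm k n V i + int n) \<longleftrightarrow> True"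
      using affine_perm_periodic[OF V n] by blast
    moreover note ball_cong[OF refl col[OF _ refl], of "{1..n - k}" "\<lambda>c. c", simplified simp_thms]
    moreover note ball_cong[OF refl row[OF _ refl], of "{1..k}" "\<lambda>c. c"]
    ultimately show ?thesis
      unfolding is_skew_perm_def skew_dep_def by (simp only: simp_thms)
  qed
  finally show ?thesis using V by (simp add: skew_positroid_def open_positroid_def)
qed (simp add: skew_positroid_def open_positroid_def)

section \<open>Dependence relations on skew shapes\<close>

text \<open>\<open>D J e\<close> is read as membership of \<open>e\<close> in the closure of
  \<open>J\<close> in a matroid. Arguing from these axioms makes the same lemmas available for the
  relations pulled back to the factors.\<close>

locale dependence =
  fixes n :: nat and D :: "nat set \<Rightarrow> nat \<Rightarrow> bool"
  assumes D_refl: "e \<in> J \<Longrightarrow> D J e"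
    and D_trans: "(\<And>j. j \<in> J \<Longrightarrow> D K j) \<Longrightarrow> D J e \<Longrightarrow> D K e"
    and D_exchange: "J \<subseteq> {1..n} \<Longrightarrow> e \<in> {1..n} \<Longrightarrow> f \<in> {1..n} \<Longrightarrow>
      D (insert f J) e \<Longrightarrow> \<not> D J e \<Longrightarrow> D (insert e J) f"
begin

lemma D_mono: "D J e \<Longrightarrow> J \<subseteq> K \<Longrightarrow> D K e"
  by (rule D_trans[of J]) (auto intro: D_refl)

lemma D_cong:
  assumes "\<And>j. j \<in> J \<Longrightarrow> D K j" "\<And>j. j \<in> K \<Longrightarrow> D J j"
  shows "D J e \<longleftrightarrow> D K e"
  using D_trans[OF assms(1)] D_trans[OF assms(2)] by (rule iffI)

text \<open>Earlier elements are added one at a time: if adding \<open>e t\<close> made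
  \<open>e i\<close> dependent, exchange would put \<open>e t\<close> in the closure of later
  elements.\<close>

lemma independent_sequence:
  fixes e :: "nat \<Rightarrow> nat" and i k :: nat
  assumes e: "\<And>i. i \<in> {1..k} \<Longrightarrow> e i \<in> {1..n}"
    and indep: "\<And>i. i \<in> {1..k} \<Longrightarrow> \<not> D (e ` {i<..k}) (e i)"
    and i: "i \<in> {1..k}"
  shows "\<not> D (e ` ({1..k} - {i})) (e i)"
proof -
  have "\<not> D (e ` ({t..k} - {i})) (e i)" if "t \<le> i" "1 \<le> t" for t
    using that
  proof (induction "i - t" arbitrary: t)
    case 0
    then have "t = i" by simp
    then have "{t..k} - {i} = {i<..k}" by auto
    then show ?case using indep[OF i] by (simp only: not_False_eq_True)
  next
    case (Suc r)
    then have t: "t < i" "t \<in> {1..k}" using i by auto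
    have IH: "\<not> D (e ` ({Suc t..k} - {i})) (e i)"
      by (rule Suc.hyps(1)) (use Suc(2) t in simp_all)
    have 1: "{t..k} - {i} = insert t ({Suc t..k} - {i})" using t by auto
    have 2: "insert i ({Suc t..k} - {i}) = {t<..k}" using t i by auto
    show ?case
    proof
      assume "D (e ` ({t..k} - {i})) (e i)"
      then have *: "D (insert (e t) (e ` ({Suc t..k} - {i}))) (e i)" by (simp only: 1 image_insert)
      have "e ` ({Suc t..k} - {i}) \<subseteq> {1..n}" by (intro image_subsetI e) auto
      then have "D (insert (e i) (e ` ({Suc t..k} - {i}))) (e t)"
        by (rule D_exchange[OF _ e[OF i] e[OF t(2)] * IH])
      then show False using indep[OF t(2)] by (simp only: image_insert[symmetric] 2)
    qed
  qed
  from this[of 1] show ?thesis using i by simp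
qed

lemma dependence_pull:
  fixes \<xi> :: "nat \<Rightarrow> nat" and n' :: nat
  assumes \<xi>: "\<And>j. j \<in> {1..n'} \<Longrightarrow> \<xi> j \<in> {1..n}"
  shows "dependence n' (\<lambda>J e. D (\<xi> ` J) (\<xi> e))"
proof
  fix e and J K :: "nat set" assume *: "\<And>j. j \<in> J \<Longrightarrow> D (\<xi> ` K) (\<xi> j)" "D (\<xi> ` J) (\<xi> e)"
  show "D (\<xi> ` K) (\<xi> e)"
  proof (rule D_trans[OF _ *(2)])
    fix j assume "j \<in> \<xi> ` J"
    then show "D (\<xi> ` K) j" using *(1) by (elim imageE) simp
  qed
next
  fix J e f assume *: "J \<subseteq> {1..n'}" "e \<in> {1..n'}" "f \<in> {1..n'}"
    "D (\<xi> ` insert f J) (\<xi> e)" "\<not> D (\<xi> ` J) (\<xi> e)"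
  have "\<xi> ` J \<subseteq> {1..n}" using *(1) by (intro image_subsetI \<xi>) auto
  then show "D (\<xi> ` insert e J) (\<xi> f)"
    unfolding image_insert by (rule D_exchange[OF _ \<xi>[OF *(2)] \<xi>[OF *(3)] *(4)[unfolded image_insert] *(5)])
next
  fix e and J :: "nat set" assume "e \<in> J"
  then show "D (\<xi> ` J) (\<xi> e)" by (intro D_refl imageI)
qed

end

lemma dependence_dep:
  assumes A: "represents k n A V"
  shows "dependence n (dep V)"
proof
  fix J e f assume J: "J \<subseteq> {1..n}" and e: "e \<in> {1..n}" and f: "f \<in> {1..n}"
    and D: "dep V (insert f J) e" "\<not> dep V J e"
  have sub: "insert f J \<subseteq> {1..n}" "insert e J \<subseteq> {1..n}" using J e f by auto
  have Ac: "A \<in> carrier_mat k n" using A by (simp add: represents_iff)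
  obtain z where z: "z \<in> carrier_vec k" "\<forall>j\<in>J. z \<bullet> col A (j - 1) = 0" "z \<bullet> col A (e - 1) \<noteq> 0"
    using D(2) dep_iff[OF A J e] by blast
  show "dep V (insert e J) f"
    unfolding dep_iff[OF A sub(2) f]
  proof (intro ballI impI)
    fix y assume y: "y \<in> carrier_vec k" and y0: "\<forall>j\<in>insert e J. y \<bullet> col A (j - 1) = 0"
    \<comment> \<open>\<open>w\<close> combines \<open>y\<close> and \<open>z\<close> so as to kill
      \<open>f\<close> along with \<open>J\<close>, hence it kills \<open>e\<close>. Since
      \<open>y\<close> kills \<open>e\<close> and \<open>z\<close> does not, \<open>y\<close> must
      kill \<open>f\<close>.\<close>
    define w where "w = (z \<bullet> col A (f - 1)) \<cdot>\<^sub>v y - (y \<bullet> col A (f - 1)) \<cdot>\<^sub>v z"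
    have w: "w \<in> carrier_vec k" using y z by (simp add: w_def)
    have wc: "w \<bullet> col A (j - 1) =
        (z \<bullet> col A (f - 1)) * (y \<bullet> col A (j - 1)) - (y \<bullet> col A (f - 1)) * (z \<bullet> col A (j - 1))" for j
    proof -
      have "col A (j - 1) \<in> carrier_vec k" using Ac by (metis col_dim carrier_matD(1))
      then show ?thesis using y z by (simp add: w_def minus_scalar_prod_distrib[of _ k])
    qed
    have "w \<bullet> col A (j - 1) = 0" if "j \<in> insert f J" for j
      using that unfolding wc using y0 z(2) by auto
    then have "w \<bullet> col A (e - 1) = 0"
      using D(1) w unfolding dep_iff[OF A sub(1) e] by blast
    then show "y \<bullet> col A (f - 1) = 0" using y0 z(3) unfolding wc by simp
  qed
next
  fix J K e assume "\<And>j. j \<in> J \<Longrightarrow> dep V K j" "dep V J e"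
  then show "dep V K e" unfolding dep_def by blast
qed (simp add: dep_def)

section \<open>Row and column labels of partitions and of their truncations\<close>

lemma le_col_height_iff:
  assumes nu: "partition_in_box k (n - k) nu" and i: "i \<in> {1..k}" and c: "c \<in> {1..n - k}"
  shows "i \<le> col_height k n nu c \<longleftrightarrow> n - k - nu i < c"
proof -
  define S where "S = {j\<in>{1..k}. n - k + 1 - c \<le> nu j}"
  have S: "col_height k n nu c = card S" by (simp add: col_height_def conj_part_def S_def)
  have anti: "nu j \<le> nu i" if "i \<le> j" "i \<in> {1..k}" "j \<in> {1..k}" for i j
    using nu that unfolding partition_in_box_def by blast
  have "n - k - nu i < c \<longleftrightarrow> i \<in> S" using i c by (auto simp: S_def)
  moreover have "i \<le> card S" if "i \<in> S"
  proof -
    have "j \<in> S" if "j \<in> {1..i}" for j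
      using anti[of j i] that \<open>i \<in> S\<close> by (simp add: S_def)
    then have "card {1..i} \<le> card S" by (intro card_mono) (auto simp: S_def)
    then show ?thesis by simp
  qed
  moreover have "card S < i" if "i \<notin> S"
  proof -
    have "j < i" if "j \<in> S" for j
    proof (rule ccontr)
      assume "\<not> j < i"
      then show False using anti[of i j] that \<open>i \<notin> S\<close> i by (simp add: S_def)
    qed
    then have "S \<subseteq> {1..<i}" by (auto simp: S_def)
    then have "card S \<le> card {1..<i}" by (intro card_mono) auto
    then show ?thesis using i by auto
  qed
  ultimately show ?thesis unfolding S by (meson not_le)
qed

text \<open>The boundary path of \<open>nu\<close> has \<open>n\<close> steps; the two families of
  labels number its horizontal and its vertical steps. The proof counts \<open>n - k\<close> and
  \<open>k\<close> distinct labels.\<close>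

lemma index_cover:
  assumes nu: "partition_in_box k (n - k) nu" and kn: "k \<le> n" and j: "j \<in> {1..n}"
  shows "(\<exists>c\<in>{1..n - k}. j = c + col_height k n nu c) \<or> (\<exists>i\<in>{1..k}. j = b_index k n nu i)"
proof -
  define p where "p = (\<lambda>c. c + col_height k n nu c)"
  have injp: "inj_on p {1..n - k}"
  proof (rule linorder_inj_onI')
    fix c d :: nat assume "c < d"
    then show "p c \<noteq> p d" using col_height_mono[of c d k n nu] unfolding p_def by auto
  qed
  have injb: "inj_on (b_index k n nu) {1..k}"
    by (rule linorder_inj_onI') (use b_index_less[OF nu] in fastforce)
  have disj: "p ` {1..n - k} \<inter> b_index k n nu ` {1..k} = {}"
    using col_index_neq_b_index[OF nu] unfolding p_def by blast
  have "p ` {1..n - k} \<union> b_index k n nu ` {1..k} = {1..n}"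
  proof (rule card_subset_eq)
    show "card (p ` {1..n - k} \<union> b_index k n nu ` {1..k}) = card {1..n}"
      using disj injp injb kn by (simp add: card_Un_disjoint card_image)
    have "p c \<in> {1..n}" if "c \<in> {1..n - k}" for c
      using that col_height_le[of k n nu c] kn unfolding p_def by auto
    moreover have "b_index k n nu i \<in> {1..n}" if "i \<in> {1..k}" for i
      using that kn unfolding b_index_def by auto
    ultimately show "p ` {1..n - k} \<union> b_index k n nu ` {1..k} \<subseteq> {1..n}" by blast
  qed simp
  then show ?thesis using j unfolding p_def by blast
qed

lemma partition_cut_right:
  assumes "partition_in_box k (n - k) nu" "1 \<le> a" "a \<le> n - k"
  shows "partition_in_box k (k + a - 1 - k) (cut_right k n a nu)"
proof -
  have "k + a - 1 - k = a - 1" by simp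
  moreover have "x - (r - a + 1) \<le> a - 1" if "x \<le> r" "1 \<le> a" "a \<le> r" for x r :: nat
    using that by arith
  ultimately show ?thesis
    using assms unfolding partition_in_box_def cut_right_def
    by (metis diff_le_mono)
qed

lemma partition_cut_left:
  assumes "partition_in_box k (n - k) nu" "1 \<le> a" "a \<le> n - k"
  shows "partition_in_box k (n - a + 1 - k) (cut_left k n a nu)"
proof -
  have "n - a + 1 - k = n - k - a + 1" using assms(2,3) by arith
  then show ?thesis
    using assms unfolding partition_in_box_def cut_left_def
    by (metis min.cobounded2 min.mono order_refl)
qed

lemma col_height_cut_right:
  assumes "a \<le> n - k" "c \<in> {1..a - 1}"
  shows "col_height k (k + a - 1) (cut_right k n a nu) c = col_height k n nu c"
proof -
  have arith: "a - 1 + 1 - c \<le> x - (r - a + 1) \<longleftrightarrow> r + 1 - c \<le> x"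
    if "a \<le> r" "1 \<le> c" "c \<le> a - 1" for x r :: nat
    using that by arith
  have "k + a - 1 - k + 1 - c = a - 1 + 1 - c" by simp
  moreover have "a - 1 + 1 - c \<le> nu i - (n - k - a + 1) \<longleftrightarrow> n - k + 1 - c \<le> nu i" for i
    by (rule arith) (use assms in simp_all)
  ultimately show ?thesis unfolding col_height_def conj_part_def cut_right_def by (simp only:)
qed

lemma col_height_cut_left:
  assumes "1 \<le> a" "a \<le> n - k" "c \<in> {1..n - a + 1 - k}"
  shows "col_height k (n - a + 1) (cut_left k n a nu) c = col_height k n nu (c + (a - 1))"
proof -
  have arith: "r - a + 1 + 1 - c \<le> min x (r - a + 1) \<longleftrightarrow> r + 1 - (c + (a - 1)) \<le> x"
    if "1 \<le> a" "a \<le> r" "1 \<le> c" "c \<le> r - a + 1" for x r :: nat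
    using that by arith
  have 1: "n - a + 1 - k = n - k - a + 1" using assms(1,2) by arith
  have "n - k - a + 1 + 1 - c \<le> min (nu i) (n - k - a + 1) \<longleftrightarrow> n - k + 1 - (c + (a - 1)) \<le> nu i" for i
    by (rule arith) (use assms 1 in simp_all)
  then show ?thesis unfolding col_height_def conj_part_def cut_left_def 1 by (simp only:)
qed

lemma b_index_cut_right:
  assumes nu: "partition_in_box k (n - k) nu" and a: "1 \<le> a" "a \<le> n - k" and i: "i \<in> {1..k}"
  shows "b_index k (k + a - 1) (cut_right k n a nu) i = min (a - 1) (n - k - nu i) + i"
proof -
  have arith: "a - 1 - (x - (r - a + 1)) = min (a - 1) (r - x)" if "x \<le> r" "a \<le> r" "1 \<le> a" for x r :: nat
    using that by arith
  have "nu i \<le> n - k" using nu i unfolding partition_in_box_def by blast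
  then have "a - 1 - (nu i - (n - k - a + 1)) = min (a - 1) (n - k - nu i)"
    by (rule arith) (use a in simp_all)
  moreover have "k + a - 1 - k = a - 1" by simp
  ultimately show ?thesis unfolding b_index_def cut_right_def by (simp only:)
qed

lemma b_index_cut_left:
  assumes "1 \<le> a" "a \<le> n - k"
  shows "b_index k (n - a + 1) (cut_left k n a nu) i = n - k - nu i - (a - 1) + i"
proof -
  have arith: "r - a + 1 - min x (r - a + 1) = r - x - (a - 1)" if "1 \<le> a" "a \<le> r" for x r :: nat
    using that by arith
  have "n - a + 1 - k = n - k - a + 1" using assms(1,2) by arith
  then show ?thesis
    using arith[OF assms, of "nu i"] unfolding b_index_def cut_left_def by (simp only:)
qed

locale skew_shape =
  fixes k n :: nat and lam mu :: "nat \<Rightarrow> nat"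
  assumes k_pos: "0 < k" and k_le: "k \<le> n"
    and lam: "partition_in_box k (n - k) lam" and mu: "partition_in_box k (n - k) mu"
    and mu_le_lam: "\<forall>i\<in>{1..k}. mu i \<le> lam i"
begin

abbreviation "b \<equiv> b_index k n mu"
abbreviation "l \<equiv> b_index k n lam"
abbreviation "g \<equiv> col_height k n mu"
abbreviation "h \<equiv> col_height k n lam"

lemma b_range: "i \<in> {1..k} \<Longrightarrow> b i \<in> {1..n}"
  using k_le by (auto simp: b_index_def)

lemma b_mono: "i \<in> {1..k} \<Longrightarrow> j \<in> {1..k} \<Longrightarrow> i < j \<Longrightarrow> b i < b j"
  by (rule b_index_less[OF mu])

lemma b_le_iff:
  assumes "i \<in> {1..k}" "j \<in> {1..k}"
  shows "b i < b j \<longleftrightarrow> i < j"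
  using b_mono[OF assms] b_mono[OF assms(2,1)] by (cases i j rule: linorder_cases) auto

lemma l_le_b: "i \<in> {1..k} \<Longrightarrow> l i \<le> b i"
  using mu_le_lam by (simp add: b_index_def diff_le_mono2)

lemma g_le_h: "g c \<le> h c"
  using mu_le_lam by (rule col_height_mono_partition)

lemma le_g_iff: "i \<in> {1..k} \<Longrightarrow> c \<in> {1..n - k} \<Longrightarrow> i \<le> g c \<longleftrightarrow> b i < c + i"
  using le_col_height_iff[OF mu] by (simp add: b_index_def)

lemma le_h_iff: "i \<in> {1..k} \<Longrightarrow> c \<in> {1..n - k} \<Longrightarrow> i \<le> h c \<longleftrightarrow> l i < c + i"
  using le_col_height_iff[OF lam] by (simp add: b_index_def)

end

locale skew_shape_dep = skew_shape k n lam mu + dependence n D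
  for k n :: nat and lam mu :: "nat \<Rightarrow> nat" and D :: "nat set \<Rightarrow> nat \<Rightarrow> bool"
begin

text \<open>Descending induction on the label: a column label that is not covered by
  \<open>K\<close> outright depends on larger labels, still at most \<open>u\<close>, and a row
  label is covered by hypothesis.\<close>

lemma dep_on_interval:
  assumes b: "\<And>i. i \<in> {1..k} \<Longrightarrow> s \<le> b i \<Longrightarrow> b i \<le> u \<Longrightarrow> D K (b i)"
    and col: "\<And>c. c \<in> {1..n - k} \<Longrightarrow> s \<le> c + g c \<Longrightarrow> c + g c \<le> u \<Longrightarrow>
      D K (c + g c) \<or> (c + h c \<le> u \<and> D {c + g c<..c + h c} (c + g c))"
    and u: "1 \<le> s" "u \<le> n" and j: "j \<in> {s..u}"
  shows "D K j"
  using j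
proof (induction "u - j" arbitrary: j rule: less_induct)
  case less
  have "j \<in> {1..n}" using less(2) u by auto
  from index_cover[OF mu k_le this] consider
    c where "c \<in> {1..n - k}" "j = c + g c" | i where "i \<in> {1..k}" "j = b i" by blast
  then show ?case
  proof cases
    case 1
    from col[of c] 1 less(2) consider "D K j" | "c + h c \<le> u" "D {j<..c + h c} j" by auto
    then show ?thesis
    proof cases
      case 2
      show ?thesis
      proof (rule D_trans[OF _ 2(2)])
        fix j' assume "j' \<in> {j<..c + h c}"
        then show "D K j'" using 2(1) less(2) by (intro less(1)) auto
      qed
    qed
  next
    case 2
    then show ?thesis using b less(2) by auto
  qed
qed

definition columns_dependent :: bool where
  "columns_dependent \<longleftrightarrow> (\<forall>c\<in>{1..n - k}. D {c + g c<..c + h c} (c + g c))"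

definition rows_independent :: bool where
  "rows_independent \<longleftrightarrow> (\<forall>i\<in>{1..k}. \<not> D (b ` ({1..k} - {i})) (b i))"

lemma skew_dep_columns: "skew_dep k n lam mu D \<Longrightarrow> columns_dependent"
  unfolding skew_dep_def columns_dependent_def by blast

lemma dep_on_b_from:
  assumes col: columns_dependent and s: "1 \<le> s" and j: "j \<in> {s..n}"
  shows "D (b ` {i\<in>{1..k}. s \<le> b i}) j"
proof (rule dep_on_interval[OF _ _ s order_refl j])
  fix c assume c: "c \<in> {1..n - k}"
  have "c + h c \<le> n" using c k_le col_height_le[of k n lam c] by auto
  then show "D (b ` {i\<in>{1..k}. s \<le> b i}) (c + g c) \<or> c + h c \<le> n \<and> D {c + g c<..c + h c} (c + g c)"
    using col c unfolding columns_dependent_def by blast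
qed (auto intro: D_refl)

lemma dep_on_b_above:
  assumes col: columns_dependent and i: "i \<in> {1..k}" and j: "j \<in> {b i<..n}"
  shows "D (b ` {i<..k}) j"
proof -
  have "{j\<in>{1..k}. Suc (b i) \<le> b j} = {i<..k}" using b_le_iff[OF i] i by (auto simp: Suc_le_eq)
  moreover have "1 \<le> Suc (b i)" "j \<in> {Suc (b i)..n}" using j by auto
  ultimately show ?thesis using dep_on_b_from[OF col, of "Suc (b i)" j] by (simp only:)
qed

lemma dep_on_b:
  assumes col: columns_dependent and j: "j \<in> {1..n}"
  shows "D (b ` {1..k}) j"
proof -
  have "{j\<in>{1..k}. 1 \<le> b j} = {1..k}" using b_range by auto
  then show ?thesis using dep_on_b_from[OF col order_refl j] by (simp only:)
qed

text \<open>The labels \<open>b t\<close> with \<open>t > j\<close> lie in the unwrapped part of the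
  interval of row \<open>j\<close>, so \<open>b j\<close> is independent of them;
  \<open>independent_sequence\<close> makes this symmetric.\<close>

lemma skew_dep_rows:
  assumes "skew_dep k n lam mu D"
  shows rows_independent
  unfolding rows_independent_def
proof
  fix i assume i: "i \<in> {1..k}"
  show "\<not> D (b ` ({1..k} - {i})) (b i)"
  proof (rule independent_sequence[OF b_range _ i])
    fix j assume j: "j \<in> {1..k}"
    then have *: "\<not> D ({b j<..n} \<union> {1..<l j}) (b j)" using assms unfolding skew_dep_def by blast
    have "b ` {j<..k} \<subseteq> {b j<..n}"
    proof
      fix x assume "x \<in> b ` {j<..k}"
      then obtain i where "i \<in> {1..k}" "j < i" "x = b i" using j by auto
      then show "x \<in> {b j<..n}" using b_mono[OF j] b_range by auto
    qed
    then have "b ` {j<..k} \<subseteq> {b j<..n} \<union> {1..<l j}" by (rule le_supI1)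
    then show "\<not> D (b ` {j<..k}) (b j)" using * D_mono[of "b ` {j<..k}" "b j"] by metis
  qed
qed

end

section \<open>Cutting along a column\<close>

text \<open>\<open>cut\<close> extracts the numerical content of the ribbon condition: the northeast
  neighbour of the lowest skew box in column \<open>a\<close> is outside \<open>lam\<close>, and
  heights do not increase to the right. If column \<open>a\<close> of the skew shape is empty, even
  the bound \<open>g a\<close> holds.\<close>

locale column_cut = skew_shape +
  fixes a :: nat
  assumes a_pos: "1 \<le> a" and a_le: "a \<le> n - k"
    and cut: "\<And>c. 1 \<le> c \<Longrightarrow> c < a \<Longrightarrow> h c \<le> Suc (g a)"
begin

abbreviation "m \<equiv> g a"
abbreviation "P \<equiv> a + g a"

text \<open>If column \<open>a\<close> of the skew diagram is empty then \<open>v\<^sub>P = 0\<close>, and the right factor keeps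
  \<open>b\<^sub>m\<^sub>+\<^sub>1\<close> instead of \<open>P\<close>.\<close>

definition idx_right :: "nat \<Rightarrow> nat" where
  "idx_right j = (if j < P then j else if j = P \<and> m < h a then P else b (j - (a - 1)))"

text \<open>The shift sends \<open>m + 1\<close> to \<open>P\<close> and the last label to
  \<open>n\<close>. Correspondingly, position \<open>a - 1 + i\<close> of the right factor belongs
  to row \<open>i\<close> for \<open>i > m\<close>, so that row \<open>m + 1\<close> sits at
  position \<open>P\<close>.\<close>

definition idx_left :: "nat \<Rightarrow> nat" where
  "idx_left j = (if j \<le> m then b j else j + (a - 1))"

lemma a_in: "a \<in> {1..n - k}" using a_pos a_le by simp

lemma m_le: "m \<le> k" by (rule col_height_le)

lemma P_le: "P \<le> n" using a_le m_le k_le by linarith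

lemma b_less_P_iff: "i \<in> {1..k} \<Longrightarrow> b i < P \<longleftrightarrow> i \<le> m"
  and b_ge: "i \<in> {1..k} \<Longrightarrow> m < i \<Longrightarrow> a + i \<le> b i"
  and b_le: "i \<in> {1..k} \<Longrightarrow> i \<le> m \<Longrightarrow> b i < a + i"
proof -
  show *: "a + i \<le> b i" if "i \<in> {1..k}" "m < i" for i
    using le_g_iff[OF that(1) a_in] that by auto
  show **: "b i < a + i" if "i \<in> {1..k}" "i \<le> m" for i
    using le_g_iff[OF that(1) a_in] that by auto
  show "b i < P \<longleftrightarrow> i \<le> m" if "i \<in> {1..k}"
    using *[OF that] **[OF that] by (cases "i \<le> m") auto
qed

text \<open>Rows of \<open>lam\<close> from \<open>m + 2\<close> on do not reach the columns right
  of \<open>a\<close>, so \<open>l i\<close> is at least \<open>a - 1 + i\<close>.\<close>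

lemma l_gt_P: "i \<in> {1..k} \<Longrightarrow> m + 2 \<le> i \<Longrightarrow> P < l i"
proof (cases "a = 1")
  case True
  assume "i \<in> {1..k}" "m + 2 \<le> i"
  then show ?thesis using True by (simp add: b_index_def)
next
  case False
  assume i: "i \<in> {1..k}" "m + 2 \<le> i"
  have a1: "1 \<le> a - 1" "a - 1 < a" using False a_pos by linarith+
  then have "a - 1 \<in> {1..n - k}" "\<not> i \<le> h (a - 1)" using i a_in cut[OF a1] by auto
  then show ?thesis using le_h_iff[of i "a - 1"] i False a_pos by auto
qed

lemma l_gt_P': "Suc m \<in> {1..k} \<Longrightarrow> \<not> m < h a \<Longrightarrow> P < l (Suc m)"
  using le_h_iff[OF _ a_in, of "Suc m"] by auto

lemma l_le_P: "i \<in> {1..k} \<Longrightarrow> i \<le> h a \<Longrightarrow> l i < a + i"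
  using le_h_iff[OF _ a_in] by auto

text \<open>The spanning arguments use the ribbon condition through this bound: a relation belonging
  to a column right of \<open>a\<close> ends at \<open>P\<close> at the latest.\<close>

lemma col_less_end: "c \<in> {1..<a} \<Longrightarrow> c + h c \<le> P"
  using cut[of c] by auto

text \<open>If such a relation does reach \<open>P\<close>, the right factor keeps \<open>P\<close>
  itself and not its substitute \<open>b (Suc m)\<close>.\<close>

lemma col_less_end': "c \<in> {1..<a} \<Longrightarrow> c + h c = P \<Longrightarrow> m < h a"
  using col_height_mono[of c a k n lam] by auto

lemma col_ge: "a \<le> c \<Longrightarrow> P \<le> c + g c"
  using col_height_mono[of a c k n mu] by auto

end

section \<open>Index maps of the two factors\<close>

context column_cut
begin

lemma idx_right_less: "j < P \<Longrightarrow> idx_right j = j"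
  by (simp add: idx_right_def)

lemma idx_right_P: "m < h a \<Longrightarrow> idx_right P = P"
  by (simp add: idx_right_def)

lemma idx_right_b:
  assumes "m < i" "i \<noteq> Suc m \<or> \<not> m < h a"
  shows "idx_right (a - 1 + i) = b i"
proof -
  have 1: "\<not> a - 1 + i < P" "a - 1 + i - (a - 1) = i" using assms(1) a_pos by auto
  have "a - 1 + i = P \<longleftrightarrow> i = Suc m" using a_pos by auto
  then have "\<not> (a - 1 + i = P \<and> m < h a)" using assms(2) by blast
  then show ?thesis unfolding idx_right_def if_not_P[OF 1(1)] 1(2) by (rule if_not_P)
qed

lemma idx_left_le: "j \<le> m \<Longrightarrow> idx_left j = b j"
  by (simp add: idx_left_def)

lemma idx_left_gt: "m < j \<Longrightarrow> idx_left j = j + (a - 1)"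
  by (simp add: idx_left_def)

lemma right_index_cases:
  assumes "j \<in> {1..k + a - 1}"
  obtains "1 \<le> j" "j < P" | i where "i \<in> {1..k}" "m < i" "j = a - 1 + i"
proof (cases "j < P")
  case True
  then show ?thesis using that(1) assms by simp
next
  case False
  have "j - (a - 1) \<in> {1..k}" "m < j - (a - 1)" "j = a - 1 + (j - (a - 1))"
    using False assms a_pos by auto
  then show ?thesis by (rule that(2))
qed

lemma idx_right_ge_P:
  assumes i: "i \<in> {1..k}" "m < i"
  shows "idx_right (a - 1 + i) \<in> {P..n}"
proof (cases "i \<noteq> Suc m \<or> \<not> m < h a")
  case True
  then show ?thesis using idx_right_b[OF i(2) True] b_ge[OF i] b_range[OF i(1)] i(2) by auto
next
  case False
  then have "a - 1 + i = P" "m < h a" using a_pos by auto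
  then show ?thesis using idx_right_P P_le by simp
qed

lemma idx_right_range:
  assumes "j \<in> {1..k + a - 1}"
  shows "idx_right j \<in> {1..n}"
  using assms
proof (cases rule: right_index_cases)
  case 1
  then show ?thesis using P_le by (simp add: idx_right_less)
next
  case (2 i)
  then show ?thesis using idx_right_ge_P[of i] a_pos by auto
qed

lemma idx_left_range:
  assumes "j \<in> {1..n - a + 1}"
  shows "idx_left j \<in> {1..n}"
proof (cases "j \<le> m")
  case True
  then show ?thesis using b_range[of j] m_le assms by (auto simp: idx_left_le)
next
  case False
  then show ?thesis using assms a_pos a_le by (auto simp: idx_left_gt)
qed

text \<open>The columns \<open>b\<^sub>1, \<dots>, b\<^sub>m\<close> together with the tail of the right part form the basis in
  which both parts are normalised when they are glued.\<close>

definition gluing_basis :: "nat \<Rightarrow> nat" where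
  "gluing_basis i = (if i \<le> m then b i else idx_right (a - 1 + i))"

lemma gluing_basis_range: "i \<in> {1..k} \<Longrightarrow> gluing_basis i \<in> {1..n}"
  using b_range idx_right_ge_P[of i] a_pos by (auto simp: gluing_basis_def)

end

locale column_cut_dep = column_cut k n lam mu a + skew_shape_dep k n lam mu D
  for k n :: nat and lam mu :: "nat \<Rightarrow> nat" and a :: nat and D :: "nat set \<Rightarrow> nat \<Rightarrow> bool"
begin

text \<open>Relations of columns right of \<open>a\<close> stay within the labels up to
  \<open>P\<close>, and the other labels there are \<open>b 1, ..., b m\<close> and possibly
  \<open>P\<close>. Together with \<open>dep_above_P\<close>, the ranks of the two sides add up to
  at most \<open>k + 1\<close>.\<close>

lemma dep_below_P:
  assumes col: columns_dependent and j: "j \<in> {1..P}"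
  shows "D (b ` {1..m} \<union> {P}) j"
proof (rule dep_on_interval[OF _ _ order_refl P_le j])
  fix i assume i: "i \<in> {1..k}" "b i \<le> P"
  then have "i \<in> {1..m} \<or> b i = P" using b_less_P_iff[of i] by auto
  then show "D (b ` {1..m} \<union> {P}) (b i)" by (intro D_refl) auto
next
  fix c assume c: "c \<in> {1..n - k}" "c + g c \<le> P"
  show "D (b ` {1..m} \<union> {P}) (c + g c) \<or> c + h c \<le> P \<and> D {c + g c<..c + h c} (c + g c)"
  proof (cases "c < a")
    case True
    then show ?thesis using c col col_less_end[of c] unfolding columns_dependent_def by auto
  next
    case False
    then have "c + g c = P" using col_ge[of c] c by auto
    then show ?thesis by (intro disjI1 D_refl) simp
  qed
qed

lemma dep_above_P:
  assumes col: columns_dependent and j: "j \<in> {P..n}"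
  shows "D (b ` {m<..k}) j"
proof -
  have "{i\<in>{1..k}. P \<le> b i} = {m<..k}" using b_less_P_iff by (auto simp: not_less[symmetric])
  moreover have "1 \<le> P" using a_pos by simp
  ultimately show ?thesis using dep_on_b_from[OF col _ j] by (simp only:)
qed

lemma loop_P:
  assumes col: columns_dependent and "\<not> m < h a"
  shows "D {} P"
proof -
  have "h a = m" using g_le_h[of a] assms(2) by simp
  then have "D {P<..P} P" using col a_in unfolding columns_dependent_def by (metis (no_types))
  then show ?thesis by simp
qed

text \<open>The label \<open>P\<close> does not become a loop when the \<open>b i\<close> with
  \<open>i > m + 1\<close> are contracted. With \<open>columns_dependent\<close> and
  \<open>rows_independent\<close> this is the setting in which row conditions are compared.\<close>

definition first_column_independent :: bool where
  "first_column_independent \<longleftrightarrow> (m < h a \<longrightarrow> \<not> D (b ` {Suc m<..k}) P)"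

lemma Suc_m_in: "m < h a \<Longrightarrow> Suc m \<in> {1..k}"
  using col_height_le[of k n lam a] by simp

lemma exchange_P:
  assumes col: columns_dependent and first: first_column_independent and a: "m < h a"
  shows "D (insert P (b ` {Suc m<..k})) (b (Suc m))"
proof (rule D_exchange)
  have "{m<..k} = insert (Suc m) {Suc m<..k}" using Suc_m_in[OF a] by auto
  then show "D (insert (b (Suc m)) (b ` {Suc m<..k})) P"
    using dep_above_P[OF col, of P] P_le by simp
  show "\<not> D (b ` {Suc m<..k}) P" using first a unfolding first_column_independent_def by simp
  show "b ` {Suc m<..k} \<subseteq> {1..n}" by (intro image_subsetI b_range) simp
  show "P \<in> {1..n}" using P_le a_pos by simp
qed (rule b_range[OF Suc_m_in[OF a]])

text \<open>After contraction of the \<open>b i\<close> with \<open>i > m + 1\<close>, the labels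
  \<open>P\<close> and \<open>b (Suc m)\<close> become parallel, so either may replace the other.
  The right factor relies on this when it keeps \<open>P\<close>.\<close>

lemma dep_P_iff:
  assumes col: columns_dependent and first: first_column_independent and a: "m < h a"
  shows "D (b ` {Suc m<..k} \<union> Y) P \<longleftrightarrow> D (b ` {Suc m<..k} \<union> Y) (b (Suc m))"
proof
  assume *: "D (b ` {Suc m<..k} \<union> Y) P"
  show "D (b ` {Suc m<..k} \<union> Y) (b (Suc m))"
    by (rule D_trans[OF _ exchange_P[OF assms]]) (use * in \<open>auto intro: D_refl\<close>)
next
  assume *: "D (b ` {Suc m<..k} \<union> Y) (b (Suc m))"
  have "{m<..k} = insert (Suc m) {Suc m<..k}" using Suc_m_in[OF a] by auto
  then have "D (insert (b (Suc m)) (b ` {Suc m<..k})) P"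
    using dep_above_P[OF col, of P] P_le by simp
  then show "D (b ` {Suc m<..k} \<union> Y) P"
    by (rule D_trans[rotated]) (use * in \<open>auto intro: D_refl\<close>)
qed

text \<open>The tail is \<open>b\<close> on \<open>{m<..k}\<close>, except that \<open>P\<close> may
  have replaced \<open>b (Suc m)\<close>, and exchange recovers the latter.\<close>

lemma dep_on_right_tail:
  assumes col: columns_dependent and first: first_column_independent and j: "j \<in> {P..n}"
  shows "D ((\<lambda>i. idx_right (a - 1 + i)) ` {m<..k}) j" (is "D ?K j")
proof (rule D_trans[OF _ dep_above_P[OF col j]])
  fix x assume "x \<in> b ` {m<..k}"
  then obtain i where i: "i \<in> {m<..k}" "x = b i" by blast
  show "D ?K x"
  proof (cases "i \<noteq> Suc m \<or> \<not> m < h a")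
    case True
    then have "x = idx_right (a - 1 + i)" using idx_right_b[of i] i by simp
    then show ?thesis using i(1) by (intro D_refl) blast
  next
    case False
    then have x: "x = b (Suc m)" and a: "m < h a" using i by auto
    have "insert P (b ` {Suc m<..k}) \<subseteq> ?K"
    proof (intro insert_subsetI subsetI)
      have "a - 1 + Suc m = P" using a_pos by simp
      then show "P \<in> ?K" using idx_right_P[OF a] Suc_m_in[OF a] by (intro image_eqI[of _ _ "Suc m"]) auto
    next
      fix y assume "y \<in> b ` {Suc m<..k}"
      then obtain i where "i \<in> {Suc m<..k}" "y = b i" by blast
      then show "y \<in> ?K" using idx_right_b[of i] by (intro image_eqI[of _ _ i]) auto
    qed
    then show ?thesis using D_mono[OF exchange_P[OF col first a]] x by simp
  qed
qed

lemma dep_on_gluing_basis: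
  assumes col: columns_dependent and first: first_column_independent and j: "j \<in> {1..n}"
  shows "D (gluing_basis ` {1..k}) j"
proof (rule D_trans[OF _ dep_on_b[OF col j]])
  fix x assume "x \<in> b ` {1..k}"
  then obtain i where i: "i \<in> {1..k}" "x = b i" by blast
  show "D (gluing_basis ` {1..k}) x"
  proof (cases "i \<le> m")
    case True
    then show ?thesis using i by (intro D_refl) (auto simp: gluing_basis_def)
  next
    case False
    then have "x \<in> {P..n}" using b_less_P_iff[of i] i b_range[of i] by auto
    from dep_on_right_tail[OF col first this] show ?thesis
      by (rule D_mono) (auto simp: gluing_basis_def)
  qed
qed

text \<open>Each element is tested against later ones only. For \<open>i \<le> m\<close> those lie
  in the span of the later \<open>b\<close>; for the element \<open>P\<close> the claim is
  \<open>first_column_independent\<close>.\<close>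

lemma gluing_basis_independent:
  assumes col: columns_dependent and row: rows_independent and first: first_column_independent
    and i: "i \<in> {1..k}"
  shows "\<not> D (gluing_basis ` ({1..k} - {i})) (gluing_basis i)"
proof (rule independent_sequence[OF gluing_basis_range _ i])
  fix i assume i: "i \<in> {1..k}"
  have "b ` {i<..k} \<subseteq> b ` ({1..k} - {i})" by (intro image_mono) auto
  then have row': "\<not> D (b ` {i<..k}) (b i)"
    using row i D_mono[of "b ` {i<..k}" "b i" "b ` ({1..k} - {i})"]
    unfolding rows_independent_def by blast
  have tail: "gluing_basis j = b j" if "Suc m < j" for j
    using that idx_right_b[of j] by (simp add: gluing_basis_def)
  show "\<not> D (gluing_basis ` {i<..k}) (gluing_basis i)"
  proof (cases "i \<le> m")
    case True
    show ?thesis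
    proof
      assume "D (gluing_basis ` {i<..k}) (gluing_basis i)"
      then have *: "D (gluing_basis ` {i<..k}) (b i)" using True by (simp add: gluing_basis_def)
      have "D (b ` {i<..k}) (b i)"
      proof (rule D_trans[OF _ *])
        fix x assume "x \<in> gluing_basis ` {i<..k}"
        then obtain j where j: "j \<in> {i<..k}" "x = gluing_basis j" by blast
        show "D (b ` {i<..k}) x"
        proof (cases "j \<le> m")
          case False
          then have "x \<in> {P..n}" using j idx_right_ge_P[of j] by (auto simp: gluing_basis_def)
          moreover have "b ` {m<..k} \<subseteq> b ` {i<..k}" using True by (intro image_mono) auto
          ultimately show ?thesis using D_mono[OF dep_above_P[OF col], of x "b ` {i<..k}"] by blast
        qed (use j in \<open>auto intro: D_refl simp: gluing_basis_def\<close>)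
      qed
      then show False using row' by simp
    qed
  next
    case False
    have tail_image: "gluing_basis ` {i<..k} = b ` {i<..k}"
      using False by (intro image_cong refl tail) auto
    show ?thesis
    proof (cases "i \<noteq> Suc m \<or> \<not> m < h a")
      case True
      then have "gluing_basis i = b i" using False idx_right_b[of i] by (simp add: gluing_basis_def)
      then show ?thesis using row' tail_image by simp
    next
      case c: False
      have "a - 1 + Suc m = P" using a_pos by simp
      then have "gluing_basis i = P" using c idx_right_P by (simp add: gluing_basis_def)
      then show ?thesis using c first tail_image unfolding first_column_independent_def by simp
    qed
  qed
qed

end

section \<open>Row conditions of the whole shape and of the two pieces\<close>

context column_cut
begin

abbreviation "bR \<equiv> b_index k (k + a - 1) (cut_right k n a mu)"
abbreviation "lR \<equiv> b_index k (k + a - 1) (cut_right k n a lam)"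
abbreviation "bL \<equiv> b_index k (n - a + 1) (cut_left k n a mu)"
abbreviation "lL \<equiv> b_index k (n - a + 1) (cut_left k n a lam)"

text \<open>The cap \<open>a - 1 + i\<close> is the label of a row that is empty in the right piece.
  Dually, in \<open>left_rows\<close> the lower bound \<open>i\<close> is the label of a row that
  fills the left piece.\<close>

lemma right_rows:
  assumes "i \<in> {1..k}"
  shows "bR i = min (a - 1 + i) (b i)" "lR i = min (a - 1 + i) (l i)"
  using b_index_cut_right[OF mu a_pos a_le assms] b_index_cut_right[OF lam a_pos a_le assms]
  by (simp_all add: b_index_def min_def)

lemma left_rows: "bL i = max i (b i - (a - 1))" "lL i = max i (l i - (a - 1))"
  unfolding b_index_cut_left[OF a_pos a_le] by (auto simp: b_index_def max_def)

end

context column_cut_dep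
begin

definition row_cond :: "nat \<Rightarrow> bool" where
  "row_cond i \<longleftrightarrow> D ({b i<..n} \<union> {1..l i}) (b i) \<and> \<not> D ({b i<..n} \<union> {1..<l i}) (b i)"

definition row_cond_right :: "nat \<Rightarrow> bool" where
  "row_cond_right i \<longleftrightarrow> D (idx_right ` ({bR i<..k + a - 1} \<union> {1..lR i})) (idx_right (bR i)) \<and>
     \<not> D (idx_right ` ({bR i<..k + a - 1} \<union> {1..<lR i})) (idx_right (bR i))"

definition row_cond_left :: "nat \<Rightarrow> bool" where
  "row_cond_left i \<longleftrightarrow> D (idx_left ` ({bL i<..n - a + 1} \<union> {1..lL i})) (idx_left (bL i)) \<and>
     \<not> D (idx_left ` ({bL i<..n - a + 1} \<union> {1..<lL i})) (idx_left (bL i))"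

text \<open>Otherwise all labels up to \<open>P\<close> would depend on the \<open>b\<close> other
  than \<open>b (Suc m)\<close>. Since \<open>l (Suc m) \<le> P\<close>, the relation of row
  \<open>Suc m\<close> would then contradict the independence of the \<open>b\<close>.\<close>

lemma skew_dep_first_column:
  assumes D: "skew_dep k n lam mu D"
  shows first_column_independent
  unfolding first_column_independent_def
proof (intro impI notI)
  assume a: "m < h a" and HP: "D (b ` {Suc m<..k}) P"
  note col = skew_dep_columns[OF D] and row = skew_dep_rows[OF D] and i = Suc_m_in[OF a]
  have sub: "b ` {Suc m<..k} \<subseteq> b ` ({1..k} - {Suc m})" "b ` {1..m} \<subseteq> b ` ({1..k} - {Suc m})"
    using m_le by (auto intro!: image_mono)
  have below: "D (b ` ({1..k} - {Suc m})) j" if "j \<in> {1..P}" for j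
  proof (rule D_trans[OF _ dep_below_P[OF col that]])
    fix x assume "x \<in> b ` {1..m} \<union> {P}"
    then show "D (b ` ({1..k} - {Suc m})) x"
      using D_mono[OF HP sub(1)] D_refl sub(2) by blast
  qed
  have "D ({b (Suc m)<..n} \<union> {1..l (Suc m)}) (b (Suc m))"
    using D i unfolding skew_dep_def by blast
  then have "D (b ` ({1..k} - {Suc m})) (b (Suc m))"
  proof (rule D_trans[rotated])
    fix j assume "j \<in> {b (Suc m)<..n} \<union> {1..l (Suc m)}"
    then consider "j \<in> {b (Suc m)<..n}" | "j \<in> {1..P}"
      using l_le_P[OF i] a by fastforce
    then show "D (b ` ({1..k} - {Suc m})) j"
    proof cases
      case 1
      show ?thesis by (rule D_mono[OF dep_on_b_above[OF col i 1] sub(1)])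
    qed (rule below)
  qed
  then show False using row i unfolding rows_independent_def by blast
qed

text \<open>In the left piece row \<open>i\<close> has label \<open>i\<close>, sent to
  \<open>i + n\<close>: it is a coloop, since the other columns kept there depend on the other
  \<open>b\<close>. In the right piece labels below \<open>P\<close> are unchanged, and those from
  \<open>P\<close> on are replaced by a spanning subset.\<close>

lemma rows_lower:
  assumes col: columns_dependent and row: rows_independent and first: first_column_independent
    and i: "i \<in> {1..k}" "i \<le> m"
  shows "row_cond_left i" "row_cond_right i \<longleftrightarrow> row_cond i"
proof -
  have bP: "b i < P" and lb: "l i \<le> b i" using b_less_P_iff l_le_b i by auto
  have bL: "bL i = i" "lL i = i" using left_rows[of i] b_le[OF i] lb by auto
  have bR: "bR i = b i" "lR i = l i" using right_rows[OF i(1)] b_le[OF i] lb by auto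
  have "D (idx_left ` ({i<..n - a + 1} \<union> {1..i})) (b i)"
    using i by (intro D_refl image_eqI[of _ _ i]) (auto simp: idx_left_le)
  moreover have "\<not> D (idx_left ` ({i<..n - a + 1} \<union> {1..<i})) (b i)"
  proof
    assume *: "D (idx_left ` ({i<..n - a + 1} \<union> {1..<i})) (b i)"
    have "D (b ` ({1..k} - {i})) (b i)"
    proof (rule D_trans[OF _ *])
      fix x assume "x \<in> idx_left ` ({i<..n - a + 1} \<union> {1..<i})"
      then obtain j where "j \<in> {i<..n - a + 1} \<union> {1..<i}" and x: "x = idx_left j" by blast
      then have j: "j \<in> {1..n - a + 1}" "j \<noteq> i" "x = idx_left j" using i a_le a_pos by auto
      show "D (b ` ({1..k} - {i})) x"
      proof (cases "j \<le> m")
        case True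
        then show ?thesis using j m_le by (intro D_refl) (auto simp: idx_left_le)
      next
        case False
        then have "x \<in> {P..n}" using j a_pos a_le by (auto simp: idx_left_gt)
        moreover have "b ` {m<..k} \<subseteq> b ` ({1..k} - {i})" using i by (intro image_mono) auto
        ultimately show ?thesis using D_mono[OF dep_above_P[OF col]] by blast
      qed
    qed
    then show False using row i unfolding rows_independent_def by blast
  qed
  ultimately show "row_cond_left i"
    unfolding row_cond_left_def bL using i by (simp add: idx_left_le)
  \<comment> \<open>\<open>Y\<close> is the wrapped part of the interval; it ends before
    \<open>P\<close> because \<open>l i \<le> b i < P\<close>.\<close>
  have eq: "D (idx_right ` ({b i<..k + a - 1} \<union> Y)) (b i) \<longleftrightarrow> D ({b i<..n} \<union> Y) (b i)"
    if Y: "Y \<subseteq> {1..<P}" for Y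
  proof (rule D_cong)
    fix x assume "x \<in> idx_right ` ({b i<..k + a - 1} \<union> Y)"
    then obtain j where j: "j \<in> {b i<..k + a - 1} \<union> Y" "x = idx_right j" by blast
    show "D ({b i<..n} \<union> Y) x"
    proof (cases "j < P")
      case True
      then show ?thesis using j P_le by (intro D_refl) (auto simp: idx_right_less)
    next
      case False
      then have "j \<in> {1..k + a - 1}" using j Y by auto
      then obtain i' where "i' \<in> {1..k}" "m < i'" "j = a - 1 + i'"
        using False by (cases rule: right_index_cases) auto
      then have "x \<in> {P..n}" using idx_right_ge_P j by simp
      then show ?thesis using bP by (intro D_refl) auto
    qed
  next
    fix x assume x: "x \<in> {b i<..n} \<union> Y"
    show "D (idx_right ` ({b i<..k + a - 1} \<union> Y)) x"
    proof (cases "x < P")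
      case True
      then have "x = idx_right x" by (simp add: idx_right_less)
      moreover have "x \<in> {b i<..k + a - 1} \<union> Y" using x True m_le by auto
      ultimately show ?thesis by (intro D_refl image_eqI)
    next
      case False
      then have "x \<in> {P..n}" using x Y by auto
      from dep_on_right_tail[OF col first this] show ?thesis
      proof (rule D_mono)
        show "(\<lambda>i. idx_right (a - 1 + i)) ` {m<..k} \<subseteq> idx_right ` ({b i<..k + a - 1} \<union> Y)"
        proof
          fix y assume "y \<in> (\<lambda>i. idx_right (a - 1 + i)) ` {m<..k}"
          then obtain j where "j \<in> {m<..k}" "y = idx_right (a - 1 + j)" by blast
          then show "y \<in> idx_right ` ({b i<..k + a - 1} \<union> Y)"
            using bP a_pos by (intro image_eqI[of _ _ "a - 1 + j"]) auto
        qed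
      qed
    qed
  qed
  have "{1..l i} \<subseteq> {1..<P}" "{1..<l i} \<subseteq> {1..<P}" using lb bP by auto
  then show "row_cond_right i \<longleftrightarrow> row_cond i"
    unfolding row_cond_right_def row_cond_def bR idx_right_less[OF bP] by (simp only: eq)
qed

text \<open>The roles are reversed: \<open>b i\<close> is a coloop of the right piece, by
  independence of the gluing basis. In the left piece the wrapped part of the interval contains
  \<open>P\<close>, so discarding the labels below \<open>P\<close> other than
  \<open>b 1, ..., b m\<close> does not change its closure.\<close>

lemma rows_upper:
  assumes col: columns_dependent and row: rows_independent and first: first_column_independent
    and i: "i \<in> {1..k}" "m < i" "i \<noteq> Suc m \<or> \<not> m < h a"
  shows "row_cond_right i" "row_cond_left i \<longleftrightarrow> row_cond i"
proof -
  have bi: "a + i \<le> b i" using b_ge i by simp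
  have li: "P < l i"
  proof (cases "i = Suc m")
    case True
    then show ?thesis using l_gt_P' i by simp
  next
    case False
    then show ?thesis using l_gt_P i by simp
  qed
  have li': "a - 1 + i \<le> l i"
  proof (cases "i = Suc m")
    case True
    then show ?thesis using li by simp
  next
    case row: False
    show ?thesis
    proof (cases "a = 1")
      case False
      have a1: "1 \<le> a - 1" "a - 1 < a" using False a_pos by linarith+
      then have "a - 1 \<in> {1..n - k}" "\<not> i \<le> h (a - 1)" using i a_in cut[OF a1] row by auto
      then show ?thesis using le_h_iff[of i "a - 1"] i by auto
    qed (simp add: b_index_def)
  qed
  have bR: "bR i = a - 1 + i" "lR i = a - 1 + i" using right_rows[OF i(1)] bi li' by auto
  have bL: "bL i = b i - (a - 1)" "lL i = l i - (a - 1)" using left_rows[of i] bi li' by auto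
  have xR: "idx_right (a - 1 + i) = b i" by (rule idx_right_b[OF i(2,3)])
  have "D (idx_right ` ({a - 1 + i<..k + a - 1} \<union> {1..a - 1 + i})) (b i)"
  proof (intro D_refl image_eqI)
    show "b i = idx_right (a - 1 + i)" by (rule xR[symmetric])
  qed (use i in simp)
  moreover have "\<not> D (idx_right ` ({a - 1 + i<..k + a - 1} \<union> {1..<a - 1 + i})) (b i)"
  proof
    assume *: "D (idx_right ` ({a - 1 + i<..k + a - 1} \<union> {1..<a - 1 + i})) (b i)"
    let ?K = "gluing_basis ` ({1..k} - {i})"
    have tail: "idx_right (a - 1 + i') \<in> ?K" if "i' \<in> {1..k}" "m < i'" "i' \<noteq> i" for i'
      using that by (intro image_eqI[of _ _ i']) (auto simp: gluing_basis_def)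
    \<comment> \<open>\<open>P\<close> is either another member of the gluing basis or a
      loop.\<close>
    have KP: "D ?K P"
    proof (cases "m < h a")
      case True
      have "a - 1 + Suc m = P" using a_pos by simp
      then have "P \<in> ?K" using tail[of "Suc m"] i(3) True Suc_m_in idx_right_P by simp
      then show ?thesis by (rule D_refl)
    next
      case False
      show ?thesis by (rule D_mono[OF loop_P[OF col False]]) simp
    qed
    have "D ?K (b i)"
    proof (rule D_trans[OF _ *])
      fix x assume "x \<in> idx_right ` ({a - 1 + i<..k + a - 1} \<union> {1..<a - 1 + i})"
      then obtain j where "j \<in> {a - 1 + i<..k + a - 1} \<union> {1..<a - 1 + i}" and x: "x = idx_right j"
        by blast
      then have j: "j \<in> {1..k + a - 1}" "j \<noteq> a - 1 + i" "x = idx_right j" using i by auto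
      from j(1) show "D ?K x"
      proof (cases rule: right_index_cases)
        case 1
        then have "x \<in> {1..P}" using j by (simp add: idx_right_less)
        from dep_below_P[OF col this] show ?thesis
        proof (rule D_trans[rotated])
          fix y assume "y \<in> b ` {1..m} \<union> {P}"
          moreover have "b ` {1..m} \<subseteq> ?K"
          proof
            fix y assume "y \<in> b ` {1..m}"
            then obtain i' where "i' \<in> {1..m}" "y = b i'" by blast
            then show "y \<in> ?K" using i m_le by (intro image_eqI[of _ _ i']) (auto simp: gluing_basis_def)
          qed
          ultimately show "D ?K y" using KP D_refl by blast
        qed
      next
        case (2 i')
        then show ?thesis using tail[of i'] j by (intro D_refl) auto
      qed
    qed
    moreover have "gluing_basis i = b i" using i xR by (simp add: gluing_basis_def)
    ultimately show False using gluing_basis_independent[OF col row first i(1)] by simp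
  qed
  ultimately show "row_cond_right i" unfolding row_cond_right_def bR xR by blast
  have xL: "idx_left (b i - (a - 1)) = b i" using bi i idx_left_gt[of "b i - (a - 1)"] by simp
  \<comment> \<open>Applied to \<open>u = l i\<close> and \<open>u = l i - 1\<close>; both are at
    least \<open>P\<close> because \<open>P < l i\<close>.\<close>
  have eq: "D (idx_left ` ({b i - (a - 1)<..n - a + 1} \<union> {1..u - (a - 1)})) (b i) \<longleftrightarrow>
      D ({b i<..n} \<union> {1..u}) (b i)" if u: "P \<le> u" "u \<le> n" for u
  proof (rule D_cong)
    fix x assume "x \<in> idx_left ` ({b i - (a - 1)<..n - a + 1} \<union> {1..u - (a - 1)})"
    then obtain j where j: "j \<in> {b i - (a - 1)<..n - a + 1} \<or> j \<in> {1..u - (a - 1)}" "x = idx_left j" by blast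
    show "D ({b i<..n} \<union> {1..u}) x"
    proof (cases "j \<le> m")
      case True
      then have "j \<in> {1..k}" using j m_le bi i by auto
      then have "x \<in> {1..u}" using b_less_P_iff[of j] b_range[of j] True u j by (auto simp: idx_left_le)
      then show ?thesis by (intro D_refl) simp
    next
      case False
      then have "x = j + (a - 1)" using j by (simp add: idx_left_gt)
      then have "x \<in> {b i<..n} \<union> {1..u}" using j(1) False a_pos a_le bi by auto
      then show ?thesis by (rule D_refl)
    qed
  next
    let ?S = "{b i - (a - 1)<..n - a + 1} \<union> {1..u - (a - 1)}"
    fix x assume x: "x \<in> {b i<..n} \<union> {1..u}"
    have large: "x \<in> idx_left ` ?S" if "P \<le> x" "x \<in> {b i<..n} \<union> {1..u}" for x
    proof (rule image_eqI[of _ _ "x - (a - 1)"])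
      show "x = idx_left (x - (a - 1))" using that idx_left_gt[of "x - (a - 1)"] a_pos by simp
      show "x - (a - 1) \<in> ?S" using that a_pos bi by auto
    qed
    show "D (idx_left ` ?S) x"
    proof (cases "P < x")
      case True
      then show ?thesis using large x by (intro D_refl) simp
    next
      case False
      then have "x \<in> {1..P}" using x bi i by auto
      from dep_below_P[OF col this] show ?thesis
      proof (rule D_trans[rotated])
        fix y assume "y \<in> b ` {1..m} \<union> {P}"
        then have "y \<in> idx_left ` ?S"
        proof
          assume "y \<in> b ` {1..m}"
          then obtain i' where "i' \<in> {1..m}" "y = b i'" by blast
          then show ?thesis using u a_pos by (intro image_eqI[of _ _ i']) (auto simp: idx_left_le)
        qed (use large[of P] u a_pos in auto)
        then show "D (idx_left ` ?S) y" by (rule D_refl)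
      qed
    qed
  qed
  have ln: "l i \<le> n" using l_le_b[OF i(1)] b_range[OF i(1)] by simp
  have "{1..<l i} = {1..l i - 1}" "{1..<l i - (a - 1)} = {1..l i - 1 - (a - 1)}" by auto
  then show "row_cond_left i \<longleftrightarrow> row_cond i"
    unfolding row_cond_left_def row_cond_def bL xL using eq[of "l i"] eq[of "l i - 1"] li ln by simp
qed

text \<open>This row crosses the cut. In the left piece its relation closes exactly on reaching
  position \<open>m + 1\<close>, which is \<open>P\<close>: exchange shows that \<open>P\<close>
  suffices, and without it independence of the \<open>b\<close> is violated. In the right piece
  \<open>P\<close> stands in for \<open>b (Suc m)\<close>, as \<open>dep_P_iff\<close>
  permits.\<close>

lemma rows_middle:
  assumes col: columns_dependent and row: rows_independent and first: first_column_independent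
    and i: "i = Suc m" and a: "m < h a"
  shows "row_cond_left i" "row_cond_right i \<longleftrightarrow> row_cond i"
proof -
  have ik: "i \<in> {1..k}" using Suc_m_in[OF a] i by simp
  have bi: "a + i \<le> b i" using b_ge[OF ik] i by simp
  have li: "l i \<le> P" using l_le_P[OF ik] i a by simp
  have ii: "a - 1 + i = P" using i a_pos by simp
  have bR: "bR i = P" "lR i = l i" using right_rows[OF ik] bi li ii by auto
  have bL: "bL i = b i - (a - 1)" "lL i = i" using left_rows[of i] bi li ii by auto
  have above: "{b i<..n} \<subseteq> idx_left ` {b i - (a - 1)<..n - a + 1}"
  proof
    fix x assume "x \<in> {b i<..n}"
    then show "x \<in> idx_left ` {b i - (a - 1)<..n - a + 1}"
      using bi i a_pos idx_left_gt[of "x - (a - 1)"] by (intro image_eqI[of _ _ "x - (a - 1)"]) auto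
  qed
  have bsub: "b ` {i<..k} \<subseteq> {b i<..n}"
  proof
    fix x assume "x \<in> b ` {i<..k}"
    then obtain j where "j \<in> {1..k}" "i < j" "x = b j" by auto
    then show "x \<in> {b i<..n}" using b_mono[OF ik] b_range[of j] by auto
  qed
  have xL: "idx_left (b i - (a - 1)) = b i" using bi i idx_left_gt[of "b i - (a - 1)"] by simp
  have "D (idx_left ` ({b i - (a - 1)<..n - a + 1} \<union> {1..i})) (b i)"
  proof -
    have "D (insert P (b ` {i<..k})) (b i)" using exchange_P[OF col first a] i by simp
    moreover have "P \<in> idx_left ` {1..i}" using i a_pos idx_left_gt[of i] by (intro image_eqI[of _ _ i]) auto
    then have "insert P (b ` {i<..k}) \<subseteq> idx_left ` ({b i - (a - 1)<..n - a + 1} \<union> {1..i})"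
      using above bsub by blast
    ultimately show ?thesis by (rule D_mono)
  qed
  moreover have "\<not> D (idx_left ` ({b i - (a - 1)<..n - a + 1} \<union> {1..<i})) (b i)"
  proof
    assume *: "D (idx_left ` ({b i - (a - 1)<..n - a + 1} \<union> {1..<i})) (b i)"
    have "D (b ` ({1..k} - {i})) (b i)"
    proof (rule D_trans[OF _ *])
      fix x assume "x \<in> idx_left ` ({b i - (a - 1)<..n - a + 1} \<union> {1..<i})"
      then consider j where "j \<in> {b i - (a - 1)<..n - a + 1}" "x = idx_left j" | j where "j \<in> {1..<i}" "x = idx_left j"
        by blast
      then show "D (b ` ({1..k} - {i})) x"
      proof cases
        case (1 j)
        then have "x \<in> {b i<..n}" using bi i a_pos a_le idx_left_gt[of j] by auto
        moreover have "b ` {i<..k} \<subseteq> b ` ({1..k} - {i})" by (intro image_mono) auto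
        ultimately show ?thesis using D_mono[OF dep_on_b_above[OF col ik]] by blast
      next
        case (2 j)
        then show ?thesis using i m_le by (intro D_refl) (auto simp: idx_left_le)
      qed
    qed
    then show False using row ik unfolding rows_independent_def by blast
  qed
  ultimately show "row_cond_left i"
    unfolding row_cond_left_def bL xL by blast
  have right: "idx_right ` ({P<..k + a - 1} \<union> Y) = b ` {Suc m<..k} \<union> Y" if "Y \<subseteq> {1..P}" for Y
  proof -
    have "idx_right x = x" if "x \<in> Y" for x
      using \<open>Y \<subseteq> {1..P}\<close> that idx_right_less[of x] idx_right_P[OF a] by (cases "x = P") auto
    then have Y: "idx_right ` Y = Y" by simp
    have "{P<..k + a - 1} = (\<lambda>j. a - 1 + j) ` {Suc m<..k}"
    proof (intro equalityI subsetI)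
      fix x assume "x \<in> {P<..k + a - 1}"
      then show "x \<in> (\<lambda>j. a - 1 + j) ` {Suc m<..k}"
        using a_pos by (intro image_eqI[of _ _ "x - (a - 1)"]) auto
    qed (use a_pos in auto)
    then have "idx_right ` {P<..k + a - 1} = b ` {Suc m<..k}"
      by (simp only: image_image) (intro image_cong refl idx_right_b, auto)
    then show ?thesis using Y by (simp only: image_Un)
  qed
  have "D (b ` {Suc m<..k} \<union> Y) P \<longleftrightarrow> D ({b i<..n} \<union> Y) (b i)" for Y
  proof -
    have "D (b ` {Suc m<..k} \<union> Y) P \<longleftrightarrow> D (b ` {i<..k} \<union> Y) (b i)"
      using dep_P_iff[OF col first a] i by simp
    also have "\<dots> \<longleftrightarrow> D ({b i<..n} \<union> Y) (b i)"
    proof (rule D_cong)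
      fix x assume "x \<in> b ` {i<..k} \<union> Y"
      then show "D ({b i<..n} \<union> Y) x" using bsub by (intro D_refl) blast
    next
      fix x assume "x \<in> {b i<..n} \<union> Y"
      then show "D (b ` {i<..k} \<union> Y) x"
      proof
        assume "x \<in> {b i<..n}"
        from dep_on_b_above[OF col ik this] show ?thesis by (rule D_mono) simp
      qed (auto intro: D_refl)
    qed
    finally show ?thesis .
  qed
  moreover have "{1..l i} \<subseteq> {1..P}" "{1..<l i} \<subseteq> {1..P}" using li by auto
  ultimately show "row_cond_right i \<longleftrightarrow> row_cond i"
    unfolding row_cond_right_def row_cond_def bR idx_right_P[OF a] by (simp only: right)
qed

text \<open>Rows up to \<open>m\<close>, and row \<open>m + 1\<close> if the skew shape meets column
  \<open>a\<close>, are decided by the right piece; all others are decided by the left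
  piece.\<close>

lemma row_cond_iff:
  assumes col: columns_dependent and row: rows_independent and first: first_column_independent
    and i: "i \<in> {1..k}"
  shows "row_cond i \<longleftrightarrow> row_cond_right i \<and> row_cond_left i"
proof -
  consider "i \<le> m" | "m < i" "i \<noteq> Suc m \<or> \<not> m < h a" | "i = Suc m" "m < h a" by linarith
  then show ?thesis
  proof cases
    case 1
    then show ?thesis using rows_lower[OF col row first i 1] by blast
  next
    case 2
    then show ?thesis using rows_upper[OF col row first i 2] by blast
  next
    case 3
    then show ?thesis using rows_middle[OF col row first 3] by blast
  qed
qed

end

section \<open>The pieces as skew shapes, and the sets defining the open subset\<close>

context column_cut
begin

lemma shape_right:
  "skew_shape k (k + a - 1) (cut_right k n a lam) (cut_right k n a mu)"
proof
  show "partition_in_box k (k + a - 1 - k) (cut_right k n a lam)"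
    "partition_in_box k (k + a - 1 - k) (cut_right k n a mu)"
    using partition_cut_right[OF lam a_pos a_le] partition_cut_right[OF mu a_pos a_le] .
qed (use k_pos a_pos mu_le_lam in \<open>auto simp: cut_right_def intro: diff_le_mono\<close>)

lemma col_heights_left:
  assumes "c \<in> {1..n - a + 1 - k}"
  shows "col_height k (n - a + 1) (cut_left k n a nu) c = col_height k n nu (c + (a - 1))"
  by (rule col_height_cut_left[OF a_pos a_le assms])

lemma left_one: "1 \<in> {1..n - a + 1 - k}"
  using a_le a_pos by auto

lemma m_left: "col_height k (n - a + 1) (cut_left k n a mu) 1 = m"
  and h_left: "col_height k (n - a + 1) (cut_left k n a lam) 1 = h a"
  using col_heights_left[OF left_one] a_pos by simp_all

text \<open>The left piece is regarded as cut at its own first column, which is column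
  \<open>a\<close> of the whole shape; there \<open>cut\<close> is vacuous. This makes
  \<open>first_column_independent\<close> and \<open>gluing_basis\<close> available for it.\<close>

lemma cut_left_shape:
  "column_cut k (n - a + 1) (cut_left k n a lam) (cut_left k n a mu) 1"
proof
  show "partition_in_box k (n - a + 1 - k) (cut_left k n a lam)"
    "partition_in_box k (n - a + 1 - k) (cut_left k n a mu)"
    using partition_cut_left[OF lam a_pos a_le] partition_cut_left[OF mu a_pos a_le] .
  show "\<forall>i\<in>{1..k}. cut_left k n a mu i \<le> cut_left k n a lam i"
    using mu_le_lam by (auto simp: cut_left_def intro: min.mono)
qed (use k_pos left_one a_le in auto)

lemma idx_left_bL: "i \<in> {1..k} \<Longrightarrow> idx_left (bL i) = b i"
  using left_rows(1)[of i] b_le[of i] b_ge[of i] idx_left_le[of i] idx_left_gt[of "b i - (a - 1)"]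
  by (cases "i \<le> m") auto

lemma I_prime_eq:
  assumes i: "i \<in> {1..k}"
  shows "I_prime k n mu a i = (\<lambda>j. if j \<le> i then min (a + j - 1) (b j) else b j) ` {1..k}"
proof -
  have "{1..k} = {1..i} \<union> {i + 1..k}" using i by auto
  moreover have "(\<lambda>j. if j \<le> i then min (a + j - 1) (b j) else b j) ` {1..i} =
      (\<lambda>j. min (a + j - 1) (b j)) ` {1..i}" by (intro image_cong) auto
  moreover have "(\<lambda>j. if j \<le> i then min (a + j - 1) (b j) else b j) ` {i + 1..k} = b ` {i + 1..k}"
    by (intro image_cong) auto
  ultimately show ?thesis unfolding I_prime_def by (simp only: image_Un)
qed

lemma I_prime_card:
  assumes i: "i \<in> {1..k}"
  shows "card (I_prime k n mu a i) = k"
proof -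
  let ?e = "\<lambda>j. if j \<le> i then min (a + j - 1) (b j) else b j"
  have lt: "?e j < ?e j'" if "j \<in> {1..k}" "j' \<in> {1..k}" "j < j'" for j j'
    using b_mono[OF that] that a_pos by auto
  have "inj_on ?e {1..k}"
  proof (rule linorder_inj_onI')
    fix j j' assume "j \<in> {1..k}" "j' \<in> {1..k}" "j < j'"
    from lt[OF this] show "?e j \<noteq> ?e j'" by (rule less_imp_neq)
  qed
  from card_image[OF this] show ?thesis unfolding I_prime_eq[OF i] by simp
qed

lemma I_prime_subset:
  assumes i: "i \<in> {1..k}"
  shows "I_prime k n mu a i \<subseteq> {1..n}"
  unfolding I_prime_eq[OF i] using b_range a_pos by fastforce

text \<open>The minimum in \<open>I_prime\<close> switches from \<open>b j\<close> to
  \<open>a + j - 1\<close> at \<open>j = m + 1\<close>, where it equals \<open>P\<close>: this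
  compares \<open>b j\<close> with \<open>a + j\<close> by means of the height of column
  \<open>a\<close>.\<close>

lemma I_prime_members:
  assumes i: "i \<in> {1..k}" "m < i"
  shows "b ` {1..m} \<subseteq> I_prime k n mu a i" "{P..a + i - 1} \<subseteq> I_prime k n mu a i"
    "b ` {i<..k} \<subseteq> I_prime k n mu a i"
proof -
  have "b j \<in> I_prime k n mu a i" if "j \<in> {1..m}" for j
  proof -
    have "j \<in> {1..k}" "j \<le> m" using that m_le by auto
    then have "min (a + j - 1) (b j) = b j" using b_le[of j] by auto
    then show ?thesis unfolding I_prime_def using that i
      by (intro UnI1 image_eqI[of _ _ j]) auto
  qed
  then show "b ` {1..m} \<subseteq> I_prime k n mu a i" by blast
  show "{P..a + i - 1} \<subseteq> I_prime k n mu a i"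
  proof
    fix x assume x: "x \<in> {P..a + i - 1}"
    define j where "j = x - (a - 1)"
    have j: "m < j" "j \<le> i" "x = a + j - 1" "j \<in> {1..k}" using x a_pos i by (auto simp: j_def)
    then have "min (a + j - 1) (b j) = x" using b_ge[of j] by auto
    then show "x \<in> I_prime k n mu a i" unfolding I_prime_def using j
      by (intro UnI1 image_eqI[of _ _ j]) auto
  qed
  have "{i<..k} = {i + 1..k}" by auto
  then show "b ` {i<..k} \<subseteq> I_prime k n mu a i" unfolding I_prime_def by auto
qed

end

section \<open>Distribution of the conditions over the two pieces\<close>

context column_cut_dep
begin

definition col_cond :: "nat \<Rightarrow> bool" where
  "col_cond c \<longleftrightarrow> D {c + g c<..c + h c} (c + g c) \<and>
     (g c < h c \<longrightarrow> \<not> D {c + g c<..<c + h c} (c + g c))"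

lemma skew_dep_iff:
  "skew_dep k n lam mu D \<longleftrightarrow> (\<forall>c\<in>{1..n - k}. col_cond c) \<and> (\<forall>i\<in>{1..k}. row_cond i)"
  unfolding skew_dep_def col_cond_def row_cond_def ..

text \<open>Columns right of \<open>a\<close> only involve labels that \<open>idx_right\<close>
  fixes, so their conditions carry over verbatim.\<close>

lemma skew_dep_right_iff:
  "skew_dep k (k + a - 1) (cut_right k n a lam) (cut_right k n a mu) (\<lambda>J e. D (idx_right ` J) (idx_right e))
    \<longleftrightarrow> (\<forall>c\<in>{1..<a}. col_cond c) \<and> (\<forall>i\<in>{1..k}. row_cond_right i)"
  unfolding skew_dep_def row_cond_right_def
proof (intro arg_cong2[of _ _ _ _ "(\<and>)"] ball_cong refl)
  show "{1..k + a - 1 - k} = {1..<a}" using a_pos by auto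
  fix c assume c: "c \<in> {1..<a}"
  then have "c \<in> {1..a - 1}" by auto
  note heights = col_height_cut_right[OF a_le this]
  \<comment> \<open>The label \<open>P\<close> is involved only if a relation ends there, and in
    that case it is kept.\<close>
  have id: "idx_right x = x" if "x \<le> c + h c" for x
  proof (cases "x < P")
    case False
    then have "x = P" "c + h c = P" using that col_less_end[OF c] by auto
    then show ?thesis using col_less_end'[OF c] idx_right_P by simp
  qed (simp add: idx_right_less)
  have S: "idx_right ` S = S" if "S \<subseteq> {..c + h c}" for S
    using that id by (auto simp: image_iff subset_iff)
  have S1: "idx_right ` {c + g c<..c + h c} = {c + g c<..c + h c}" by (rule S) auto
  have S2: "idx_right ` {c + g c<..<c + h c} = {c + g c<..<c + h c}" by (rule S) auto
  have "idx_right (c + g c) = c + g c" using g_le_h[of c] by (intro id) simp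
  then show "(D (idx_right ` {c + col_height k (k + a - 1) (cut_right k n a mu) c<..
        c + col_height k (k + a - 1) (cut_right k n a lam) c})
        (idx_right (c + col_height k (k + a - 1) (cut_right k n a mu) c)) \<and>
      (col_height k (k + a - 1) (cut_right k n a mu) c < col_height k (k + a - 1) (cut_right k n a lam) c \<longrightarrow>
        \<not> D (idx_right ` {c + col_height k (k + a - 1) (cut_right k n a mu) c<..<
          c + col_height k (k + a - 1) (cut_right k n a lam) c})
          (idx_right (c + col_height k (k + a - 1) (cut_right k n a mu) c)))) = col_cond c"
    unfolding heights col_cond_def by (simp only: S1 S2)
qed

text \<open>From column \<open>a\<close> on, every label involved exceeds \<open>m\<close> in the
  numbering of the left piece, and there \<open>idx_left\<close> is a shift by
  \<open>a - 1\<close>.\<close>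

lemma skew_dep_left_iff:
  "skew_dep k (n - a + 1) (cut_left k n a lam) (cut_left k n a mu) (\<lambda>J e. D (idx_left ` J) (idx_left e))
    \<longleftrightarrow> (\<forall>c\<in>{a..n - k}. col_cond c) \<and> (\<forall>i\<in>{1..k}. row_cond_left i)"
  unfolding skew_dep_def row_cond_left_def
proof (intro arg_cong2[of _ _ _ _ "(\<and>)"] refl)
  let ?gL = "col_height k (n - a + 1) (cut_left k n a mu)" and ?hL = "col_height k (n - a + 1) (cut_left k n a lam)"
  have shift: "{a..n - k} = (\<lambda>c. c + (a - 1)) ` {1..n - a + 1 - k}"
  proof (intro equalityI subsetI)
    fix x assume "x \<in> {a..n - k}"
    then show "x \<in> (\<lambda>c. c + (a - 1)) ` {1..n - a + 1 - k}"
      using a_pos by (intro image_eqI[of _ _ "x - (a - 1)"]) auto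
  qed (use a_pos a_le in auto)
  have "(D (idx_left ` {c + ?gL c<..c + ?hL c}) (idx_left (c + ?gL c)) \<and>
      (?gL c < ?hL c \<longrightarrow> \<not> D (idx_left ` {c + ?gL c<..<c + ?hL c}) (idx_left (c + ?gL c)))) =
      col_cond (c + (a - 1))" if c: "c \<in> {1..n - a + 1 - k}" for c
  proof -
    let ?c = "c + (a - 1)"
    have "a \<le> ?c" using c by auto
    from col_height_mono[OF this, of k n mu] have m: "m < c + g ?c" using c by auto
    have left: "idx_left ` {u<..v} = {u + (a - 1)<..v + (a - 1)}"
      "idx_left ` {u<..<v} = {u + (a - 1)<..<v + (a - 1)}" if "m < u" for u v
    proof -
      have idx: "idx_left x = x + (a - 1)" if "u < x" for x
        using that \<open>m < u\<close> by (intro idx_left_gt) simp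
      show "idx_left ` {u<..v} = {u + (a - 1)<..v + (a - 1)}"
      proof (intro equalityI subsetI)
        fix x assume "x \<in> {u + (a - 1)<..v + (a - 1)}"
        then show "x \<in> idx_left ` {u<..v}"
          using idx[of "x - (a - 1)"] by (intro image_eqI[of _ _ "x - (a - 1)"]) auto
      qed (auto simp: idx)
      show "idx_left ` {u<..<v} = {u + (a - 1)<..<v + (a - 1)}"
      proof (intro equalityI subsetI)
        fix x assume "x \<in> {u + (a - 1)<..<v + (a - 1)}"
        then show "x \<in> idx_left ` {u<..<v}"
          using idx[of "x - (a - 1)"] by (intro image_eqI[of _ _ "x - (a - 1)"]) auto
      qed (auto simp: idx)
    qed
    have assoc: "c + x + (a - 1) = ?c + x" for x by simp
    show ?thesis
      unfolding col_heights_left[OF c] col_cond_def left[OF m] idx_left_gt[OF m] assoc ..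
  qed
  then show "(\<forall>c\<in>{1..n - a + 1 - k}. D (idx_left ` {c + ?gL c<..c + ?hL c}) (idx_left (c + ?gL c)) \<and>
      (?gL c < ?hL c \<longrightarrow> \<not> D (idx_left ` {c + ?gL c<..<c + ?hL c}) (idx_left (c + ?gL c)))) =
      (\<forall>c\<in>{a..n - k}. col_cond c)"
    unfolding shift ball_simps by (intro ball_cong refl)
qed

lemma left_dep:
  "column_cut_dep k (n - a + 1) (cut_left k n a lam) (cut_left k n a mu) 1 (\<lambda>J e. D (idx_left ` J) (idx_left e))"
  by (intro column_cut_dep.intro skew_shape_dep.intro cut_left_shape dependence_pull idx_left_range
      column_cut.axioms(1)[OF cut_left_shape])

text \<open>Column conditions are divided between the pieces, and \<open>row_cond_iff\<close>
  matches the row conditions once its three premises are known. Coming from the pieces, the column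
  relations are supplied by both, and the two independence statements by the left one, which keeps
  \<open>P\<close> and all \<open>b i\<close>.\<close>

lemma skew_dep_cut:
  "skew_dep k n lam mu D \<longleftrightarrow>
    skew_dep k (k + a - 1) (cut_right k n a lam) (cut_right k n a mu) (\<lambda>J e. D (idx_right ` J) (idx_right e)) \<and>
    skew_dep k (n - a + 1) (cut_left k n a lam) (cut_left k n a mu) (\<lambda>J e. D (idx_left ` J) (idx_left e))"
    (is "_ \<longleftrightarrow> ?R \<and> ?L")
proof -
  have split: "{1..n - k} = {1..<a} \<union> {a..n - k}" using a_pos a_le by auto
  have *: "skew_dep k n lam mu D \<longleftrightarrow> ?R \<and> ?L"
    if col: columns_dependent and row: rows_independent and first: first_column_independent
    unfolding skew_dep_iff skew_dep_right_iff skew_dep_left_iff split ball_Un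
    using row_cond_iff[OF col row first] by blast
  show ?thesis
  proof
    assume D: "skew_dep k n lam mu D"
    then show "?R \<and> ?L"
      using *[OF skew_dep_columns[OF D] skew_dep_rows[OF D] skew_dep_first_column[OF D]] by simp
  next
    assume RL: "?R \<and> ?L"
    have col: columns_dependent
      using RL unfolding skew_dep_right_iff skew_dep_left_iff columns_dependent_def split ball_Un col_cond_def
      by blast
    interpret L: column_cut_dep k "n - a + 1" "cut_left k n a lam" "cut_left k n a mu" 1
      "\<lambda>J e. D (idx_left ` J) (idx_left e)" by (rule left_dep)
    have image: "idx_left ` bL ` S = b ` S" if "S \<subseteq> {1..k}" for S
      using that idx_left_bL by (auto simp: image_image intro!: image_cong)
    have row: rows_independent
      unfolding rows_independent_def
    proof
      fix i assume i: "i \<in> {1..k}"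
      then have "\<not> D (idx_left ` bL ` ({1..k} - {i})) (idx_left (bL i))"
        using L.skew_dep_rows RL unfolding L.rows_independent_def by blast
      then show "\<not> D (b ` ({1..k} - {i})) (b i)"
        using image[of "{1..k} - {i}"] idx_left_bL[OF i] by simp
    qed
    have "idx_left ` bL ` {Suc m<..k} = b ` {Suc m<..k}" by (rule image) auto
    moreover have "idx_left (1 + m) = P" using idx_left_gt[of "1 + m"] a_pos by simp
    ultimately have first: first_column_independent
      using L.skew_dep_first_column[OF conjunct2[OF RL]]
      unfolding L.first_column_independent_def first_column_independent_def m_left h_left
      by (simp only:)
    show "skew_dep k n lam mu D" using *[OF col row first] RL by simp
  qed
qed

text \<open>The set contains \<open>b 1, ..., b m\<close> and \<open>P\<close>, so it spans the
  labels up to \<open>P\<close>, and it contains those from \<open>P\<close> to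
  \<open>a + i - 1\<close>. For \<open>m < t \<le> i\<close>, descending induction applies the
  relation of row \<open>t\<close>, whose wrapped part ends at \<open>l t < a + t\<close>.\<close>

lemma dep_on_I_prime:
  assumes D: "skew_dep k n lam mu D" and i: "m < i" "i \<le> h a" and j: "j \<in> {1..n}"
  shows "D (I_prime k n mu a i) j"
proof -
  note col = skew_dep_columns[OF D]
  have ik: "i \<in> {1..k}" using i col_height_le[of k n lam a] by simp
  let ?K = "I_prime k n mu a i"
  note members = I_prime_members[OF ik i(1)]
  have P: "P \<in> ?K" using members(2) i a_pos by auto
  have low: "D ?K x" if "x \<in> {1..a + i - 1}" for x
  proof (cases "x \<le> P")
    case True
    then have "x \<in> {1..P}" using that by simp
    from dep_below_P[OF col this] show ?thesis by (rule D_mono) (use members(1) P in blast)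
  next
    case False
    then show ?thesis using that members(2) by (intro D_refl) auto
  qed
  have "D ?K (b t)" if "t \<in> {1..k}" for t
    using that
  proof (induction "k - t" arbitrary: t rule: less_induct)
    case less
    consider "t \<le> m" | "i < t" | "m < t" "t \<le> i" by linarith
    then show ?case
    proof cases
      case 1
      then show ?thesis using members(1) less(2) by (intro D_refl) auto
    next
      case 2
      then show ?thesis using members(3) less(2) by (intro D_refl) auto
    next
      case 3
      have "D ({b t<..n} \<union> {1..l t}) (b t)" using D less(2) unfolding skew_dep_def by blast
      then show ?thesis
      proof (rule D_trans[rotated])
        fix x assume "x \<in> {b t<..n} \<union> {1..l t}"
        then show "D ?K x"
        proof
          assume "x \<in> {b t<..n}"
          from dep_on_b_above[OF col less(2) this] show ?thesis
          proof (rule D_trans[rotated])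
            fix y assume "y \<in> b ` {t<..k}"
            then obtain t' where "t' \<in> {t<..k}" "y = b t'" by blast
            then show "D ?K y" using less(1)[of t'] less(2) by auto
          qed
        next
          assume x: "x \<in> {1..l t}"
          have "l t < a + t" using l_le_P[OF less(2)] 3 i by simp
          then have "x \<in> {1..a + i - 1}" using x 3 by auto
          then show ?thesis by (rule low)
        qed
      qed
    qed
  qed
  then show ?thesis by (intro D_trans[OF _ dep_on_b[OF col j]]) auto
qed

end

section \<open>Gluing\<close>

text \<open>An inverse up to a nonzero scalar is enough, so that \<open>G\<close> can be an
  adjugate.\<close>

lemma represents_mult:
  assumes A: "represents k n A V" and G: "G \<in> carrier_mat k k" and H: "H \<in> carrier_mat k k"
    and GH: "G * H = c \<cdot>\<^sub>m 1\<^sub>m k" "c \<noteq> 0"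
  shows "represents k n (G * A) V"
proof -
  define K where "K = (1 / c) \<cdot>\<^sub>m H"
  have K: "K \<in> carrier_mat k k" using H by (simp add: K_def)
  have GK: "G * K = 1\<^sub>m k"
    using GH G H by (intro eq_matI) (auto simp: K_def mult_smult_distrib[of _ k k])
  have KG: "K * G = 1\<^sub>m k" by (rule mat_mult_left_right_inverse[OF G K GK])
  have Ac: "A \<in> carrier_mat k n" using A by (simp add: represents_iff)
  have inv: "invertible_mat G"
    unfolding invertible_mat_def inverts_mat_def using G K GK KG by auto
  have "vec_space.row_space n (G * A) = V"
    using vec_space.row_space_is_preserved[OF inv G Ac] A by (simp add: represents_def)
  moreover have "y = 0\<^sub>v k" if y: "y \<in> carrier_vec k" and 0: "\<forall>j<n. y \<bullet> col (G * A) j = 0" for y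
  proof -
    have GTy: "G\<^sup>T *\<^sub>v y \<in> carrier_vec k" using G y by simp
    have "(G\<^sup>T *\<^sub>v y) \<bullet> col A j = 0" if j: "j < n" for j
    proof -
      have a: "col A j \<in> carrier_vec k" using Ac j by auto
      have "(G\<^sup>T *\<^sub>v y) \<bullet> col A j = y \<bullet> (G *\<^sub>v col A j)"
        using G a y by (simp add: transpose_vec_mult_scalar[of _ k k])
      also have "\<dots> = y \<bullet> col (G * A) j" by (simp only: col_mult2[OF G Ac j])
      finally show ?thesis using 0 j by simp
    qed
    then have "G\<^sup>T *\<^sub>v y = 0\<^sub>v k" using A GTy by (auto simp: represents_iff)
    moreover have "K\<^sup>T *\<^sub>v 0\<^sub>v k = 0\<^sub>v k" using K by (intro eq_vecI) auto
    ultimately have "K\<^sup>T *\<^sub>v (G\<^sup>T *\<^sub>v y) = 0\<^sub>v k" by simp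
    then have "(K\<^sup>T * G\<^sup>T) *\<^sub>v y = 0\<^sub>v k" using G K y by simp
    moreover have "K\<^sup>T * G\<^sup>T = 1\<^sub>m k" using transpose_mult[OF G K] GK by simp
    ultimately show ?thesis using y by simp
  qed
  moreover have "G * A \<in> carrier_mat k n" using G Ac by simp
  ultimately show ?thesis
    unfolding represents_def using rank_eq_iff_inj[of "G * A" k n] by auto
qed

lemma represents_functional: "represents k n A V \<Longrightarrow> represents k n A W \<Longrightarrow> V = W"
  by (simp add: represents_def)

lemma represents_smult:
  assumes A: "represents k n A V" and c: "c \<noteq> 0"
  shows "represents k n (c \<cdot>\<^sub>m A) V"
proof -
  have Ac: "A \<in> carrier_mat k n" using A by (simp add: represents_iff)
  have "represents k n ((c \<cdot>\<^sub>m 1\<^sub>m k) * A) V"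
    by (rule represents_mult[OF A, of _ "1\<^sub>m k" c]) (use c in auto)
  then show ?thesis using Ac by (simp add: mult_smult_assoc_mat[of _ k k])
qed

text \<open>By Cramer's rule these are, up to a common factor, the entries of the matrix with the same
  row space whose columns \<open>t\<close> form the identity matrix.\<close>

definition normal_entry :: "nat \<Rightarrow> complex mat \<Rightarrow> (nat \<Rightarrow> nat) \<Rightarrow> nat \<Rightarrow> nat \<Rightarrow> complex" where
  "normal_entry k A t i j = tuple_minor k A (t(i := j))"

lemma normal_entry_basis:
  assumes "i < k" "i' < k"
  shows "normal_entry k A t i (t i') = (if i = i' then tuple_minor k A t else 0)"
proof (cases "i = i'")
  case False
  have "tuple_minor k A (t(i := t i')) = 0"
    unfolding tuple_minor_def
    by (rule det_identical_cols[of _ k i i']) (use assms False in \<open>auto intro!: eq_vecI\<close>)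
  then show ?thesis using False by (simp add: normal_entry_def)
qed (simp add: normal_entry_def)

text \<open>By Cramer's rule the matrix is \<open>adj_mat M * A\<close>, where \<open>M\<close>
  consists of the columns \<open>t\<close>. No division occurs, so the entries stay polynomial in
  those of \<open>A\<close>.\<close>

lemma represents_normal_entry:
  assumes A: "represents k n A V" and t: "\<And>j. j < k \<Longrightarrow> t j \<in> {1..n}"
    and nz: "tuple_minor k A t \<noteq> 0"
  shows "represents k n (mat k n (\<lambda>(i, j). normal_entry k A t i (Suc j))) V"
proof -
  define M where "M = mat k k (\<lambda>(i, j). A $$ (i, t j - 1))"
  have M: "M \<in> carrier_mat k k" by (simp add: M_def)
  have dM: "det M = tuple_minor k A t" by (simp add: M_def tuple_minor_def)
  have Ac: "A \<in> carrier_mat k n" using A by (simp add: represents_iff)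
  note adj = adj_mat[OF M]
  have smult: "(c \<cdot>\<^sub>m 1\<^sub>m k) *\<^sub>v v = c \<cdot>\<^sub>v (1\<^sub>m k *\<^sub>v v)" if "v \<in> carrier_vec k"
    for c :: complex and v using that by auto
  have "mat k n (\<lambda>(i, j). normal_entry k A t i (Suc j)) = adj_mat M * A"
  proof (rule eq_matI)
    fix i j assume "i < dim_row (adj_mat M * A)" "j < dim_col (adj_mat M * A)"
    then have ij: "i < k" "j < n" using adj Ac by auto
    define x where "x = adj_mat M *\<^sub>v col A j"
    have cA: "col A j \<in> carrier_vec k" using Ac ij by auto
    have x: "x \<in> carrier_vec k" using adj cA by (simp add: x_def)
    have "M *\<^sub>v x = (M * adj_mat M) *\<^sub>v col A j"
      unfolding x_def by (rule assoc_mult_mat_vec[OF M adj(1) cA, symmetric])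
    also have "\<dots> = det M \<cdot>\<^sub>v (1\<^sub>m k *\<^sub>v col A j)"
      unfolding adj(2) by (rule smult) (rule cA)
    also have "\<dots> = det M \<cdot>\<^sub>v col A j" using cA by simp
    finally have Mx: "M *\<^sub>v x = det M \<cdot>\<^sub>v col A j" .
    \<comment> \<open>\<open>B\<close> is \<open>M\<close> with column \<open>i\<close> replaced by
      column \<open>j\<close> of \<open>A\<close>; the matrix in Cramer's rule has the extra factor
      \<open>det M\<close> in that column.\<close>
    define B where "B = mat k k (\<lambda>(i', j'). A $$ (i', (t(i := Suc j)) j' - 1))"
    have B: "B \<in> carrier_mat k k" by (simp add: B_def)
    have "replace_col M (M *\<^sub>v x) i = mat k k (\<lambda>(i', j'). if j' = i then det M * B $$ (i', j') else B $$ (i', j'))"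
      unfolding replace_col_def Mx using M Ac ij by (intro eq_matI) (auto simp: M_def B_def)
    also have "\<dots> = (multrow i (det M) B\<^sup>T)\<^sup>T"
      by (intro eq_matI) (use B in auto)
    finally have "det (replace_col M (M *\<^sub>v x) i) = det M * det B"
      using det_multrow[of i k "B\<^sup>T" "det M"] ij B det_transpose[OF B] det_transpose[of "multrow i (det M) B\<^sup>T" k]
      by simp
    then have "x $ i * det M = det M * det B" using cramer_lemma_mat[OF M x ij(1)] by simp
    then have "x $ i = det B" using nz dM by simp
    moreover have "(adj_mat M * A) $$ (i, j) = x $ i" using adj Ac ij by (simp add: x_def)
    ultimately show "mat k n (\<lambda>(i, j). normal_entry k A t i (Suc j)) $$ (i, j) = (adj_mat M * A) $$ (i, j)"
      using ij by (simp add: normal_entry_def tuple_minor_def B_def)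
  qed (use adj Ac in auto)
  then show ?thesis
    using represents_mult[OF A adj(1) M adj(3)] nz dM by simp
qed

lemma Gr_diff:
  assumes "V \<in> Gr k n" "x \<in> V" "y \<in> V"
  shows "x - y \<in> V"
proof -
  obtain A where A: "represents k n A V" using assms(1) by (auto simp: Gr_def)
  then have Ac: "A \<in> carrier_mat k n" and V: "V = (\<lambda>y. vec n (\<lambda>j. y \<bullet> col A j)) ` carrier_vec k"
    by (auto simp: represents_iff)
  obtain u v where uv: "u \<in> carrier_vec k" "v \<in> carrier_vec k"
    "x = vec n (\<lambda>j. u \<bullet> col A j)" "y = vec n (\<lambda>j. v \<bullet> col A j)" using assms(2,3) V by auto
  have "x - y = vec n (\<lambda>j. (u - v) \<bullet> col A j)"
  proof (rule eq_vecI)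
    fix j assume "j < dim_vec (vec n (\<lambda>j. (u - v) \<bullet> col A j))"
    then have j: "j < n" by simp
    then have "col A j \<in> carrier_vec k" using Ac by auto
    then show "(x - y) $ j = vec n (\<lambda>j. (u - v) \<bullet> col A j) $ j"
      using j uv by (simp add: minus_scalar_prod_distrib[of _ k])
  qed (use uv in simp)
  then show ?thesis unfolding V using uv by auto
qed

lemma Gr_carrier: "V \<in> Gr k n \<Longrightarrow> x \<in> V \<Longrightarrow> x \<in> carrier_vec n"
  by (auto simp: Gr_def represents_iff)

text \<open>Selecting columns turns minors into minors of \<open>rep k n V\<close>; \<open>s\<close>
  compares the selected columns with the representative chosen for the smaller space. The guard
  mirrors the default value of \<open>plucker\<close>.\<close>

lemma plucker_pull:
  assumes V: "V \<in> Gr k n" and \<xi>: "\<And>j. j \<in> {1..n'} \<Longrightarrow> \<xi> j \<in> {1..n}"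
    and dep: "\<And>e. e \<in> {1..n} \<Longrightarrow> dep V (\<xi> ` {1..n'}) e"
  shows "\<exists>s. s \<noteq> 0 \<and> (\<forall>I. plucker k n' (pull n' \<xi> V) I =
    s * (if I \<subseteq> {1..n'} \<and> card I = k then tuple_minor k (rep k n V) (\<xi> \<circ> enum_set I) else 0))"
proof -
  let ?B = "mat k n' (\<lambda>(i, j). rep k n V $$ (i, \<xi> (Suc j) - 1))"
  have "represents k n' ?B (pull n' \<xi> V)"
    by (rule represents_pull[OF represents_rep[OF V] \<xi> dep])
  from plucker_representation[OF this] obtain s where s: "s \<noteq> 0"
    "\<And>I. I \<subseteq> {1..n'} \<and> card I = k \<Longrightarrow> plucker k n' (pull n' \<xi> V) I = s * tuple_minor k ?B (enum_set I)"
    by blast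
  have "tuple_minor k ?B (enum_set I) = tuple_minor k (rep k n V) (\<xi> \<circ> enum_set I)"
    if I: "I \<subseteq> {1..n'}" "card I = k" for I
  proof -
    have "enum_set I j \<in> {1..n'}" if "j < k" for j
      using bij_betwE[OF enum_set_bij[OF I]] that I(1) by blast
    then show ?thesis unfolding tuple_minor_def by (intro arg_cong[of _ _ det] eq_matI) fastforce+
  qed
  then have "plucker k n' (pull n' \<xi> V) I =
    s * (if I \<subseteq> {1..n'} \<and> card I = k then tuple_minor k (rep k n V) (\<xi> \<circ> enum_set I) else 0)" for I
    using s(2)[of I] by (simp add: plucker_def)
  then show ?thesis using s(1) by blast
qed

lemma minor_form:
  assumes \<xi>: "\<And>j. j \<in> {1..n'} \<Longrightarrow> \<xi> j \<in> {1..n}"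
  shows "\<exists>\<epsilon> S. \<forall>V\<in>Gr k n. (if I \<subseteq> {1..n'} \<and> card I = k then tuple_minor k (rep k n V) (\<xi> \<circ> enum_set I) else 0)
    = \<epsilon> * plucker k n V S"
proof (cases "I \<subseteq> {1..n'} \<and> card I = k")
  case True
  then have "enum_set I j \<in> {1..n'}" if "j < k" for j
    using bij_betwE[OF enum_set_bij[of I n' k]] that by blast
  then have "(\<xi> \<circ> enum_set I) j \<in> {1..n}" if "j < k" for j using \<xi> that by simp
  from tuple_minor_linear_form[where t = "\<xi> \<circ> enum_set I", OF this] show ?thesis using True by simp
next
  case False
  then show ?thesis by (intro exI[of _ 0] exI[of _ "{}"]) (simp only: if_not_P mult_zero_left, simp)
qed

context skew_shape
begin

text \<open>Prepared for \<open>dep_pull\<close>, which compares relations only for labels in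
  range.\<close>

lemma skew_dep_cong:
  assumes "\<And>J e. J \<subseteq> {1..n} \<Longrightarrow> e \<in> {1..n} \<Longrightarrow> D J e \<longleftrightarrow> D' J e"
  shows "skew_dep k n lam mu D \<longleftrightarrow> skew_dep k n lam mu D'"
  unfolding skew_dep_def
proof (rule arg_cong2[of _ _ _ _ "(\<and>)"]; rule ball_cong[OF refl])
  fix c assume c: "c \<in> {1..n - k}"
  then have "c + g c \<in> {1..n}" "c + h c \<le> n"
    using k_le col_height_le[of k n lam c] col_height_le[of k n mu c] by auto
  then have "D {c + g c<..c + h c} (c + g c) = D' {c + g c<..c + h c} (c + g c)"
    "D {c + g c<..<c + h c} (c + g c) = D' {c + g c<..<c + h c} (c + g c)"
    by (intro assms; auto)+
  then show "(D {c + g c<..c + h c} (c + g c) \<and> (g c < h c \<longrightarrow> \<not> D {c + g c<..<c + h c} (c + g c))) =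
      (D' {c + g c<..c + h c} (c + g c) \<and> (g c < h c \<longrightarrow> \<not> D' {c + g c<..<c + h c} (c + g c)))"
    by (simp only:)
next
  fix i assume i: "i \<in> {1..k}"
  then have "b i \<in> {1..n}" "l i \<le> n" using b_range[OF i] l_le_b[OF i] by auto
  then have "D ({b i<..n} \<union> {1..l i}) (b i) = D' ({b i<..n} \<union> {1..l i}) (b i)"
    "D ({b i<..n} \<union> {1..<l i}) (b i) = D' ({b i<..n} \<union> {1..<l i}) (b i)"
    by (intro assms; auto)+
  then show "(D ({b i<..n} \<union> {1..l i}) (b i) \<and> \<not> D ({b i<..n} \<union> {1..<l i}) (b i)) =
      (D' ({b i<..n} \<union> {1..l i}) (b i) \<and> \<not> D' ({b i<..n} \<union> {1..<l i}) (b i))"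
    by (simp only:)
qed

lemma positroid_iff:
  "V \<in> skew_positroid k n lam mu \<longleftrightarrow> V \<in> Gr k n \<and> skew_dep k n lam mu (dep V)"
  by (rule skew_positroid_iff[OF k_pos k_le lam mu mu_le_lam])

end

section \<open>Cutting points and gluing them back\<close>

context column_cut
begin

abbreviation "nR \<equiv> k + a - 1"
abbreviation "nL \<equiv> n - a + 1"
abbreviation "X \<equiv> skew_positroid k n lam mu"
abbreviation "XR \<equiv> skew_positroid k nR (cut_right k n a lam) (cut_right k n a mu)"
abbreviation "XL \<equiv> skew_positroid k nL (cut_left k n a lam) (cut_left k n a mu)"

text \<open>These are the positions of the gluing basis in the left factor; in the right factor
  \<open>bR\<close> gives its positions.\<close>

definition tuple_left :: "nat \<Rightarrow> nat" where
  "tuple_left = column_cut.gluing_basis k nL (cut_left k n a lam) (cut_left k n a mu) 1"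

lemma dep_Gr: "V \<in> Gr k n \<Longrightarrow> column_cut_dep k n lam mu a (dep V)"
  by (intro column_cut_dep.intro skew_shape_dep.intro column_cut_axioms skew_shape_axioms
      dependence_dep[OF represents_rep])

lemma idx_right_bR: "i \<in> {1..k} \<Longrightarrow> idx_right (bR i) = gluing_basis i"
proof (cases "i \<le> m")
  case True
  assume i: "i \<in> {1..k}"
  then have "bR i = b i" "b i < P" using True right_rows(1)[OF i] b_le[OF i True] b_less_P_iff by auto
  then show ?thesis using True by (simp add: gluing_basis_def idx_right_less)
next
  case False
  assume i: "i \<in> {1..k}"
  then have "bR i = a - 1 + i" using False right_rows(1)[OF i] b_ge[OF i] by auto
  then show ?thesis using False by (simp add: gluing_basis_def)
qed

lemma bR_range: "i \<in> {1..k} \<Longrightarrow> bR i \<in> {1..nR}"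
  by (rule skew_shape.b_range[OF shape_right])

lemma tuple_left_range: "i \<in> {1..k} \<Longrightarrow> tuple_left i \<in> {1..nL}"
  unfolding tuple_left_def by (rule column_cut.gluing_basis_range[OF cut_left_shape])

lemma tuple_left_le: "i \<in> {1..k} \<Longrightarrow> i \<le> m \<Longrightarrow> tuple_left i = i"
  unfolding tuple_left_def column_cut.gluing_basis_def[OF cut_left_shape] m_left
  using left_rows(1)[of i] b_le[of i] by auto

lemma tuple_left_gt:
  assumes i: "i \<in> {1..k}" "m < i"
  shows "tuple_left i = (if i = Suc m \<and> m < h a then i else bL i)"
proof -
  have "tuple_left i = column_cut.idx_right k nL (cut_left k n a lam) (cut_left k n a mu) 1 i"
    using i unfolding tuple_left_def column_cut.gluing_basis_def[OF cut_left_shape] m_left by simp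
  also have "\<dots> = (if i = Suc m \<and> m < h a then i else bL i)"
    using i unfolding column_cut.idx_right_def[OF cut_left_shape] m_left h_left by auto
  finally show ?thesis .
qed

lemma idx_left_tuple_left:
  assumes i: "i \<in> {1..k}"
  shows "idx_left (tuple_left i) = gluing_basis i"
proof (cases "i \<le> m")
  case True
  then show ?thesis using i tuple_left_le by (simp add: gluing_basis_def idx_left_le)
next
  case False
  show ?thesis
  proof (cases "i = Suc m \<and> m < h a")
    case True
    then have "idx_left i = P" "a - 1 + i = P" using a_pos by (auto simp: idx_left_gt)
    then show ?thesis using True i tuple_left_gt[OF i] idx_right_P by (simp add: gluing_basis_def)
  next
    case c: False
    then have "idx_right (a - 1 + i) = b i" using False by (intro idx_right_b) auto
    then show ?thesis
      using c False i tuple_left_gt[OF i] idx_left_bL[OF i] by (auto simp: gluing_basis_def)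
  qed
qed

lemma gluing_basis_right: "gluing_basis ` {1..k} \<subseteq> idx_right ` {1..nR}"
  using idx_right_bR bR_range by (metis image_eqI image_subsetI)

lemma gluing_basis_left: "gluing_basis ` {1..k} \<subseteq> idx_left ` {1..nL}"
  using idx_left_tuple_left tuple_left_range by (metis image_eqI image_subsetI)

lemma positroid_spanned:
  assumes V: "V \<in> X" and e: "e \<in> {1..n}"
  shows "dep V (gluing_basis ` {1..k}) e" "dep V (idx_right ` {1..nR}) e" "dep V (idx_left ` {1..nL}) e"
proof -
  have VG: "V \<in> Gr k n" and D: "skew_dep k n lam mu (dep V)" using V by (auto simp: positroid_iff)
  interpret column_cut_dep k n lam mu a "dep V" by (rule dep_Gr[OF VG])
  show *: "dep V (gluing_basis ` {1..k}) e"
    by (rule dep_on_gluing_basis[OF skew_dep_columns[OF D] skew_dep_first_column[OF D] e])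
  show "dep V (idx_right ` {1..nR}) e" by (rule D_mono[OF * gluing_basis_right])
  show "dep V (idx_left ` {1..nL}) e" by (rule D_mono[OF * gluing_basis_left])
qed

text \<open>The dependences of a pulled-back space are the pulled-back dependences, so
  \<open>skew_dep_cut\<close> applies. One direction serves cutting and the other gluing.\<close>

lemma positroid_cut_iff:
  assumes V: "V \<in> Gr k n" and R: "pull nR idx_right V \<in> Gr k nR" and L: "pull nL idx_left V \<in> Gr k nL"
  shows "V \<in> X \<longleftrightarrow> pull nR idx_right V \<in> XR \<and> pull nL idx_left V \<in> XL"
proof -
  interpret column_cut_dep k n lam mu a "dep V" by (rule dep_Gr[OF V])
  have "skew_dep k nR (cut_right k n a lam) (cut_right k n a mu) (dep (pull nR idx_right V)) \<longleftrightarrow>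
      skew_dep k nR (cut_right k n a lam) (cut_right k n a mu) (\<lambda>J e. dep V (idx_right ` J) (idx_right e))"
    by (rule skew_shape.skew_dep_cong[OF shape_right]) (rule dep_pull)
  moreover have "skew_dep k nL (cut_left k n a lam) (cut_left k n a mu) (dep (pull nL idx_left V)) \<longleftrightarrow>
      skew_dep k nL (cut_left k n a lam) (cut_left k n a mu) (\<lambda>J e. dep V (idx_left ` J) (idx_left e))"
    by (rule skew_shape.skew_dep_cong[OF column_cut.axioms(1)[OF cut_left_shape]]) (rule dep_pull)
  ultimately show ?thesis
    unfolding positroid_iff skew_shape.positroid_iff[OF shape_right]
      skew_shape.positroid_iff[OF column_cut.axioms(1)[OF cut_left_shape]]
    using V R L skew_dep_cut by blast
qed

lemma pull_Gr:
  assumes V: "V \<in> X"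
  shows "pull nR idx_right V \<in> Gr k nR" "pull nL idx_left V \<in> Gr k nL"
proof -
  have "V \<in> Gr k n" using V by (simp add: positroid_iff)
  note A = represents_rep[OF this]
  have "represents k nR (mat k nR (\<lambda>(i, j). rep k n V $$ (i, idx_right (Suc j) - 1))) (pull nR idx_right V)"
    by (rule represents_pull[OF A idx_right_range positroid_spanned(2)[OF V]])
  then show "pull nR idx_right V \<in> Gr k nR" unfolding Gr_def by blast
  have "represents k nL (mat k nL (\<lambda>(i, j). rep k n V $$ (i, idx_left (Suc j) - 1))) (pull nL idx_left V)"
    by (rule represents_pull[OF A idx_left_range positroid_spanned(3)[OF V]])
  then show "pull nL idx_left V \<in> Gr k nL" unfolding Gr_def by blast
qed

lemma pull_positroid:
  assumes V: "V \<in> X"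
  shows "pull nR idx_right V \<in> XR" "pull nL idx_left V \<in> XL"
proof -
  have "V \<in> Gr k n" using V unfolding positroid_iff by blast
  from positroid_cut_iff[OF this pull_Gr[OF V]] V
  show "pull nR idx_right V \<in> XR" "pull nL idx_left V \<in> XL" by blast+
qed

text \<open>A vector \<open>x\<close> of \<open>V\<close> has companions \<open>y\<close> and
  \<open>z\<close> in \<open>V'\<close> that agree with it on the columns of the right and of the
  left factor. Their difference vanishes on the gluing basis, so they coincide, and every label
  occurs in one of the factors.\<close>

lemma pull_subset:
  assumes V: "V \<in> X" and V': "V' \<in> X"
    and R: "pull nR idx_right V = pull nR idx_right V'" and L: "pull nL idx_left V = pull nL idx_left V'"
  shows "V \<subseteq> V'"
proof
  fix x assume x: "x \<in> V"
  have G: "V \<in> Gr k n" "V' \<in> Gr k n" using V V' unfolding positroid_iff by blast+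
  have agree: "\<exists>y\<in>V'. \<forall>j\<in>{1..n'}. y $ (\<xi> j - 1) = x $ (\<xi> j - 1)" if eq: "pull n' \<xi> V = pull n' \<xi> V'"
    for n' :: nat and \<xi>
  proof -
    have "vec n' (\<lambda>j. x $ (\<xi> (Suc j) - 1)) \<in> pull n' \<xi> V"
      unfolding pull_def using x by (rule imageI)
    then have "vec n' (\<lambda>j. x $ (\<xi> (Suc j) - 1)) \<in> pull n' \<xi> V'" by (simp only: eq)
    then obtain y where y: "y \<in> V'" "vec n' (\<lambda>j. x $ (\<xi> (Suc j) - 1)) = vec n' (\<lambda>j. y $ (\<xi> (Suc j) - 1))"
      unfolding pull_def by blast
    have "y $ (\<xi> j - 1) = x $ (\<xi> j - 1)" if j: "j \<in> {1..n'}" for j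
    proof -
      obtain j' where j': "j = Suc j'" "j' < n'" using j by (cases j) auto
      have "vec n' (\<lambda>j. x $ (\<xi> (Suc j) - 1)) $ j' = vec n' (\<lambda>j. y $ (\<xi> (Suc j) - 1)) $ j'"
        by (simp only: y(2))
      then show ?thesis using j' by (simp only: index_vec)
    qed
    then show ?thesis using y(1) by blast
  qed
  obtain y where y: "y \<in> V'" "\<forall>j\<in>{1..nR}. y $ (idx_right j - 1) = x $ (idx_right j - 1)"
    using agree[OF R] by blast
  obtain z where z: "z \<in> V'" "\<forall>j\<in>{1..nL}. z $ (idx_left j - 1) = x $ (idx_left j - 1)"
    using agree[OF L] by blast
  have car: "x \<in> carrier_vec n" "y \<in> carrier_vec n" "z \<in> carrier_vec n"
    using Gr_carrier[OF G(1) x] Gr_carrier[OF G(2) y(1)] Gr_carrier[OF G(2) z(1)] by blast+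
  have d: "(y - z) $ (e - 1) = y $ (e - 1) - z $ (e - 1)" if "e \<in> {1..n}" for e
  proof -
    have "e - 1 < n" using that by auto
    then show ?thesis using car by simp
  qed
  have yz: "y $ (e - 1) = z $ (e - 1)" if e: "e \<in> {1..n}" for e
  proof -
    have "(y - z) $ (e - 1) = 0"
    proof -
      have "\<forall>j\<in>gluing_basis ` {1..k}. (y - z) $ (j - 1) = 0"
      proof
        fix j assume j: "j \<in> gluing_basis ` {1..k}"
        obtain r where r: "r \<in> {1..nR}" "j = idx_right r" using gluing_basis_right j by blast
        obtain s where s: "s \<in> {1..nL}" "j = idx_left s" using gluing_basis_left j by blast
        have "y $ (j - 1) = x $ (j - 1)" using y(2) r by blast
        moreover have "z $ (j - 1) = x $ (j - 1)" using z(2) s by blast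
        moreover have "j \<in> {1..n}" using idx_right_range[OF r(1)] r(2) by simp
        ultimately show "(y - z) $ (j - 1) = 0" using d by simp
      qed
      then show ?thesis
        using positroid_spanned(1)[OF V' e] Gr_diff[OF G(2) y(1) z(1)] unfolding dep_def by blast
    qed
    then show ?thesis using d[OF e] by simp
  qed
  have "y = x"
  proof (rule eq_vecI)
    fix j assume "j < dim_vec x"
    then have e: "Suc j \<in> {1..n}" using car by auto
    show "y $ j = x $ j"
    proof (cases "Suc j < P")
      case True
      then have "idx_right (Suc j) = Suc j" "Suc j \<in> {1..nR}" using m_le by (auto simp: idx_right_less)
      then show ?thesis using y(2) by (metis diff_Suc_1)
    next
      case False
      define i where "i = Suc j - (a - 1)"
      have i: "m < i" "i \<in> {1..nL}" "i + (a - 1) = Suc j" using False e a_pos a_le by (auto simp: i_def)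
      then have "idx_left i = Suc j" by (simp add: idx_left_gt)
      then have "z $ j = x $ j" using z(2) i(2) by (metis diff_Suc_1)
      then show ?thesis using yz[OF e] by simp
    qed
  qed (use car in simp)
  then show "x \<in> V'" using y(1) by simp
qed

text \<open>Each half is normalised on the gluing basis and multiplied by the basis minor of the
  other. The basis columns then become the same multiple of unit vectors in both halves, and each
  entry is a product of one maximal minor from either factor.\<close>

definition glue_matrix :: "complex vec set \<times> complex vec set \<Rightarrow> complex mat" where
  "glue_matrix = (\<lambda>(W, U). mat k n (\<lambda>(i, j).
     if Suc j < P
     then normal_entry k (rep k nR W) (\<lambda>i. bR (Suc i)) i (Suc j) * tuple_minor k (rep k nL U) (\<lambda>i. tuple_left (Suc i))
     else tuple_minor k (rep k nR W) (\<lambda>i. bR (Suc i)) *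
       normal_entry k (rep k nL U) (\<lambda>i. tuple_left (Suc i)) i (Suc j - (a - 1))))"

definition glue :: "complex vec set \<times> complex vec set \<Rightarrow> complex vec set" where
  "glue q = vec_space.row_space n (glue_matrix q)"

text \<open>On the right these are the row labels of the piece, which span; on the left they form
  the gluing basis of the piece cut at its first column.\<close>

lemma minors_nonzero:
  shows "W \<in> XR \<Longrightarrow> tuple_minor k (rep k nR W) (\<lambda>i. bR (Suc i)) \<noteq> 0"
    and "U \<in> XL \<Longrightarrow> tuple_minor k (rep k nL U) (\<lambda>i. tuple_left (Suc i)) \<noteq> 0"
proof -
  have image: "(\<lambda>i. f (Suc i)) ` {..<k} = f ` {1..k}" for f :: "nat \<Rightarrow> nat"
    using image_image[of f Suc "{..<k}"] by (simp add: image_Suc_lessThan)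
  {
    assume "W \<in> XR"
    then have W: "W \<in> Gr k nR" "skew_dep k nR (cut_right k n a lam) (cut_right k n a mu) (dep W)"
      unfolding skew_shape.positroid_iff[OF shape_right] by blast+
    interpret R: skew_shape_dep k nR "cut_right k n a lam" "cut_right k n a mu" "dep W"
      by (intro skew_shape_dep.intro shape_right dependence_dep[OF represents_rep[OF W(1)]])
    have range: "bR (Suc j) \<in> {1..nR}" if "j < k" for j using bR_range that by simp
    show "tuple_minor k (rep k nR W) (\<lambda>i. bR (Suc i)) \<noteq> 0"
    proof (rule iffD2[OF tuple_minor_nonzero_iff[OF represents_rep[OF W(1)]]])
      show "\<forall>e\<in>{1..nR}. dep W ((\<lambda>i. bR (Suc i)) ` {..<k}) e"
        unfolding image using R.dep_on_b[OF R.skew_dep_columns[OF W(2)]] by blast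
    qed (rule range)
  next
    assume "U \<in> XL"
    then have U: "U \<in> Gr k nL" "skew_dep k nL (cut_left k n a lam) (cut_left k n a mu) (dep U)"
      unfolding skew_shape.positroid_iff[OF column_cut.axioms(1)[OF cut_left_shape]] by blast+
    interpret L: column_cut_dep k nL "cut_left k n a lam" "cut_left k n a mu" 1 "dep U"
      by (rule column_cut.dep_Gr[OF cut_left_shape U(1)])
    have range: "tuple_left (Suc j) \<in> {1..nL}" if "j < k" for j using tuple_left_range that by simp
    show "tuple_minor k (rep k nL U) (\<lambda>i. tuple_left (Suc i)) \<noteq> 0"
    proof (rule iffD2[OF tuple_minor_nonzero_iff[OF represents_rep[OF U(1)]]])
      show "\<forall>e\<in>{1..nL}. dep U ((\<lambda>i. tuple_left (Suc i)) ` {..<k}) e"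
        unfolding image tuple_left_def
        using L.dep_on_gluing_basis[OF L.skew_dep_columns[OF U(2)] L.skew_dep_first_column[OF U(2)]] by blast
    qed (rule range)
  }
qed

text \<open>A column of one factor that is stored in the half of the other belongs to the gluing
  basis, and there both formulas give the same multiple of a unit vector.\<close>

lemma glue_columns:
  fixes W U :: "complex vec set"
  assumes i: "i < k"
  defines "AR \<equiv> rep k nR W" and "tR \<equiv> \<lambda>i. bR (Suc i)"
    and "AL \<equiv> rep k nL U" and "tL \<equiv> \<lambda>i. tuple_left (Suc i)"
  shows "j \<in> {1..nR} \<Longrightarrow> glue_matrix (W, U) $$ (i, idx_right j - 1) =
      tuple_minor k AL tL * normal_entry k AR tR i j"
    and "j \<in> {1..nL} \<Longrightarrow> glue_matrix (W, U) $$ (i, idx_left j - 1) =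
      tuple_minor k AR tR * normal_entry k AL tL i j"
proof -
  have entry: "glue_matrix (W, U) $$ (i, e - 1) =
      (if e < P then normal_entry k AR tR i e * tuple_minor k AL tL
       else tuple_minor k AR tR * normal_entry k AL tL i (e - (a - 1)))" if e: "e \<in> {1..n}" for e
  proof -
    have "e - 1 < n" "Suc (e - 1) = e" using e by auto
    then show ?thesis using i by (simp add: glue_matrix_def AR_def AL_def tR_def tL_def)
  qed
  {
    assume j: "j \<in> {1..nR}"
    from j show "glue_matrix (W, U) $$ (i, idx_right j - 1) = tuple_minor k AL tL * normal_entry k AR tR i j"
    proof (cases rule: right_index_cases)
      case 1
      then show ?thesis using entry[OF idx_right_range[OF j]] by (simp add: idx_right_less)
    next
      case (2 i')
      have tRj: "tR (i' - 1) = j" using 2 right_rows(1)[of i'] b_ge[of i'] by (simp add: tR_def)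
      have "idx_right j = gluing_basis i'" using 2 by (simp add: gluing_basis_def)
      then have idx: "idx_right j = idx_left (tuple_left i')" using idx_left_tuple_left 2 by simp
      have "m < tuple_left i'" using 2 tuple_left_gt[of i'] left_rows(1)[of i'] by (auto simp: less_max_iff_disj)
      then have "idx_right j - (a - 1) = tL (i' - 1)" using idx idx_left_gt 2 by (simp add: tL_def)
      moreover have "\<not> idx_right j < P" using idx_right_ge_P[of i'] 2 by simp
      ultimately have "glue_matrix (W, U) $$ (i, idx_right j - 1) =
          tuple_minor k AR tR * normal_entry k AL tL i (tL (i' - 1))"
        using entry[OF idx_right_range[OF j]] by simp
      moreover have "i' - 1 < k" using 2 by auto
      ultimately show ?thesis
        using normal_entry_basis[of i k "i' - 1" AL tL] normal_entry_basis[of i k "i' - 1" AR tR] i tRj by simp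
    qed
  next
    assume j: "j \<in> {1..nL}"
    show "glue_matrix (W, U) $$ (i, idx_left j - 1) = tuple_minor k AR tR * normal_entry k AL tL i j"
    proof (cases "j \<le> m")
      case True
      then have jk: "j \<in> {1..k}" using j m_le by auto
      have idx: "idx_left j = b j" "b j < P" using True b_less_P_iff[OF jk] by (auto simp: idx_left_le)
      have tRj: "tR (j - 1) = b j" using jk right_rows(1)[OF jk] b_le[OF jk True] by (simp add: tR_def)
      have tLj: "tL (j - 1) = j" using jk tuple_left_le[OF jk True] by (simp add: tL_def)
      have "j - 1 < k" using jk by auto
      then show ?thesis
        using entry[OF idx_left_range[OF j]] idx i tRj tLj
          normal_entry_basis[of i k "j - 1" AL tL] normal_entry_basis[of i k "j - 1" AR tR] by simp
    next
      case False
      then have "\<not> idx_left j < P" "idx_left j - (a - 1) = j" using a_pos by (auto simp: idx_left_gt)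
      then show ?thesis using entry[OF idx_left_range[OF j]] by (simp only: if_False)
    qed
  }
qed

text \<open>On the gluing basis the matrix is a nonzero multiple of the identity, so no nonzero
  functional kills all columns.\<close>

lemma represents_glue:
  assumes W: "W \<in> XR" and U: "U \<in> XL"
  shows "represents k n (glue_matrix (W, U)) (glue (W, U))"
proof -
  define DR DL where "DR = tuple_minor k (rep k nR W) (\<lambda>i. bR (Suc i))"
    and "DL = tuple_minor k (rep k nL U) (\<lambda>i. tuple_left (Suc i))"
  have nz: "DR \<noteq> 0" "DL \<noteq> 0" using minors_nonzero W U by (auto simp: DR_def DL_def)
  let ?A = "glue_matrix (W, U)"
  have A: "?A \<in> carrier_mat k n" by (simp add: glue_matrix_def)
  have "y = 0\<^sub>v k" if y: "y \<in> carrier_vec k" and 0: "\<forall>j<n. y \<bullet> col ?A j = 0" for y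
  proof (rule eq_vecI)
    fix i assume "i < dim_vec (0\<^sub>v k :: complex vec)"
    then have i: "i < k" by simp
    define j where "j = idx_right (bR (Suc i)) - 1"
    have r: "bR (Suc i) \<in> {1..nR}" using bR_range i by simp
    have j: "j < n" using idx_right_range[OF r] by (auto simp: j_def)
    have col: "col ?A j = (DL * DR) \<cdot>\<^sub>v unit_vec k i"
    proof (rule eq_vecI)
      fix i' assume "i' < dim_vec ((DL * DR) \<cdot>\<^sub>v unit_vec k i)"
      then have i': "i' < k" by simp
      then show "col ?A j $ i' = ((DL * DR) \<cdot>\<^sub>v unit_vec k i) $ i'"
        using glue_columns(1)[OF i' r, of W U] normal_entry_basis[OF i' i, of "rep k nR W" "\<lambda>i. bR (Suc i)"] A i j
        by (simp add: j_def DL_def DR_def)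
    qed (use A in simp)
    have "y \<bullet> col ?A j = 0" using 0 j by blast
    then have "DL * DR * y $ i = 0" unfolding col using y i by simp
    then show "y $ i = 0\<^sub>v k $ i" using nz i by simp
  qed (use y in simp)
  then show ?thesis
    unfolding glue_def represents_def using A rank_eq_iff_inj[OF A] by blast
qed

text \<open>The selected columns of the glued matrix form a nonzero multiple of the normalised
  matrix of the factor, which has the original row space.\<close>

lemma pull_glue:
  assumes W: "W \<in> XR" and U: "U \<in> XL"
  shows "pull nR idx_right (glue (W, U)) = W" "pull nL idx_left (glue (W, U)) = U"
proof -
  define AR tR AL tL where "AR = rep k nR W" and "tR = (\<lambda>i. bR (Suc i))"
    and "AL = rep k nL U" and "tL = (\<lambda>i. tuple_left (Suc i))"
  have nz: "tuple_minor k AR tR \<noteq> 0" "tuple_minor k AL tL \<noteq> 0"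
    using minors_nonzero W U by (auto simp: AR_def AL_def tR_def tL_def)
  have GW: "represents k nR AR W" and GU: "represents k nL AL U"
    using W U represents_rep unfolding AR_def AL_def skew_positroid_def open_positroid_def by auto
  have tR: "tR j \<in> {1..nR}" and tL: "tL j \<in> {1..nL}" if "j < k" for j
    using that bR_range tuple_left_range by (auto simp: tR_def tL_def)
  note A = represents_glue[OF W U]
  note cols = glue_columns[where W = W and U = U, folded AR_def AL_def tR_def tL_def]
  have span: "dep (glue (W, U)) (gluing_basis ` {1..k}) e" if e: "e \<in> {1..n}" for e
  proof -
    have "tuple_minor k (glue_matrix (W, U)) (\<lambda>i. gluing_basis (Suc i)) \<noteq> 0"
    proof -
      have "glue_matrix (W, U) $$ (i, gluing_basis (Suc i') - 1) =
          tuple_minor k AL tL * (if i = i' then tuple_minor k AR tR else 0)" if "i < k" "i' < k" for i i'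
        using cols(1)[OF that(1) tR[OF that(2)]] normal_entry_basis[OF that, of AR tR] idx_right_bR[of "Suc i'"] that
        by (simp add: tR_def)
      then have "mat k k (\<lambda>(i, j). glue_matrix (W, U) $$ (i, gluing_basis (Suc j) - 1)) =
          (tuple_minor k AL tL * tuple_minor k AR tR) \<cdot>\<^sub>m 1\<^sub>m k"
        by (intro eq_matI) auto
      then show ?thesis using nz by (simp add: tuple_minor_def)
    qed
    moreover have "(\<lambda>i. gluing_basis (Suc i)) ` {..<k} = gluing_basis ` {1..k}"
      using image_image[of gluing_basis Suc "{..<k}"] by (simp add: image_Suc_lessThan)
    ultimately show ?thesis
      using tuple_minor_nonzero_iff[OF A, of "\<lambda>i. gluing_basis (Suc i)"] gluing_basis_range e by auto
  qed
  have "represents k nR (mat k nR (\<lambda>(i, j). glue_matrix (W, U) $$ (i, idx_right (Suc j) - 1)))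
      (pull nR idx_right (glue (W, U)))"
    by (rule represents_pull[OF A idx_right_range dep_mono[OF span gluing_basis_right]])
  moreover have "mat k nR (\<lambda>(i, j). glue_matrix (W, U) $$ (i, idx_right (Suc j) - 1)) =
      tuple_minor k AL tL \<cdot>\<^sub>m mat k nR (\<lambda>(i, j). normal_entry k AR tR i (Suc j))"
  proof (rule eq_matI)
    fix i j assume "i < dim_row (tuple_minor k AL tL \<cdot>\<^sub>m mat k nR (\<lambda>(i, j). normal_entry k AR tR i (Suc j)))"
      "j < dim_col (tuple_minor k AL tL \<cdot>\<^sub>m mat k nR (\<lambda>(i, j). normal_entry k AR tR i (Suc j)))"
    then have ij: "i < k" "j < nR" by auto
    then have "Suc j \<in> {1..nR}" by simp
    from cols(1)[OF ij(1) this] show "mat k nR (\<lambda>(i, j). glue_matrix (W, U) $$ (i, idx_right (Suc j) - 1)) $$ (i, j) =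
        (tuple_minor k AL tL \<cdot>\<^sub>m mat k nR (\<lambda>(i, j). normal_entry k AR tR i (Suc j))) $$ (i, j)"
      using ij by simp
  qed auto
  moreover have "represents k nR (tuple_minor k AL tL \<cdot>\<^sub>m mat k nR (\<lambda>(i, j). normal_entry k AR tR i (Suc j))) W"
    by (intro represents_smult represents_normal_entry GW tR nz)
  ultimately show "pull nR idx_right (glue (W, U)) = W" using represents_functional by simp
  have "represents k nL (mat k nL (\<lambda>(i, j). glue_matrix (W, U) $$ (i, idx_left (Suc j) - 1)))
      (pull nL idx_left (glue (W, U)))"
    by (rule represents_pull[OF A idx_left_range dep_mono[OF span gluing_basis_left]])
  moreover have "mat k nL (\<lambda>(i, j). glue_matrix (W, U) $$ (i, idx_left (Suc j) - 1)) =
      tuple_minor k AR tR \<cdot>\<^sub>m mat k nL (\<lambda>(i, j). normal_entry k AL tL i (Suc j))"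
  proof (rule eq_matI)
    fix i j assume "i < dim_row (tuple_minor k AR tR \<cdot>\<^sub>m mat k nL (\<lambda>(i, j). normal_entry k AL tL i (Suc j)))"
      "j < dim_col (tuple_minor k AR tR \<cdot>\<^sub>m mat k nL (\<lambda>(i, j). normal_entry k AL tL i (Suc j)))"
    then have ij: "i < k" "j < nL" by auto
    then have "Suc j \<in> {1..nL}" by simp
    from cols(2)[OF ij(1) this] show "mat k nL (\<lambda>(i, j). glue_matrix (W, U) $$ (i, idx_left (Suc j) - 1)) $$ (i, j) =
        (tuple_minor k AR tR \<cdot>\<^sub>m mat k nL (\<lambda>(i, j). normal_entry k AL tL i (Suc j))) $$ (i, j)"
      using ij by simp
  qed auto
  moreover have "represents k nL (tuple_minor k AR tR \<cdot>\<^sub>m mat k nL (\<lambda>(i, j). normal_entry k AL tL i (Suc j))) U"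
    by (intro represents_smult represents_normal_entry GU tL nz)
  ultimately show "pull nL idx_left (glue (W, U)) = U" using represents_functional by simp
qed

lemma glue_positroid:
  assumes W: "W \<in> XR" and U: "U \<in> XL"
  shows "glue (W, U) \<in> X"
proof -
  have "glue (W, U) \<in> Gr k n" using represents_glue[OF W U] by (auto simp: Gr_def)
  moreover have "W \<in> Gr k nR" "U \<in> Gr k nL"
    using W U unfolding skew_positroid_def open_positroid_def by auto
  ultimately show ?thesis using positroid_cut_iff pull_glue[OF W U] W U by simp
qed

end

section \<open>The isomorphism and the open subset\<close>

context column_cut
begin

definition cut_map :: "complex vec set \<Rightarrow> complex vec set \<times> complex vec set" where
  "cut_map V = (pull nR idx_right V, pull nL idx_left V)"

lemma variety_morphism_cut_map:
  "variety_morphism (plucker k n) X (segre (plucker k nR) (plucker k nL)) (XR \<times> XL) cut_map"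
proof -
  define cR where "cR V I = (if I \<subseteq> {1..nR} \<and> card I = k
    then tuple_minor k (rep k n V) (idx_right \<circ> enum_set I) else 0)" for V I
  define cL where "cL V I = (if I \<subseteq> {1..nL} \<and> card I = k
    then tuple_minor k (rep k n V) (idx_left \<circ> enum_set I) else 0)" for V I
  have "\<forall>I. \<exists>\<epsilon> S. \<forall>V\<in>Gr k n. cR V I = \<epsilon> * plucker k n V S"
    unfolding cR_def using minor_form[where \<xi> = idx_right and n = n and n' = nR and k = k, OF idx_right_range] by blast
  then obtain eR sR where R: "\<And>I V. V \<in> Gr k n \<Longrightarrow> cR V I = eR I * plucker k n V (sR I)"
    by metis
  have "\<forall>I. \<exists>\<epsilon> S. \<forall>V\<in>Gr k n. cL V I = \<epsilon> * plucker k n V S"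
    unfolding cL_def using minor_form[where \<xi> = idx_left and n = n and n' = nL and k = k, OF idx_left_range] by blast
  then obtain eL sL where L: "\<And>I V. V \<in> Gr k n \<Longrightarrow> cL V I = eL I * plucker k n V (sL I)"
    by metis
  show ?thesis
  \<comment> \<open>A Segre coordinate multiplies one minor from each factor, and each of these is a
    multiple of a Pluecker coordinate of \<open>V\<close>; hence degree 2.\<close>
  proof (rule variety_morphism_homogeneous[where d = 2 and
        G = "\<lambda>(I, J) x. (eR I * x (sR I)) * (eL J * x (sL J))"])
    show "cut_map ` X \<subseteq> XR \<times> XL" using pull_positroid by (auto simp: cut_map_def)
  next
    fix IJ :: "nat set \<times> nat set"
    obtain I J where IJ: "IJ = (I, J)" by (cases IJ)
    have "homogeneous_form (1 + 1) (\<lambda>x. (eR I * x (sR I)) * (eL J * x (sL J)))"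
      by (intro homogeneous_form_mult homogeneous_form_coord)
    then show "homogeneous_form 2 ((\<lambda>(I, J) x. (eR I * x (sR I)) * (eL J * x (sL J))) IJ)"
      by (simp add: IJ numeral_2_eq_2)
  next
    fix V assume V: "V \<in> X"
    then have VG: "V \<in> Gr k n" unfolding positroid_iff by blast
    obtain s where s: "s \<noteq> 0" "\<And>I. plucker k nR (pull nR idx_right V) I = s * cR V I"
      using plucker_pull[where \<xi> = idx_right and n' = nR, OF VG idx_right_range positroid_spanned(2)[OF V]]
      unfolding cR_def by blast
    obtain t where t: "t \<noteq> 0" "\<And>I. plucker k nL (pull nL idx_left V) I = t * cL V I"
      using plucker_pull[where \<xi> = idx_left and n' = nL, OF VG idx_left_range positroid_spanned(3)[OF V]]
      unfolding cL_def by blast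
    show "\<exists>s. s \<noteq> 0 \<and> (\<forall>j. segre (plucker k nR) (plucker k nL) (cut_map V) j =
        s * (case j of (I, J) \<Rightarrow> \<lambda>x. (eR I * x (sR I)) * (eL J * x (sL J))) (plucker k n V))"
      using s t R[OF VG] L[OF VG]
      by (intro exI[of _ "s * t"]) (auto simp: segre_def cut_map_def mult_ac)
  qed
qed

text \<open>The cross multiplication in \<open>glue_matrix\<close> makes each entry a multiple of a
  single Segre coordinate.\<close>

lemma glue_entry_form:
  assumes e: "e \<in> {1..n}" and i: "i < k"
  shows "\<exists>F. homogeneous_form 1 F \<and> (\<forall>q\<in>XR \<times> XL. glue_matrix q $$ (i, e - 1) =
    F (segre (plucker k nR) (plucker k nL) q))"
proof -
  let ?tR = "\<lambda>i. bR (Suc i)" and ?tL = "\<lambda>i. tuple_left (Suc i)"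
  have product: "\<exists>F. homogeneous_form 1 F \<and> (\<forall>q\<in>XR \<times> XL.
      tuple_minor k (rep k nR (fst q)) t * tuple_minor k (rep k nL (snd q)) u =
      F (segre (plucker k nR) (plucker k nL) q))"
    if t: "\<And>j. j < k \<Longrightarrow> t j \<in> {1..nR}" and u: "\<And>j. j < k \<Longrightarrow> u j \<in> {1..nL}" for t u
  proof -
    obtain \<epsilon> I where 1: "\<And>W. W \<in> Gr k nR \<Longrightarrow> tuple_minor k (rep k nR W) t = \<epsilon> * plucker k nR W I"
      using tuple_minor_linear_form[where t = t, OF t] by blast
    obtain \<delta> J where 2: "\<And>U. U \<in> Gr k nL \<Longrightarrow> tuple_minor k (rep k nL U) u = \<delta> * plucker k nL U J"
      using tuple_minor_linear_form[where t = u, OF u] by blast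
    have "tuple_minor k (rep k nR (fst q)) t * tuple_minor k (rep k nL (snd q)) u =
        (\<epsilon> * \<delta>) * segre (plucker k nR) (plucker k nL) q (I, J)" if "q \<in> XR \<times> XL" for q
    proof -
      have "fst q \<in> Gr k nR" "snd q \<in> Gr k nL"
        using that unfolding skew_positroid_def open_positroid_def by auto
      from 1[OF this(1)] 2[OF this(2)] show ?thesis by (simp add: segre_def case_prod_unfold)
    qed
    then show ?thesis using homogeneous_form_coord[of "\<epsilon> * \<delta>" "(I, J)"] by blast
  qed
  have tR: "?tR j \<in> {1..nR}" and tL: "?tL j \<in> {1..nL}" if "j < k" for j
    using that bR_range tuple_left_range by auto
  have e': "e - 1 < n" "Suc (e - 1) = e" using e by auto
  show ?thesis
  proof (cases "e < P")
    case True
    then have "e \<in> {1..nR}" using e m_le by auto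
    then have "(?tR(i := e)) j \<in> {1..nR}" if "j < k" for j using tR that by simp
    from product[of "?tR(i := e)" ?tL, OF this tL] show ?thesis
      using e' i True by (auto simp: glue_matrix_def normal_entry_def case_prod_unfold)
  next
    case False
    then have "e - (a - 1) \<in> {1..nL}" using e a_pos by auto
    then have "(?tL(i := e - (a - 1))) j \<in> {1..nL}" if "j < k" for j using tL that by simp
    from product[of ?tR "?tL(i := e - (a - 1))", OF tR this] show ?thesis
      using e' i False by (auto simp: glue_matrix_def normal_entry_def case_prod_unfold)
  qed
qed

lemma variety_morphism_glue:
  "variety_morphism (segre (plucker k nR) (plucker k nL)) (XR \<times> XL) (plucker k n) X glue"
proof -
  let ?h = "segre (plucker k nR) (plucker k nL)"
  have "\<forall>i e. \<exists>F. i < k \<and> e \<in> {1..n} \<longrightarrow> homogeneous_form 1 F \<and>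
      (\<forall>q\<in>XR \<times> XL. glue_matrix q $$ (i, e - 1) = F (?h q))"
    using glue_entry_form by blast
  then obtain F where F: "\<And>i e. i < k \<Longrightarrow> e \<in> {1..n} \<Longrightarrow> homogeneous_form 1 (F i e)"
    "\<And>i e q. i < k \<Longrightarrow> e \<in> {1..n} \<Longrightarrow> q \<in> XR \<times> XL \<Longrightarrow> glue_matrix q $$ (i, e - 1) = F i e (?h q)"
    by metis
  define G where "G S x = (if S \<subseteq> {1..n} \<and> card S = k
    then det (mat k k (\<lambda>(i, j). F i (enum_set S j) x)) else 0)" for S x
  have enum: "enum_set S j \<in> {1..n}" if "S \<subseteq> {1..n}" "card S = k" "j < k" for S j
    using bij_betwE[OF enum_set_bij[OF that(1,2)]] that(1,3) by blast
  show ?thesis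
  \<comment> \<open>The Pluecker coordinates of the glued point are minors of size \<open>k\<close>
    of a matrix of linear forms.\<close>
  proof (rule variety_morphism_homogeneous[where d = "k * 1" and G = G])
    show "glue ` (XR \<times> XL) \<subseteq> X" using glue_positroid by auto
  next
    fix S
    show "homogeneous_form (k * 1) (G S)"
    proof (cases "S \<subseteq> {1..n} \<and> card S = k")
      case True
      have "homogeneous_form (k * 1) (\<lambda>x. det (mat k k (\<lambda>(i, j). F i (enum_set S j) x)))"
        by (rule homogeneous_form_det) (use F(1) enum True in blast)
      then show ?thesis unfolding G_def using True by (simp only: if_True simp_thms)
    next
      case False
      then show ?thesis unfolding G_def by (simp only: if_False homogeneous_form_zero)
    qed
  next
    fix q assume q: "q \<in> XR \<times> XL"
    then have "represents k n (glue_matrix q) (glue q)" using represents_glue by (cases q) auto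
    from plucker_representation[OF this] obtain s where s: "s \<noteq> 0"
      "\<And>S. S \<subseteq> {1..n} \<and> card S = k \<Longrightarrow> plucker k n (glue q) S = s * tuple_minor k (glue_matrix q) (enum_set S)"
      by blast
    have "plucker k n (glue q) S = s * G S (?h q)" for S
    proof (cases "S \<subseteq> {1..n} \<and> card S = k")
      case True
      have "mat k k (\<lambda>(i, j). glue_matrix q $$ (i, enum_set S j - 1)) =
          mat k k (\<lambda>(i, j). F i (enum_set S j) (?h q))"
        by (rule cong_mat[OF refl refl]) (use F(2)[OF _ _ q] enum True in auto)
      then show ?thesis using s(2)[OF True] True unfolding G_def tuple_minor_def by simp
    next
      case False
      then show ?thesis by (auto simp: plucker_def G_def)
    qed
    then show "\<exists>s. s \<noteq> 0 \<and> (\<forall>S. plucker k n (glue q) S = s * G S (?h q))" using s(1) by blast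
  qed
qed

lemma variety_isomorphic_cut:
  "variety_isomorphic (plucker k n) X (segre (plucker k nR) (plucker k nL)) (XR \<times> XL)"
  unfolding variety_isomorphic_def
proof (intro exI conjI ballI)
  fix V assume V: "V \<in> X"
  note VRL = pull_positroid[OF V]
  from glue_positroid[OF this] have g: "glue (cut_map V) \<in> X" by (simp only: cut_map_def)
  have eq: "pull nR idx_right (glue (cut_map V)) = pull nR idx_right V"
    "pull nL idx_left (glue (cut_map V)) = pull nL idx_left V"
    using pull_glue[OF VRL] by (simp_all only: cut_map_def)
  show "glue (cut_map V) = V"
    using pull_subset[OF g V eq] pull_subset[OF V g eq[symmetric]] by (rule equalityI)
next
  fix q assume "q \<in> XR \<times> XL"
  then show "cut_map (glue q) = q" using pull_glue by (cases q) (auto simp: cut_map_def)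
qed (rule variety_morphism_cut_map variety_morphism_glue)+

lemma U_set_eq: "U_set k n lam mu a = X"
proof -
  have "plucker k n V (I_prime k n mu a i) \<noteq> 0" if V: "V \<in> X" and i: "i \<in> {m + 1..h a}" for V i
  proof -
    have VG: "V \<in> Gr k n" and D: "skew_dep k n lam mu (dep V)" using V unfolding positroid_iff by blast+
    interpret column_cut_dep k n lam mu a "dep V" by (rule dep_Gr[OF VG])
    have ik: "i \<in> {1..k}" "m < i" "i \<le> h a" using i col_height_le[of k n lam a] by auto
    show ?thesis
      unfolding plucker_nonzero_iff[OF VG I_prime_subset[OF ik(1)] I_prime_card[OF ik(1)]]
      using dep_on_I_prime[OF D ik(2,3)] by blast
  qed
  then show ?thesis unfolding U_set_def by blast
qed

end

theorem corollary1p1p4: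
  fixes k n a :: nat and lam mu :: "nat \<Rightarrow> nat"
  assumes "0 < k" and "k < n"
    and "partition_in_box k (n - k) lam"
    and "partition_in_box k (n - k) mu"
    and "\<forall>i\<in>{1..k}. mu i \<le> lam i"
    and "1 \<le> a" and "a \<le> n - k"
    and "\<forall>i. (a, i) \<in> skew_diagram k n lam mu \<longrightarrow> (a, i) \<in> boundary_ribbon k n lam mu"
  shows "openin (zariski (plucker k n) (skew_positroid k n lam mu)) (U_set k n lam mu a) \<and>
    U_set k n lam mu a = skew_positroid k n lam mu \<and>
    variety_isomorphic
      (plucker k n) (skew_positroid k n lam mu)
      (segre (plucker k (k + a - 1)) (plucker k (n - a + 1)))
      (skew_positroid k (k + a - 1) (cut_right k n a lam) (cut_right k n a mu) \<times>
       skew_positroid k (n - a + 1) (cut_left k n a lam) (cut_left k n a mu))"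
proof -
  interpret column_cut k n lam mu a
  proof
    fix c assume c: "1 \<le> c" "c < a"
    have le: "col_height k n lam c \<le> col_height k n lam (a - 1)" "col_height k n lam (a - 1) \<le> col_height k n lam a"
      using c by (auto intro: col_height_mono)
    show "col_height k n lam c \<le> Suc (col_height k n mu a)"
    proof (cases "col_height k n mu a < col_height k n lam a")
      case True
      \<comment> \<open>The lowest skew box of column \<open>a\<close> is chosen, since its
        northeast neighbour gives the strongest bound on column \<open>a - 1\<close>.\<close>
      then have "(a, Suc (col_height k n mu a)) \<in> skew_diagram k n lam mu"
        using assms(6,7) by (auto simp: skew_diagram_def diagram_def)
      then have "(a - 1, Suc (col_height k n mu a) + 1) \<notin> diagram k n lam"
        using assms(8) by (auto simp: boundary_ribbon_def)
      \<comment> \<open>As \<open>c < a\<close>, the column \<open>a - 1\<close> exists, so absence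
        from the diagram really bounds its height.\<close>
      moreover have "a - 1 \<in> {1..n - k}" using c assms(7) by auto
      ultimately show ?thesis using le(1) by (auto simp: diagram_def)
    qed (use le in auto)
  qed (use assms in auto)
  show ?thesis
    using U_set_eq variety_isomorphic_cut
      openin_topspace[of "zariski (plucker k n) (skew_positroid k n lam mu)"] by simp
qed

end
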